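(* Let $M$ be a compact embedded surface of constant mean curvature in $\mathrm{Sol}$ bounded by a closed curve $\Gamma=\partial M$ contained in the plane $P=\{(0,y,z):y,z\in\mathbb{R}\}$. Denote by $D$ the bounded domain determined by $\partial M$ in $P$. Assume that $M$ lies in one side of $P$ and that $M$ is a graph on $D$ around $\Gamma$. Then $M$ is a graph on $D$.
   Context: $\mathrm{Sol}$ is $\mathbb{R}^3$ with canonical coordinates $(x,y,z)$ and the Riemannian metric $e^{2z}dx^2+e^{-2z}dy^2+dz^2$. "$M$ lies in one side of $P$" means (up to the reflection $(x,y,z)\mapsto(-x,y,z)$, which is an isometry) that $M\subset P^+=\{(x,y,z):x\ge 0\}$ and $M\setminus\partial M\subset\{(x,y,z):x>0\}$. The (Killing) graph of a function $u$ on a domain of $P$ is the surface $\{\Psi(u(p),p)\}$, $p$ in the domain, where $\Psi:\mathbb{R}\times P\to\mathrm{Sol}$ is the flow of the Killing vector field $\partial/\partial x$, orthogonal to $P$; explicitly it is the set of points $(u(0,y,z),y,z)$ with $(0,y,z)$ in the domain (so it is a graph in the usual Euclidean sense in the $x$-direction). "$M$ is a graph on $D$ around $\Gamma$" means that a neighbourhood of $\Gamma$ in $M$ is a graph over a neighbourhood of $\Gamma$ in $D$ (with the boundary $\Gamma$ included). *)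

theory Defs
  imports "HOL-Analysis.Analysis"
begin

section \<open>Smooth maps on open sets\<close>

primrec Ck_on :: "nat \<Rightarrow> ('a::euclidean_space \<Rightarrow> 'b::real_normed_vector) \<Rightarrow> 'a set \<Rightarrow> bool" where
  "Ck_on 0 f S \<longleftrightarrow> continuous_on S f"
| "Ck_on (Suc k) f S \<longleftrightarrow>
     f differentiable_on S \<and> (\<forall>b\<in>Basis. Ck_on k (\<lambda>x. frechet_derivative f (at x) b) S)"

text \<open>Only meaningful for open \<open>S\<close>, because the derivatives are taken at \<open>at x\<close>.\<close>

definition smooth_on :: "'a::euclidean_space set \<Rightarrow> ('a \<Rightarrow> 'b::real_normed_vector) \<Rightarrow> bool" where
  "smooth_on S f \<longleftrightarrow> (\<forall>k. Ck_on k f S)"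

definition partial :: "'n::finite \<Rightarrow> (real^'n \<Rightarrow> 'b::real_normed_vector) \<Rightarrow> real^'n \<Rightarrow> 'b" where
  "partial i f x = frechet_derivative f (at x) (axis i 1)"


section \<open>The Riemannian manifold Sol\<close>

text \<open>Sol is \<open>real^3\<close>; the coordinates \<open>x, y, z\<close> are the components 1, 2, 3.\<close>

definition sol_metric :: "real^3 \<Rightarrow> real^3^3" where
  "sol_metric p = (\<chi> i j. if i \<noteq> j then 0
     else if i = 1 then exp (2 * p$3) else if i = 2 then exp (- 2 * p$3) else 1)"

definition sol_inner :: "real^3 \<Rightarrow> real^3 \<Rightarrow> real^3 \<Rightarrow> real" where
  "sol_inner p v w = v \<bullet> (sol_metric p *v w)"

text \<open>Christoffel symbols \<open>\<Gamma>\<^sup>k\<^sub>i\<^sub>j\<close> of the Levi-Civita connection.\<close>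

definition christoffel :: "real^3 \<Rightarrow> 3 \<Rightarrow> 3 \<Rightarrow> 3 \<Rightarrow> real" where
  "christoffel p k i j = (\<Sum>l\<in>UNIV. matrix_inv (sol_metric p) $ k $ l *
     (partial i (\<lambda>q. sol_metric q $ j $ l) p + partial j (\<lambda>q. sol_metric q $ i $ l) p
      - partial l (\<lambda>q. sol_metric q $ i $ j) p)) / 2"


section \<open>Embedded surfaces with boundary\<close>

definition half_plane :: "(real^2) set" where
  "half_plane = {u. u$1 \<ge> 0}"

text \<open>
  A local parametrization is a smooth immersion of a relatively open piece \<open>U \<inter> half_plane\<close> of the
  half plane, smoothly extended to \<open>U\<close>, which is a homeomorphism onto a subset that is open in \<open>M\<close> for
  the topology induced from the ambient space. The extension carries no information about \<open>M\<close>
  outside the half plane. Ordinary parametrizations are those with \<open>U\<close> inside \<open>u$1 > 0\<close>.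
\<close>

definition local_param :: "(real^3) set \<Rightarrow> (real^2) set \<Rightarrow> (real^2 \<Rightarrow> real^3) \<Rightarrow> bool" where
  "local_param M U X \<longleftrightarrow>
     open U \<and> smooth_on U X \<and>
     (\<forall>u\<in>U \<inter> half_plane. inj (frechet_derivative X (at u))) \<and>
     openin (top_of_set M) (X ` (U \<inter> half_plane)) \<and>
     (\<exists>Y. homeomorphism (U \<inter> half_plane) (X ` (U \<inter> half_plane)) X Y)"

definition embedded_surface :: "(real^3) set \<Rightarrow> bool" where
  "embedded_surface M \<longleftrightarrow>
     (\<forall>p\<in>M. \<exists>U X. local_param M U X \<and> p \<in> X ` (U \<inter> half_plane))"

definition surface_boundary :: "(real^3) set \<Rightarrow> (real^3) set" where
  "surface_boundary M = {p. \<exists>U X u. local_param M U X \<and> u \<in> U \<and> u$1 = 0 \<and> X u = p}"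


section \<open>Mean curvature in Sol\<close>

definition first_fundamental_form :: "(real^2 \<Rightarrow> real^3) \<Rightarrow> real^2 \<Rightarrow> real^2^2" where
  "first_fundamental_form X u = (\<chi> a b. sol_inner (X u) (partial a X u) (partial b X u))"

text \<open>The covariant derivative, along \<open>X\<close> in direction \<open>a\<close>, of the coordinate field \<open>partial b X\<close>.\<close>

definition cov_deriv :: "(real^2 \<Rightarrow> real^3) \<Rightarrow> 2 \<Rightarrow> 2 \<Rightarrow> real^2 \<Rightarrow> real^3" where
  "cov_deriv X a b u = partial a (partial b X) u +
     (\<chi> k. \<Sum>i\<in>UNIV. \<Sum>j\<in>UNIV. christoffel (X u) k i j * partial a X u $ i * partial b X u $ j)"

definition second_fundamental_form ::
    "(real^2 \<Rightarrow> real^3) \<Rightarrow> real^3 \<Rightarrow> real^2 \<Rightarrow> real^2^2" where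
  "second_fundamental_form X n u = (\<chi> a b. sol_inner (X u) (cov_deriv X a b u) n)"

text \<open>Half the trace of the shape operator, at \<open>X u\<close>, with respect to the unit normal \<open>n\<close>.\<close>

definition mean_curvature :: "(real^2 \<Rightarrow> real^3) \<Rightarrow> real^3 \<Rightarrow> real^2 \<Rightarrow> real" where
  "mean_curvature X n u =
     trace (matrix_inv (first_fundamental_form X u) ** second_fundamental_form X n u) / 2"

definition unit_normal_field :: "(real^3) set \<Rightarrow> (real^3 \<Rightarrow> real^3) \<Rightarrow> bool" where
  "unit_normal_field M N \<longleftrightarrow>
     continuous_on M N \<and> (\<forall>p\<in>M. sol_inner p (N p) (N p) = 1) \<and>
     (\<forall>U X. local_param M U X \<longrightarrow>
        (\<forall>u\<in>U \<inter> half_plane. \<forall>a. sol_inner (X u) (partial a X u) (N (X u)) = 0))"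

definition constant_mean_curvature :: "(real^3) set \<Rightarrow> bool" where
  "constant_mean_curvature M \<longleftrightarrow>
     (\<exists>N H. unit_normal_field M N \<and>
        (\<forall>U X. local_param M U X \<longrightarrow>
           (\<forall>u\<in>U \<inter> half_plane. mean_curvature X (N (X u)) u = H)))"


section \<open>The plane \<open>P\<close> and Killing graphs\<close>

definition plane_P :: "(real^3) set" where
  "plane_P = {p. p$1 = 0}"

text \<open>Subsets of \<open>P\<close> are described by their coordinates \<open>(y, z)\<close>, so that topological notions such as
  \<open>inside\<close> and \<open>interior\<close> are those of the plane.\<close>

definition P_point :: "real^2 \<Rightarrow> real^3" where
  "P_point q = vector [0, q$1, q$2]"

definition killing_flow :: "real \<Rightarrow> real^3 \<Rightarrow> real^3" where
  "killing_flow s p = p + s *\<^sub>R axis 1 1"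

definition closed_curve :: "(real^3) set \<Rightarrow> bool" where
  "closed_curve C \<longleftrightarrow>
     (\<exists>c. simple_path c \<and> pathfinish c = pathstart c \<and> path_image c = C)"

definition bounded_domain :: "(real^3) set \<Rightarrow> (real^2) set" where
  "bounded_domain C = inside (P_point -` C)"

definition one_side_of_P :: "(real^3) set \<Rightarrow> bool" where
  "one_side_of_P M \<longleftrightarrow>
     (M \<subseteq> {p. p$1 \<ge> 0} \<and> M - surface_boundary M \<subseteq> {p. p$1 > 0}) \<or>
     (M \<subseteq> {p. p$1 \<le> 0} \<and> M - surface_boundary M \<subseteq> {p. p$1 < 0})"

text \<open>\<open>A\<close> will be the closure of a domain \<open>D\<close>, or a relatively open subset of it. The function is
  continuous up to the boundary and smooth inside; its slope may be infinite at the boundary.\<close>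

definition killing_graph :: "(real^2) set \<Rightarrow> (real^3) set \<Rightarrow> bool" where
  "killing_graph A S \<longleftrightarrow>
     (\<exists>u::real^2 \<Rightarrow> real. continuous_on A u \<and> smooth_on (interior A) u \<and>
        S = (\<lambda>q. killing_flow (u q) (P_point q)) ` A)"

definition graph_around :: "(real^3) set \<Rightarrow> (real^2) set \<Rightarrow> (real^3) set \<Rightarrow> bool" where
  "graph_around M D C \<longleftrightarrow>
     (\<exists>V A. openin (top_of_set M) V \<and> C \<subseteq> V \<and>
        openin (top_of_set (closure D)) A \<and> P_point -` C \<subseteq> A \<and> killing_graph A V)"

end

theory Submission
  imports Defs
begin

text \<open>
  The proof is Alexandrov's reflection method with the mirrors \<open>x = T\<close>. Reflections in these planes
  are isometries of Sol because the metric coefficients depend on \<open>z\<close> only. After a reflection in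
  \<open>P\<close>, if necessary, the surface lies in \<open>x \<ge> 0\<close>; let \<open>S\<close> be the surface without its boundary.

  Consider the pairs of distinct points of \<open>M\<close> on a common line parallel to the \<open>x\<close>-axis, together
  with their degenerate limits, the points of \<open>S\<close> whose tangent plane contains the \<open>x\<close>-direction
  (\<open>reflection_pairs\<close>). If there are none, the projection of \<open>S\<close> to the plane is injective and open,
  its image is open and closed in the complement of the boundary curve, hence equal to \<open>D\<close>, and the
  inverse of the projection is the required graph (\<open>killing_graph_M\<close>).

  If there are pairs, choose one whose midpoint has the largest height \<open>T\<close> (\<open>maximal_pair\<close>). By
  maximality, near such a pair the lower sheet stays on one side of the mirror image of the upper
  sheet and touches it; for a degenerate pair the two halves of a sheet cut by the mirror are compared
  in the same way. The strong maximum principle, respectively the boundary point lemma of Hopf, gives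
  local symmetry (\<open>contact_interior\<close>, \<open>contact_vertical\<close>). The set of points where this contact happens
  is therefore open and closed in the connected surface \<open>S\<close>, hence all of \<open>S\<close>. Points of \<open>S\<close> close to
  the boundary curve are then reflected to points of \<open>M\<close> at height close to \<open>2 T\<close>, so \<open>M\<close> contains
  points at height \<open>2 T\<close> over the curve, and \<open>no_high_boundary_column\<close> excludes this.

  Two sheets can be compared only if their normals agree after the reflection, so the normal has to
  alternate along a line. This is a separation property. It is obtained from a real function that
  vanishes exactly on \<open>S\<close> and increases along the normal (\<open>crossing_function\<close>): a circle-valued
  function winding once across the surface lifts to the reals because the ambient open set is
  contractible. That open set is the complement of the half cylinder below \<open>D\<close>; it contains the points
  above the boundary curve and connects them to infinity without meeting \<open>M\<close>, because \<open>M\<close> is a graph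
  on \<open>D\<close> around \<open>\<Gamma>\<close>. This gives \<open>opposite_normals\<close> and \<open>boundary_column\<close>.

  On the analytic side, near every interior point \<open>M\<close> is a graph \<open>x\<^sub>k = f(x\<^sub>i, x\<^sub>j)\<close> in some coordinate
  direction \<open>k\<close> (\<open>local_graph_exists\<close>), and constant mean curvature is a quasilinear elliptic equation
  for \<open>f\<close> with coefficients depending on the 1-jet in a Lipschitz way. If two solutions agree to first
  order at a point, their difference \<open>w\<close> satisfies \<open>\<bar>a:D\<^sup>2w\<bar> \<le> K (\<bar>w\<bar> + \<bar>Dw\<bar>)\<close> near that point
  (\<open>elliptic_difference\<close>), and this inequality is all that the barrier argument of Hopf requires.
\<close>

section \<open>Calculus of smooth maps\<close>

lemma Ck_on_cong:
  assumes "open S" "Ck_on k f S" "\<And>x. x \<in> S \<Longrightarrow> f x = g x"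
  shows "Ck_on k g S"
  using assms(2,3)
proof (induction k arbitrary: f g)
  case 0
  then show ?case by (metis Ck_on.simps(1) continuous_on_cong)
next
  case (Suc k)
  have d: "(g has_derivative frechet_derivative f (at x)) (at x)" if "x \<in> S" for x
  proof -
    have "f differentiable at x"
      using Suc.prems(1) that \<open>open S\<close> by (auto simp: differentiable_on_eq_differentiable_at)
    then have "(f has_derivative frechet_derivative f (at x)) (at x)"
      using frechet_derivative_works by blast
    then show ?thesis
      using has_derivative_transform_within_open[OF _ \<open>open S\<close> that] Suc.prems(2) by blast
  qed
  then have e: "frechet_derivative f (at x) = frechet_derivative g (at x)" if "x \<in> S" for x
    using that frechet_derivative_at by blast
  have "g differentiable_on S"
    using d \<open>open S\<close> by (meson differentiableI differentiable_on_eq_differentiable_at)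
  moreover have "Ck_on k (\<lambda>x. frechet_derivative g (at x) b) S" if "b \<in> Basis" for b
  proof (rule Suc.IH)
    show "Ck_on k (\<lambda>x. frechet_derivative f (at x) b) S" using Suc.prems(1) that by simp
  qed (simp add: e)
  ultimately show ?case by simp
qed

lemma Ck_on_Suc_I:
  assumes "open S" "\<And>x. x \<in> S \<Longrightarrow> (f has_derivative f' x) (at x)"
    and "\<And>b. b \<in> Basis \<Longrightarrow> Ck_on k (\<lambda>x. f' x b) S"
  shows "Ck_on (Suc k) f S"
proof -
  have "f differentiable_on S"
    using assms(1,2) by (meson differentiableI differentiable_on_eq_differentiable_at)
  moreover have "f' x = frechet_derivative f (at x)" if "x \<in> S" for x
    using assms(2)[OF that] frechet_derivative_at by blast
  ultimately show ?thesis
    using Ck_on_cong[OF \<open>open S\<close> assms(3)] by simp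
qed

lemma Ck_on_has_derivative:
  assumes "open S" "Ck_on (Suc k) f S" "x \<in> S"
  shows "(f has_derivative frechet_derivative f (at x)) (at x)"
  using assms by (auto simp: differentiable_on_eq_differentiable_at frechet_derivative_works)

lemma Ck_on_Suc_imp: "Ck_on (Suc k) f S \<Longrightarrow> Ck_on k f S"
  by (induction k arbitrary: f) (auto simp: differentiable_imp_continuous_on)

lemma Ck_on_subset: "Ck_on k f S \<Longrightarrow> T \<subseteq> S \<Longrightarrow> Ck_on k f T"
  by (induction k arbitrary: f) (auto intro: continuous_on_subset differentiable_on_subset)

lemma Ck_on_imp_continuous: "Ck_on k f S \<Longrightarrow> continuous_on S f"
  by (cases k) (auto simp: differentiable_imp_continuous_on)

lemma Ck_on_open_Union:
  assumes "\<And>x. x \<in> S \<Longrightarrow> \<exists>T. open T \<and> x \<in> T \<and> Ck_on k f T"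
  shows "Ck_on k f S"
  using assms
proof (induction k arbitrary: f)
  case 0
  then show ?case
    by (metis Ck_on.simps(1) continuous_at_imp_continuous_on continuous_on_eq_continuous_at)
next
  case (Suc k)
  have "f differentiable at x" if x: "x \<in> S" for x
  proof -
    obtain T where "open T" "x \<in> T" "Ck_on (Suc k) f T" using Suc.prems[OF x] by auto
    then show ?thesis by (auto simp: differentiable_on_eq_differentiable_at)
  qed
  moreover have "Ck_on k (\<lambda>x. frechet_derivative f (at x) b) S" if "b \<in> Basis" for b
  proof (rule Suc.IH)
    fix x assume "x \<in> S"
    with Suc.prems obtain T where "open T" "x \<in> T" "Ck_on (Suc k) f T" by auto
    then show "\<exists>T. open T \<and> x \<in> T \<and> Ck_on k (\<lambda>x. frechet_derivative f (at x) b) T"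
      using that by auto
  qed
  moreover have "f differentiable_on S"
    using \<open>\<And>x. x \<in> S \<Longrightarrow> f differentiable at x\<close> unfolding differentiable_on_def
    by (blast intro: differentiable_at_withinI)
  ultimately show ?case by simp
qed

lemma Ck_on_const: "Ck_on k (\<lambda>x. c) S"
  by (induction k arbitrary: c) auto

lemma Ck_on_bounded_linear:
  assumes "open S" "bounded_linear L" "Ck_on k f S"
  shows "Ck_on k (\<lambda>x. L (f x)) S"
  using assms(3)
proof (induction k arbitrary: f)
  case 0
  then show ?case using assms(2) by (auto intro: bounded_linear.continuous_on)
next
  case (Suc k)
  have "((\<lambda>x. L (f x)) has_derivative (\<lambda>h. L (frechet_derivative f (at x) h))) (at x)" if "x \<in> S" for x
    using bounded_linear.has_derivative[OF assms(2) Ck_on_has_derivative[OF \<open>open S\<close> Suc.prems that]] .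
  moreover have "Ck_on k (\<lambda>x. L (frechet_derivative f (at x) b)) S" if "b \<in> Basis" for b
    using Suc.prems that by (intro Suc.IH) simp_all
  ultimately show ?case
    by (rule Ck_on_Suc_I[OF \<open>open S\<close>])
qed

lemma Ck_on_add:
  assumes "open S" "Ck_on k f S" "Ck_on k g S"
  shows "Ck_on k (\<lambda>x. f x + g x) S"
  using assms(2,3)
proof (induction k arbitrary: f g)
  case 0
  then show ?case by (auto intro: continuous_intros)
next
  case (Suc k)
  have "((\<lambda>x. f x + g x) has_derivative
     (\<lambda>h. frechet_derivative f (at x) h + frechet_derivative g (at x) h)) (at x)" if "x \<in> S" for x
    using that Suc.prems \<open>open S\<close> by (intro has_derivative_add Ck_on_has_derivative)
  moreover have "Ck_on k (\<lambda>x. frechet_derivative f (at x) b + frechet_derivative g (at x) b) S" if "b \<in> Basis" for b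
    using Suc.prems that by (intro Suc.IH) simp_all
  ultimately show ?case
    by (rule Ck_on_Suc_I[OF \<open>open S\<close>])
qed

lemma Ck_on_sum:
  assumes "open S" "finite I" "\<And>i. i \<in> I \<Longrightarrow> Ck_on k (f i) S"
  shows "Ck_on k (\<lambda>x. \<Sum>i\<in>I. f i x) S"
  using assms(2,3) by (induction I) (auto intro: Ck_on_const Ck_on_add[OF \<open>open S\<close>])

lemma Ck_on_mult:
  fixes f g :: "'a::euclidean_space \<Rightarrow> real"
  assumes "open S" "Ck_on k f S" "Ck_on k g S"
  shows "Ck_on k (\<lambda>x. f x * g x) S"
  using assms(2,3)
proof (induction k arbitrary: f g)
  case 0
  then show ?case by (auto intro: continuous_intros)
next
  case (Suc k)
  have "((\<lambda>x. f x * g x) has_derivative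
     (\<lambda>h. f x * frechet_derivative g (at x) h + frechet_derivative f (at x) h * g x)) (at x)" if "x \<in> S" for x
    using that Suc.prems \<open>open S\<close> by (intro has_derivative_mult Ck_on_has_derivative)
  moreover have "Ck_on k (\<lambda>x. f x * frechet_derivative g (at x) b + frechet_derivative f (at x) b * g x) S"
    if "b \<in> Basis" for b
    using Suc.prems that Suc.prems[THEN Ck_on_Suc_imp] by (intro Ck_on_add Suc.IH \<open>open S\<close>) simp_all
  ultimately show ?case
    by (rule Ck_on_Suc_I[OF \<open>open S\<close>])
qed

lemma Ck_on_inverse:
  fixes f :: "'a::euclidean_space \<Rightarrow> real"
  assumes "open S" "Ck_on k f S" "\<And>x. x \<in> S \<Longrightarrow> f x \<noteq> 0"
  shows "Ck_on k (\<lambda>x. inverse (f x)) S"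
  using assms(2)
proof (induction k)
  case 0
  then show ?case using assms(3) by (auto intro!: continuous_intros)
next
  case (Suc k)
  have "((\<lambda>x. inverse (f x)) has_derivative
     (\<lambda>h. - (inverse (f x) * frechet_derivative f (at x) h * inverse (f x)))) (at x)" if "x \<in> S" for x
    using that Suc.prems \<open>open S\<close> assms(3) by (intro Deriv.has_derivative_inverse Ck_on_has_derivative) auto
  moreover have "Ck_on k (\<lambda>x. inverse (f x)) S" using Suc.IH Suc.prems[THEN Ck_on_Suc_imp] by simp
  moreover have "Ck_on k (\<lambda>x. -1 * (inverse (f x) * frechet_derivative f (at x) b * inverse (f x))) S" 
    if "b \<in> Basis" for b
    using Suc.prems that calculation(2) by (intro Ck_on_mult \<open>open S\<close> Ck_on_const) simp_all
  ultimately show ?case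
    by (intro Ck_on_Suc_I[OF \<open>open S\<close>, where f' = "\<lambda>x h. - (inverse (f x) * frechet_derivative f (at x) h * inverse (f x))"])
      simp_all
qed

lemma Ck_on_components:
  fixes f :: "'a::euclidean_space \<Rightarrow> 'b::euclidean_space"
  assumes "open S" "\<And>c. c \<in> Basis \<Longrightarrow> Ck_on k (\<lambda>x. f x \<bullet> c) S"
  shows "Ck_on k f S"
proof -
  have "Ck_on k (\<lambda>x. \<Sum>c\<in>Basis. (f x \<bullet> c) *\<^sub>R c) S"
    by (intro Ck_on_sum assms(1) finite_Basis Ck_on_bounded_linear[OF assms(1) bounded_linear_scaleR_left] assms(2))
  then show ?thesis by (simp add: euclidean_representation)
qed

lemma Ck_on_compose:
  fixes g :: "'a::euclidean_space \<Rightarrow> 'b::euclidean_space" and f :: "'b \<Rightarrow> real"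
  assumes "open S" "open T" "Ck_on k f T" "Ck_on k g S" "g ` S \<subseteq> T"
  shows "Ck_on k (\<lambda>x. f (g x)) S"
  using assms(3,4)
proof (induction k arbitrary: f)
  case 0
  then show ?case using assms(5) by (auto intro: continuous_on_compose2)
next
  case (Suc k)
  have "((\<lambda>x. f (g x)) has_derivative
     (\<lambda>h. frechet_derivative f (at (g x)) (frechet_derivative g (at x) h))) (at x)" if "x \<in> S" for x
  proof -
    have "g x \<in> T" using that assms(5) by auto
    from has_derivative_compose[OF Ck_on_has_derivative[OF \<open>open S\<close> Suc.prems(2) that]
          Ck_on_has_derivative[OF \<open>open T\<close> Suc.prems(1) this]]
    show ?thesis .
  qed
  moreover have "Ck_on k (\<lambda>x. frechet_derivative f (at (g x)) (frechet_derivative g (at x) b)) S" 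
    if "b \<in> Basis" for b
  proof (rule Ck_on_cong[OF \<open>open S\<close>])
    show "Ck_on k (\<lambda>x. \<Sum>c\<in>Basis. (frechet_derivative g (at x) b \<bullet> c) * frechet_derivative f (at (g x)) c) S"
      using Suc.prems that Suc.prems(2)[THEN Ck_on_Suc_imp]
      by (intro Ck_on_sum assms(1) finite_Basis Ck_on_mult Suc.IH
          Ck_on_bounded_linear[OF assms(1) bounded_linear_inner_left]) simp_all
    fix x assume "x \<in> S"
    then have "g x \<in> T" using assms(5) by auto
    then have "linear (frechet_derivative f (at (g x)))"
      using Suc.prems(1) \<open>open T\<close> has_derivative_linear Ck_on_has_derivative by blast
    then show "(\<Sum>c\<in>Basis. (frechet_derivative g (at x) b \<bullet> c) * frechet_derivative f (at (g x)) c)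
       = frechet_derivative f (at (g x)) (frechet_derivative g (at x) b)"
      by (subst (2) euclidean_representation[of "frechet_derivative g (at x) b", symmetric])
         (simp add: linear_sum linear_cmul)
  qed
  ultimately show ?case
    by (rule Ck_on_Suc_I[OF \<open>open S\<close>])
qed

lemma Ck_on_vec_iff:
  fixes f :: "'a::euclidean_space \<Rightarrow> real^'n"
  assumes "open S"
  shows "Ck_on k f S \<longleftrightarrow> (\<forall>i. Ck_on k (\<lambda>x. f x $ i) S)"
proof (intro iffI allI)
  fix i assume f: "Ck_on k f S"
  show "Ck_on k (\<lambda>x. f x $ i) S"
    by (rule Ck_on_bounded_linear[OF assms bounded_linear_vec_nth f])
next
  assume f: "\<forall>i. Ck_on k (\<lambda>x. f x $ i) S"
  show "Ck_on k f S"
  proof (rule Ck_on_components[OF assms])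
    fix c :: "real^'n" assume "c \<in> Basis"
    then obtain i where "c = axis i 1" by (auto simp: Basis_vec_def)
    then have "(\<lambda>x. f x \<bullet> c) = (\<lambda>x. f x $ i)" by (simp add: inner_axis)
    then show "Ck_on k (\<lambda>x. f x \<bullet> c) S" using f by metis
  qed
qed

lemma Ck_on_Suc_partial:
  fixes f :: "real^'n \<Rightarrow> 'b::real_normed_vector"
  shows "Ck_on (Suc k) f S \<longleftrightarrow> f differentiable_on S \<and> (\<forall>i. Ck_on k (partial i f) S)"
  by (auto simp: partial_def[abs_def] Basis_vec_def)

lemma has_derivative_partial:
  fixes f :: "real^'n \<Rightarrow> 'b::real_normed_vector"
  assumes "f differentiable at x"
  shows "(f has_derivative (\<lambda>h. \<Sum>i\<in>UNIV. (h $ i) *\<^sub>R partial i f x)) (at x)"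
proof -
  have d: "(f has_derivative frechet_derivative f (at x)) (at x)"
    using assms frechet_derivative_works by blast
  have "frechet_derivative f (at x) h = (\<Sum>i\<in>UNIV. (h $ i) *\<^sub>R partial i f x)" for h
    unfolding partial_def
    by (subst (1) basis_expansion[of h, symmetric])
       (simp add: linear_sum[OF has_derivative_linear[OF d]] linear_cmul[OF has_derivative_linear[OF d]] scalar_mult_eq_scaleR)
  with d show ?thesis by (metis (no_types, lifting) ext)
qed

lemma partial_eqI:
  "(f has_derivative f') (at x) \<Longrightarrow> partial i f x = f' (axis i 1)"
  unfolding partial_def by (metis frechet_derivative_at)

lemma smooth_on_partial:
  fixes f :: "real^'n \<Rightarrow> 'b::real_normed_vector"
  shows "smooth_on S f \<Longrightarrow> smooth_on S (partial i f)"
  unfolding smooth_on_def using Ck_on_Suc_partial by blast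

lemma smooth_on_differentiable:
  "open S \<Longrightarrow> smooth_on S f \<Longrightarrow> x \<in> S \<Longrightarrow> f differentiable at x"
  unfolding smooth_on_def by (metis Ck_on.simps(2) differentiable_on_eq_differentiable_at)

lemma smooth_on_continuous: "smooth_on S f \<Longrightarrow> continuous_on S f"
  unfolding smooth_on_def by (metis Ck_on_imp_continuous)

lemma smooth_on_subset: "smooth_on S f \<Longrightarrow> T \<subseteq> S \<Longrightarrow> smooth_on T f"
  unfolding smooth_on_def by (metis Ck_on_subset)

text \<open>The partial derivatives of the inverse are rational functions of those of the map, evaluated at the
  inverse itself; so one more degree of smoothness is gained at each step of the induction.\<close>

lemma Ck_on_inverse_map:
  fixes \<phi> g :: "real^2 \<Rightarrow> real^2"
  assumes U: "open U" and V: "open V" and \<phi>: "smooth_on U \<phi>" and gV: "g ` V \<subseteq> U"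
    and der: "\<And>y. y \<in> V \<Longrightarrow> g differentiable (at y)"
    and right: "\<And>y. y \<in> V \<Longrightarrow> \<phi> (g y) = y"
  shows "Ck_on k g V"
proof (induction k)
  case 0
  show ?case using der V
    by (simp add: continuous_on_eq_continuous_at differentiable_imp_continuous_within)
next
  case (Suc k)
  define P where "P a b x = partial b \<phi> x $ a" for a b x
  define J where "J x = P 1 1 x * P 2 2 x - P 1 2 x * P 2 1 x" for x
  define q where "q a b y = partial b g y $ a" for a b y
  have eq: "P a 1 (g y) * q 1 b y + P a 2 (g y) * q 2 b y = axis b 1 $ a" if "y \<in> V" for y a b
  proof -
    have d1: "(\<phi> has_derivative (\<lambda>h. \<Sum>i\<in>UNIV. (h $ i) *\<^sub>R partial i \<phi> (g y))) (at (g y))"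
      using that gV by (intro has_derivative_partial smooth_on_differentiable[OF U \<phi>]) auto
    have d2: "(g has_derivative (\<lambda>h. \<Sum>i\<in>UNIV. (h $ i) *\<^sub>R partial i g y)) (at y)"
      using that by (intro has_derivative_partial der) auto
    have "((\<lambda>y. \<phi> (g y)) has_derivative (\<lambda>h. h)) (at y)"
      by (rule has_derivative_transform_within_open[OF has_derivative_ident V that]) (simp add: right)
    from has_derivative_unique[OF this has_derivative_compose[OF d2 d1]]
    have "axis b 1 = (\<Sum>i\<in>UNIV. ((\<Sum>j\<in>UNIV. (axis b 1 $ j) *\<^sub>R partial j g y) $ i) *\<^sub>R partial i \<phi> (g y))"
      by metis
    also have "(\<Sum>j\<in>UNIV. (axis b 1 $ j) *\<^sub>R partial j g y) = partial b g y"
      using exhaust_2[of b] by (auto simp: sum_2 axis_def)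
    finally show ?thesis
      by (simp add: sum_2 P_def q_def mult.commute)
  qed
  have J: "J (g y) \<noteq> 0" if "y \<in> V" for y
  proof -
    have "J (g y) * (q 1 1 y * q 2 2 y - q 1 2 y * q 2 1 y) = 
      (P 1 1 (g y) * q 1 1 y + P 1 2 (g y) * q 2 1 y) * (P 2 1 (g y) * q 1 2 y + P 2 2 (g y) * q 2 2 y)
      - (P 1 1 (g y) * q 1 2 y + P 1 2 (g y) * q 2 2 y) * (P 2 1 (g y) * q 1 1 y + P 2 2 (g y) * q 2 1 y)"
      unfolding J_def by algebra
    also have "\<dots> = 1" unfolding eq[OF that] by (simp add: axis_def)
    finally show ?thesis by auto
  qed
  have Pk: "Ck_on k (\<lambda>y. P a b (g y)) V" for a b
    using \<phi>[THEN smooth_on_partial[where i=b]] unfolding P_def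
    by (intro Ck_on_compose[OF V U _ Suc gV]) (auto simp: smooth_on_def Ck_on_vec_iff[OF U])
  have Jk: "Ck_on k (\<lambda>y. inverse (J (g y))) V"
  proof (rule Ck_on_inverse[OF V _ J])
    have "Ck_on k (\<lambda>y. P 1 1 (g y) * P 2 2 (g y) + (-1) * (P 1 2 (g y) * P 2 1 (g y))) V"
      by (intro Ck_on_add Ck_on_mult Ck_on_const V Pk)
    then show "Ck_on k (\<lambda>y. J (g y)) V" by (simp add: J_def)
  qed auto
  have sol: "q 1 b y = (P 2 2 (g y) * axis b 1 $ 1 + (-1) * (P 1 2 (g y) * axis b 1 $ 2)) * inverse (J (g y))"
     "q 2 b y = (P 1 1 (g y) * axis b 1 $ 2 + (-1) * (P 2 1 (g y) * axis b 1 $ 1)) * inverse (J (g y))"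
    if "y \<in> V" for y b
  proof -
    have "P 2 2 (g y) * axis b 1 $ 1 + (-1) * (P 1 2 (g y) * axis b 1 $ 2) = q 1 b y * J (g y)"
      unfolding eq[OF that, symmetric] J_def by algebra
    then show "q 1 b y = (P 2 2 (g y) * axis b 1 $ 1 + (-1) * (P 1 2 (g y) * axis b 1 $ 2)) * inverse (J (g y))"
      using J[OF that] by (simp add: divide_simps)
    have "P 1 1 (g y) * axis b 1 $ 2 + (-1) * (P 2 1 (g y) * axis b 1 $ 1) = q 2 b y * J (g y)"
      unfolding eq[OF that, symmetric] J_def by algebra
    then show "q 2 b y = (P 1 1 (g y) * axis b 1 $ 2 + (-1) * (P 2 1 (g y) * axis b 1 $ 1)) * inverse (J (g y))"
      using J[OF that] by (simp add: divide_simps)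
  qed
  have "Ck_on k (\<lambda>y. q a b y) V" for a b
  proof -
    have "Ck_on k (\<lambda>y. q 1 b y) V"
      by (rule Ck_on_cong[OF V _ sol(1)[symmetric]]) (intro Ck_on_add Ck_on_mult Ck_on_const V Pk Jk, assumption)
    moreover have "Ck_on k (\<lambda>y. q 2 b y) V"
      by (rule Ck_on_cong[OF V _ sol(2)[symmetric]]) (intro Ck_on_add Ck_on_mult Ck_on_const V Pk Jk, assumption)
    ultimately show ?thesis using exhaust_2[of a] by auto
  qed
  then have "Ck_on k (partial b g) V" for b
    by (subst Ck_on_vec_iff[OF V]) (simp add: q_def)
  then show ?case
    using der by (simp add: Ck_on_Suc_partial differentiable_on_eq_differentiable_at V del: Ck_on.simps)
qed

section \<open>Surfaces as local graphs\<close>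

definition frame3 :: "3 \<Rightarrow> 3 \<Rightarrow> 3 \<Rightarrow> bool" where
  "frame3 i j k \<longleftrightarrow> i \<noteq> j \<and> j \<noteq> k \<and> i \<noteq> k"

lemma frame3_UNIV: "frame3 i j k \<Longrightarrow> (UNIV::3 set) = {i, j, k}"
  by (rule card_subset_eq[symmetric]) (auto simp: frame3_def)

lemma frame3_cases:
  assumes "frame3 i j k" shows "l = i \<or> l = j \<or> l = k"
proof -
  have "l \<in> {i, j, k}" using frame3_UNIV[OF assms] by (metis UNIV_I)
  then show ?thesis by simp
qed

lemma frame3_sum:
  fixes g :: "3 \<Rightarrow> 'a::comm_monoid_add"
  shows "frame3 i j k \<Longrightarrow> (\<Sum>l\<in>UNIV. g l) = g i + g j + g k"
  by (subst frame3_UNIV, assumption) (auto simp: frame3_def add.assoc)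

lemma frame3_eqI:
  fixes x y :: "'a^3"
  assumes "frame3 i j k" "x $ i = y $ i" "x $ j = y $ j" "x $ k = y $ k"
  shows "x = y"
proof (intro vec_eq_iff[THEN iffD2] allI)
  fix l show "x $ l = y $ l" using frame3_cases[OF assms(1), of l] assms(2-) by auto
qed

text \<open>In the sequel a frame \<open>i, j, k\<close> singles out the coordinate direction \<open>k\<close> in which a piece of the surface is a
  graph over the coordinates \<open>i, j\<close>: \<open>pr\<close> is the projection along \<open>k\<close>, and \<open>gpt\<close> is the point of height \<open>s\<close> over \<open>v\<close>.\<close>

definition pr :: "3 \<Rightarrow> 3 \<Rightarrow> real^3 \<Rightarrow> real^2" where
  "pr i j x = vector [x $ i, x $ j]"

definition gpt :: "3 \<Rightarrow> 3 \<Rightarrow> 3 \<Rightarrow> real^2 \<Rightarrow> real \<Rightarrow> real^3" where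
  "gpt i j k v s = (v $ 1) *\<^sub>R axis i 1 + (v $ 2) *\<^sub>R axis j 1 + s *\<^sub>R axis k 1"

lemma pr_nth [simp]: "pr i j x $ 1 = x $ i" "pr i j x $ 2 = x $ j"
  by (simp_all add: pr_def)

lemma gpt_nth [simp]:
  assumes "frame3 i j k"
  shows "gpt i j k v s $ i = v $ 1" "gpt i j k v s $ j = v $ 2" "gpt i j k v s $ k = s"
  using assms by (auto simp: gpt_def frame3_def axis_def)

lemma pr_gpt [simp]: "frame3 i j k \<Longrightarrow> pr i j (gpt i j k v s) = v"
  by (simp add: vec_eq_iff forall_2)

lemma gpt_pr: "frame3 i j k \<Longrightarrow> gpt i j k (pr i j x) (x $ k) = x"
  by (rule frame3_eqI) auto

lemma bounded_linear_pr: "bounded_linear (pr i j)"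
  by (rule linear_conv_bounded_linear[THEN iffD1], rule linearI)
     (simp_all add: vec_eq_iff forall_2)

lemma continuous_on_pr [continuous_intros]:
  "continuous_on S f \<Longrightarrow> continuous_on S (\<lambda>x. pr i j (f x))"
  by (rule bounded_linear.continuous_on[OF bounded_linear_pr])

lemma continuous_on_gpt [continuous_intros]:
  "continuous_on S f \<Longrightarrow> continuous_on S g \<Longrightarrow> continuous_on S (\<lambda>x. gpt i j k (f x) (g x))"
  unfolding gpt_def by (intro continuous_intros)

lemma norm_le_pr:
  assumes "frame3 i j k"
  shows "norm x \<le> 2 * norm (pr i j x) + \<bar>x $ k\<bar>"
proof -
  have "norm x \<le> \<bar>x $ i\<bar> + \<bar>x $ j\<bar> + \<bar>x $ k\<bar>"
    using norm_le_l1_cart[of x] by (simp add: frame3_sum[OF assms])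
  then show ?thesis
    using component_le_norm_cart[of "pr i j x" 1] component_le_norm_cart[of "pr i j x" 2] by simp
qed

text \<open>The interior counterpart of \<open>local_param\<close>: the parameters fill a whole open set, wherever it lies in
  the plane.\<close>

definition open_param :: "(real^3) set \<Rightarrow> (real^2) set \<Rightarrow> (real^2 \<Rightarrow> real^3) \<Rightarrow> bool" where
  "open_param M B X \<longleftrightarrow> open B \<and> smooth_on B X \<and>
     (\<forall>u\<in>B. inj (frechet_derivative X (at u))) \<and> openin (top_of_set M) (X ` B) \<and>
     (\<exists>Y. homeomorphism B (X ` B) X Y)"

lemma openin_homeomorphic_image:
  assumes "homeomorphism S (X ` S) X Y" "openin (top_of_set M) (X ` S)" "openin (top_of_set S) T"
  shows "openin (top_of_set M) (X ` T)"
  using homeomorphism_imp_open_map[OF assms(1,3)] assms(2) openin_trans by blast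

lemma open_param_subset:
  assumes "open_param M B X" "open B'" "B' \<subseteq> B"
  shows "open_param M B' X"
proof -
  obtain Y where Y: "homeomorphism B (X ` B) X Y" using assms(1) by (auto simp: open_param_def)
  have "homeomorphism B' (X ` B') X Y"
    using Y assms(3) by (auto intro: homeomorphism_of_subsets)
  moreover have "openin (top_of_set M) (X ` B')"
    by (rule openin_homeomorphic_image[OF Y]) (use assms in \<open>auto simp: open_param_def open_subset\<close>)
  ultimately show ?thesis
    using assms smooth_on_subset unfolding open_param_def by blast
qed

lemma interior_open_param:
  assumes "embedded_surface M" "p \<in> M" "p \<notin> surface_boundary M"
  obtains B X u where "open_param M B X" "u \<in> B" "X u = p"
proof -
  obtain U X where UX: "local_param M U X" and p: "p \<in> X ` (U \<inter> half_plane)"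
    using assms by (auto simp: embedded_surface_def)
  then obtain u where u: "u \<in> U" "u $ 1 \<ge> 0" "X u = p" by (auto simp: half_plane_def)
  then have u1: "u $ 1 > 0"
    using assms(3) UX by (force simp: surface_boundary_def)
  define B where "B = U \<inter> {u. u $ 1 > 0}"
  have op: "open {u::real^2. u $ 1 > 0}"
    by (simp add: open_halfspace_component_gt_cart)
  have sub: "B \<subseteq> U \<inter> half_plane" by (auto simp: B_def half_plane_def)
  obtain Y where Y: "homeomorphism (U \<inter> half_plane) (X ` (U \<inter> half_plane)) X Y"
    using UX by (auto simp: local_param_def)
  have "open B" using UX op by (auto simp: B_def local_param_def)
  have "open_param M B X"
    unfolding open_param_def
  proof (intro conjI exI)
    show "homeomorphism B (X ` B) X Y"
      using Y sub by (blast intro: homeomorphism_of_subsets)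
    show "openin (top_of_set M) (X ` B)"
      by (rule openin_homeomorphic_image[OF Y])
         (use UX \<open>open B\<close> sub in \<open>auto simp: local_param_def open_subset\<close>)
    show "smooth_on B X" using UX sub smooth_on_subset by (auto simp: local_param_def)
    show "\<forall>u\<in>B. inj (frechet_derivative X (at u))" using UX sub by (auto simp: local_param_def)
  qed fact
  then show thesis using that[of B X u] u u1 by (auto simp: B_def)
qed

text \<open>Translating the parameters moves a small disc into the half plane, and no term of the mean curvature
  notices the translation. In this way the curvature condition applies to every \<open>open_param\<close>.\<close>

lemma has_derivative_shift_iff:
  "((\<lambda>v. X (v - c)) has_derivative D) (at v) \<longleftrightarrow> (X has_derivative D) (at (v - c))"
proof
  assume "(X has_derivative D) (at (v - c))"
  moreover have "((\<lambda>v. v - c) has_derivative (\<lambda>h. h)) (at v)"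
    by (auto intro!: derivative_eq_intros)
  ultimately show "((\<lambda>v. X (v - c)) has_derivative D) (at v)"
    using has_derivative_compose by blast
next
  assume d: "((\<lambda>v. X (v - c)) has_derivative D) (at v)"
  have "((\<lambda>v. v + c) has_derivative (\<lambda>h. h)) (at (v - c))"
    by (auto intro!: derivative_eq_intros)
  from has_derivative_compose[OF this] d show "(X has_derivative D) (at (v - c))"
    by force
qed

lemma frechet_derivative_shift:
  "frechet_derivative (\<lambda>v. X (v - c)) (at v) = frechet_derivative X (at (v - c))"
  by (simp add: frechet_derivative_def has_derivative_shift_iff)

lemma partial_shift: "partial a (\<lambda>v. X (v - c)) = (\<lambda>v. partial a X (v - c))"
  by (rule ext) (simp add: partial_def frechet_derivative_shift)

lemma mean_curvature_shift:
  "mean_curvature (\<lambda>v. X (v - c)) n v = mean_curvature X n (v - c)"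
  by (simp add: mean_curvature_def first_fundamental_form_def second_fundamental_form_def
      cov_deriv_def partial_shift)

lemma Ck_on_ident: "open S \<Longrightarrow> Ck_on k (\<lambda>x::'a::euclidean_space. x) S"
  by (cases k) (auto intro!: Ck_on_Suc_I[where f' = "\<lambda>x h. h"] Ck_on_const simp del: Ck_on.simps(2))

lemma Ck_on_shift:
  fixes X :: "'a::euclidean_space \<Rightarrow> 'b::real_normed_vector"
  assumes "open B" "Ck_on k X B"
  shows "Ck_on k (\<lambda>v. X (v - c)) ((+) c ` B)"
  using assms(2)
proof (induction k arbitrary: X)
  case 0
  then show ?case by (auto intro!: continuous_on_compose2[of B X] continuous_intros)
next
  case (Suc k)
  have "(\<lambda>v. X (v - c)) differentiable (at v)" if "v \<in> (+) c ` B" for v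
  proof -
    have "(X has_derivative frechet_derivative X (at (v - c))) (at (v - c))"
      using that by (intro Ck_on_has_derivative[OF assms(1) Suc.prems]) auto
    then show ?thesis using has_derivative_shift_iff differentiableI by blast
  qed
  moreover have "open ((+) c ` B)" using assms(1) open_translation by blast
  ultimately have "(\<lambda>v. X (v - c)) differentiable_on ((+) c ` B)"
    by (simp add: differentiable_on_eq_differentiable_at)
  moreover have "Ck_on k (\<lambda>v. frechet_derivative X (at (v - c)) b) ((+) c ` B)" if "b \<in> Basis" for b
    using Suc.prems that by (intro Suc.IH) simp
  ultimately show ?case by (simp add: frechet_derivative_shift)
qed

definition cmc_normal :: "(real^3) set \<Rightarrow> (real^3 \<Rightarrow> real^3) \<Rightarrow> real \<Rightarrow> bool" where
  "cmc_normal M N H \<longleftrightarrow> unit_normal_field M N \<and>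
     (\<forall>U X. local_param M U X \<longrightarrow> (\<forall>u\<in>U \<inter> half_plane. mean_curvature X (N (X u)) u = H))"

lemma cmc_normal_open_param:
  assumes N: "cmc_normal M N H" and X: "open_param M B X" and "u \<in> B"
  shows "sol_inner (X u) (partial a X u) (N (X u)) = 0"
    and "mean_curvature X (N (X u)) u = H"
proof -
  obtain \<epsilon> where \<epsilon>: "\<epsilon> > 0" "ball u \<epsilon> \<subseteq> B"
    using X \<open>u \<in> B\<close> open_contains_ball unfolding open_param_def by meson
  define c :: "real^2" where "c = (\<epsilon> - u $ 1) *\<^sub>R axis 1 1"
  define U where "U = (+) c ` ball u \<epsilon>"
  define Y where "Y = (\<lambda>v. X (v - c))"
  have X': "open_param M (ball u \<epsilon>) X" using open_param_subset[OF X _ \<epsilon>(2)] by simp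
  then obtain Z where Z: "homeomorphism (ball u \<epsilon>) (X ` ball u \<epsilon>) X Z" by (auto simp: open_param_def)
  have U: "v $ 1 > 0" if "v \<in> U" for v
  proof -
    have "dist u (v - c) < \<epsilon>" using that by (auto simp: U_def dist_norm algebra_simps)
    moreover have "\<bar>(u - (v - c)) $ 1\<bar> \<le> norm (u - (v - c))" by (rule component_le_norm_cart)
    ultimately show ?thesis by (simp add: dist_norm c_def)
  qed
  then have hp: "U \<inter> half_plane = U" by (force simp: half_plane_def)
  have YU: "Y ` U = X ` ball u \<epsilon>" unfolding Y_def U_def image_image by simp
  have "local_param M U Y"
    unfolding local_param_def hp YU
  proof (intro conjI exI ballI)
    show "open U" by (simp add: U_def open_translation)
    show "smooth_on U Y" using X' unfolding smooth_on_def U_def Y_def open_param_def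
      by (blast intro: Ck_on_shift open_ball)
    show "inj (frechet_derivative Y (at v))" if "v \<in> U" for v
    proof -
      have "v - c \<in> ball u \<epsilon>" using that unfolding U_def by (auto simp: dist_norm algebra_simps)
      then show ?thesis using X' unfolding Y_def frechet_derivative_shift open_param_def by blast
    qed
    show "openin (top_of_set M) (X ` ball u \<epsilon>)" using X' by (simp add: open_param_def)
    show "homeomorphism U (X ` ball u \<epsilon>) Y (\<lambda>x. Z x + c)"
      using Z unfolding homeomorphism_def
    proof (intro conjI ballI)
      assume Z: "(\<forall>x\<in>ball u \<epsilon>. Z (X x) = x) \<and> X ` ball u \<epsilon> = X ` ball u \<epsilon> \<and> continuous_on (ball u \<epsilon>) X \<and>
        (\<forall>y\<in>X ` ball u \<epsilon>. X (Z y) = y) \<and> Z ` X ` ball u \<epsilon> = ball u \<epsilon> \<and> continuous_on (X ` ball u \<epsilon>) Z"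
      show "continuous_on U Y" unfolding Y_def using Z
        by (auto simp: U_def dist_norm algebra_simps intro!: continuous_on_compose2[of "ball u \<epsilon>" X] continuous_intros)
      show "continuous_on (X ` ball u \<epsilon>) (\<lambda>x. Z x + c)"
        using Z by (intro continuous_on_add continuous_on_const) blast
      have "(\<lambda>x. Z x + c) ` X ` ball u \<epsilon> = (+) c ` (Z ` X ` ball u \<epsilon>)"
        by (simp only: image_image add.commute)
      then show "(\<lambda>x. Z x + c) ` X ` ball u \<epsilon> = U" using Z unfolding U_def by metis
      show "Y ` U = X ` ball u \<epsilon>" by (rule YU)
      show "Z (Y v) + c = v" if v: "v \<in> U" for v
      proof -
        obtain w where "w \<in> ball u \<epsilon>" "v = c + w" using v unfolding U_def by blast
        then show ?thesis using Z by (simp add: Y_def)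
      qed
      show "Y (Z x + c) = x" if "x \<in> X ` ball u \<epsilon>" for x
      proof -
        have "X (Z x) = x" using Z that by blast
        then show ?thesis by (simp add: Y_def)
      qed
    qed
  qed
  moreover have "u + c \<in> U \<inter> half_plane" unfolding hp using \<epsilon>(1) by (auto simp: U_def)
  ultimately have 1: "sol_inner (Y (u + c)) (partial a Y (u + c)) (N (Y (u + c))) = 0"
    and 2: "mean_curvature Y (N (Y (u + c))) (u + c) = H"
    using N unfolding cmc_normal_def unit_normal_field_def by blast+
  show "sol_inner (X u) (partial a X u) (N (X u)) = 0"
    using 1 unfolding Y_def partial_shift by simp
  show "mean_curvature X (N (X u)) u = H"
    using 2 unfolding Y_def mean_curvature_shift by simp
qed

text \<open>Within the cylinder of radius \<open>r\<close> and half height \<open>e\<close> about \<open>p\<close>, the surface is exactly the graph of \<open>f\<close>. Having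
  an equivalence on a full cylinder makes it possible to decide membership in \<open>M\<close> from \<open>f\<close>.\<close>

definition local_graph :: "(real^3) set \<Rightarrow> 3 \<Rightarrow> 3 \<Rightarrow> 3 \<Rightarrow> real^3 \<Rightarrow> real \<Rightarrow> real \<Rightarrow> (real^2 \<Rightarrow> real) \<Rightarrow> bool" where
  "local_graph M i j k p r e f \<longleftrightarrow> 0 < r \<and> 0 < e \<and> smooth_on (ball (pr i j p) r) f \<and>
     (\<forall>v\<in>ball (pr i j p) r. \<bar>f v - p $ k\<bar> < e) \<and>
     (\<forall>x. pr i j x \<in> ball (pr i j p) r \<and> \<bar>x $ k - p $ k\<bar> < e \<longrightarrow> (x \<in> M \<longleftrightarrow> x $ k = f (pr i j x)))"

lemma local_graphD:
  assumes "local_graph M i j k p r e f"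
  shows "0 < r" "0 < e" "smooth_on (ball (pr i j p) r) f"
    "v \<in> ball (pr i j p) r \<Longrightarrow> \<bar>f v - p $ k\<bar> < e"
    "pr i j x \<in> ball (pr i j p) r \<Longrightarrow> \<bar>x $ k - p $ k\<bar> < e \<Longrightarrow> x \<in> M \<longleftrightarrow> x $ k = f (pr i j x)"
  using assms unfolding local_graph_def by blast+

lemma local_graph_mem:
  assumes "frame3 i j k" "local_graph M i j k p r e f" "v \<in> ball (pr i j p) r"
  shows "gpt i j k v (f v) \<in> M"
  using local_graphD(5)[OF assms(2), of "gpt i j k v (f v)"] local_graphD(4)[OF assms(2,3)] assms(1,3)
  by simp

lemma local_graph_center:
  assumes "local_graph M i j k p r e f" "p \<in> M"
  shows "f (pr i j p) = p $ k"
  using local_graphD(5)[OF assms(1), of p] local_graphD(1,2)[OF assms(1)] assms(2) by simp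

lemma differentiable_has_derivative_2:
  fixes f :: "real^2 \<Rightarrow> real"
  assumes "f differentiable at v"
  shows "(f has_derivative (\<lambda>h. partial 1 f v * h $ 1 + partial 2 f v * h $ 2)) (at v)"
  using has_derivative_partial[OF assms] by (simp add: sum_2 mult.commute)

lemma has_derivative_gpt:
  assumes "(f has_derivative f') F"
  shows "((\<lambda>v. gpt i j k v (f v)) has_derivative (\<lambda>h. gpt i j k h (f' h))) F"
  unfolding gpt_def
  by (intro has_derivative_add has_derivative_scaleR_left assms bounded_linear_imp_has_derivative bounded_linear_vec_nth)

lemma partial_gpt:
  assumes "f differentiable at v"
  shows "partial 1 (\<lambda>v. gpt i j k v (f v)) v = axis i 1 + partial 1 f v *\<^sub>R axis k 1"
    "partial 2 (\<lambda>v. gpt i j k v (f v)) v = axis j 1 + partial 2 f v *\<^sub>R axis k 1"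
  by (subst partial_eqI[OF has_derivative_gpt[OF differentiable_has_derivative_2[OF assms]]],
      simp add: gpt_def axis_def)+

lemma local_graph_open_param:
  assumes fr: "frame3 i j k" and lg: "local_graph M i j k p r e f"
  shows "open_param M (ball (pr i j p) r) (\<lambda>v. gpt i j k v (f v))"
proof -
  let ?B = "ball (pr i j p) r" and ?X = "\<lambda>v. gpt i j k v (f v)"
  note lg' = local_graphD[OF lg]
  show ?thesis
    unfolding open_param_def
  proof (intro conjI exI ballI)
    show "smooth_on ?B ?X"
      unfolding smooth_on_def gpt_def
      using lg'(3) unfolding smooth_on_def
      by (intro allI Ck_on_add Ck_on_bounded_linear[OF _ bounded_linear_scaleR_left]
           Ck_on_bounded_linear[OF _ bounded_linear_vec_nth, where f="\<lambda>x. x"]) 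
         (auto intro!: Ck_on_ident)
    show "inj (frechet_derivative ?X (at v))" if v: "v \<in> ?B" for v
    proof -
      have "(f has_derivative frechet_derivative f (at v)) (at v)"
        using smooth_on_differentiable[OF _ lg'(3) v] frechet_derivative_works by auto
      from frechet_derivative_at[OF has_derivative_gpt[OF this, of i j k]]
      have *: "frechet_derivative ?X (at v) = (\<lambda>h. gpt i j k h (frechet_derivative f (at v) h))" by simp
      have "pr i j (frechet_derivative ?X (at v) h) = h" for h
        unfolding * using fr by simp
      then show ?thesis by (rule inj_on_inverseI)
    qed
    have im: "?X ` ?B = M \<inter> (pr i j -` ?B \<inter> {x. \<bar>x $ k - p $ k\<bar> < e})"
    proof (intro set_eqI iffI)
      fix x assume "x \<in> ?X ` ?B"
      then obtain v where v: "v \<in> ?B" "x = ?X v" by blast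
      have "x \<in> M" using local_graph_mem[OF fr lg v(1)] v(2) by simp
      moreover have "pr i j x \<in> ?B" "\<bar>x $ k - p $ k\<bar> < e"
        using v fr lg'(4)[OF v(1)] by simp_all
      ultimately show "x \<in> M \<inter> (pr i j -` ?B \<inter> {x. \<bar>x $ k - p $ k\<bar> < e})" by blast
    next
      fix x assume "x \<in> M \<inter> (pr i j -` ?B \<inter> {x. \<bar>x $ k - p $ k\<bar> < e})"
      then have x: "x \<in> M" "pr i j x \<in> ?B" "\<bar>x $ k - p $ k\<bar> < e" by blast+
      then have "x = ?X (pr i j x)" using lg'(5) gpt_pr[OF fr, of x] by metis
      then show "x \<in> ?X ` ?B" using x by blast
    qed
    have "open (pr i j -` ?B)"
      by (intro open_vimage continuous_intros) auto
    moreover have "open {x::real^3. \<bar>x $ k - p $ k\<bar> < e}"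
      by (intro open_Collect_less continuous_intros)
    ultimately show "openin (top_of_set M) (?X ` ?B)"
      unfolding im by (intro openin_open_Int) auto
    show "homeomorphism ?B (?X ` ?B) ?X (pr i j)"
      unfolding homeomorphism_def
      using fr by (auto simp: image_image
         intro!: continuous_intros smooth_on_continuous[OF lg'(3)])
  qed auto
qed


text \<open>If the conormal \<open>\<nu>\<close> has a nonzero \<open>k\<close>-component, no tangent vector is parallel to the \<open>k\<close>-axis, so the
  projection of the parametrization along \<open>k\<close> is a local diffeomorphism; \<open>f\<close> is its inverse followed
  by the height.\<close>

lemma local_graph_exists:
  assumes fr: "frame3 i j k" and X: "open_param M B X" and u0: "u0 \<in> B" and p: "X u0 = p"
    and orth: "\<And>a. \<nu> \<bullet> partial a X u0 = 0" and \<nu>k: "\<nu> $ k \<noteq> 0" and "\<epsilon> > 0"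
  obtains r e f where "local_graph M i j k p r e f" "r < \<epsilon>" "e < \<epsilon>"
proof -
  define \<phi> where "\<phi> = (\<lambda>u. pr i j (X u))"
  have B: "open B" and Xs: "smooth_on B X" and inj: "inj (frechet_derivative X (at u0))"
    and XB: "openin (top_of_set M) (X ` B)" 
    using X u0 by (auto simp: open_param_def)
  obtain Y where Y: "homeomorphism B (X ` B) X Y" using X by (auto simp: open_param_def)
  have \<phi>s: "smooth_on B \<phi>"
    using Xs unfolding smooth_on_def \<phi>_def by (blast intro: Ck_on_bounded_linear[OF B bounded_linear_pr])
  have dX: "(X has_derivative frechet_derivative X (at u)) (at u)" if "u \<in> B" for u
    using smooth_on_differentiable[OF B Xs that] frechet_derivative_works by blast
  have d\<phi>: "(\<phi> has_derivative frechet_derivative \<phi> (at u)) (at u)" if "u \<in> B" for u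
    using smooth_on_differentiable[OF B \<phi>s that] frechet_derivative_works by blast
  define D where "D u = Blinfun (frechet_derivative \<phi> (at u))" for u
  have D: "blinfun_apply (D u) = frechet_derivative \<phi> (at u)" if "u \<in> B" for u
    unfolding D_def using has_derivative_bounded_linear[OF d\<phi>[OF that]] by (rule bounded_linear_Blinfun_apply)
  have contD: "continuous_on B D"
  proof (rule continuous_on_blinfun_componentwise)
    fix b :: "real^2" assume "b \<in> Basis"
    then have "continuous_on B (\<lambda>u. frechet_derivative \<phi> (at u) b)"
      using \<phi>s unfolding smooth_on_def by (metis Ck_on.simps(2) Ck_on_imp_continuous)
    then show "continuous_on B (\<lambda>u. blinfun_apply (D u) b)"
      by (rule continuous_on_eq) (simp add: D)
  qed
  have lin: "linear (frechet_derivative \<phi> (at u0))" using d\<phi>[OF u0] has_derivative_linear by blast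
  have "frechet_derivative \<phi> (at u0) = (\<lambda>h. pr i j (frechet_derivative X (at u0) h))"
    unfolding \<phi>_def
    by (rule frechet_derivative_at[OF bounded_linear.has_derivative[OF bounded_linear_pr dX[OF u0]], symmetric])
  moreover have "h = 0" if "pr i j (frechet_derivative X (at u0) h) = 0" for h
  proof -
    let ?w = "frechet_derivative X (at u0) h"
    have w: "?w $ i = 0" "?w $ j = 0"
      using arg_cong[OF that, of "\<lambda>v. v $ 1"] arg_cong[OF that, of "\<lambda>v. v $ 2"] by simp_all
    have "?w = (\<Sum>a\<in>UNIV. h $ a *\<^sub>R partial a X u0)"
      by (rule fun_cong[OF has_derivative_unique[OF dX[OF u0] has_derivative_partial[OF smooth_on_differentiable[OF B Xs u0]]]])
    then have "\<nu> \<bullet> ?w = 0" by (simp add: inner_sum_right orth)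
    then have "\<nu> $ k * ?w $ k = 0" by (simp add: inner_vec_def frame3_sum[OF fr] w)
    then have "?w = 0" using w \<nu>k by (intro frame3_eqI[OF fr]) auto
    then show "h = 0"
      using inj linear_injective_0[OF has_derivative_linear[OF dX[OF u0]]] by auto
  qed
  ultimately have "inj (frechet_derivative \<phi> (at u0))"
    using linear_injective_0[OF lin] by simp
  then obtain L where L: "linear L" "L \<circ> frechet_derivative \<phi> (at u0) = id"
    using linear_injective_left_inverse[OF lin] by blast
  have LB: "blinfun_apply (Blinfun L) = L"
    using L(1) by (simp add: bounded_linear_Blinfun_apply linear_conv_bounded_linear)
  have "Blinfun L o\<^sub>L D u0 = id_blinfun"
    by (rule blinfun_eqI) (use L(2) D[OF u0] in \<open>simp add: LB fun_eq_iff\<close>)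
  moreover have "(\<phi> has_derivative blinfun_apply (D u)) (at u)" if "u \<in> B" for u
    using d\<phi>[OF that] D[OF that] by simp
  ultimately obtain U' V g g' where U': "open U'" "U' \<subseteq> B" "u0 \<in> U'" and V: "open V" "\<phi> u0 \<in> V"
    and hom: "homeomorphism U' V \<phi> g" and g: "\<And>y. y \<in> V \<Longrightarrow> (g has_derivative (g' y)) (at y)"
    using inverse_function_theorem[OF B _ contD u0, of \<phi> "Blinfun L"] by metis
  have gV: "g ` V \<subseteq> U'" and \<phi>g: "\<And>y. y \<in> V \<Longrightarrow> \<phi> (g y) = y" and g\<phi>: "\<And>u. u \<in> U' \<Longrightarrow> g (\<phi> u) = u"
    using hom by (auto simp: homeomorphism_def)
  define f where "f v = X (g v) $ k" for v
  have gk: "Ck_on n g V" for n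
    using Ck_on_inverse_map[OF B V(1) \<phi>s _ _ \<phi>g] gV U'(2) g differentiableI by blast
  have fs: "smooth_on V f"
    unfolding smooth_on_def f_def
  proof
    fix n
    have "Ck_on n (\<lambda>u. X u $ k) B" using Xs B Ck_on_vec_iff unfolding smooth_on_def by blast
    then show "Ck_on n (\<lambda>v. X (g v) $ k) V"
      by (rule Ck_on_compose[OF V(1) B _ gk]) (use gV U'(2) in blast)
  qed
  have X_eq: "X u = gpt i j k (\<phi> u) (f (\<phi> u))" if "u \<in> U'" for u
    using gpt_pr[OF fr, of "X u"] by (simp add: \<phi>_def[symmetric] f_def g\<phi>[OF that]) (simp add: \<phi>_def)
  have "openin (top_of_set M) (X ` U')"
    by (rule openin_homeomorphic_image[OF Y XB]) (use U' B in \<open>auto simp: open_subset\<close>)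
  then obtain W where W: "open W" "X ` U' = M \<inter> W" by (auto simp: openin_open)
  have "p \<in> W" using W U'(3) p by blast
  then obtain d where d: "d > 0" "ball p d \<subseteq> W" using W(1) open_contains_ball by meson
  define e where "e = min (d/4) (\<epsilon>/2)"
  have e: "e > 0" "e < \<epsilon>" "e \<le> d / 4" using d \<open>\<epsilon> > 0\<close> by (auto simp: e_def)
  have f0: "f (\<phi> u0) = p $ k" and \<phi>0: "\<phi> u0 = pr i j p" using g\<phi>[OF U'(3)] p by (auto simp: f_def \<phi>_def)
  have "continuous (at (\<phi> u0)) f"
    using smooth_on_continuous[OF fs] V continuous_on_eq_continuous_at by blast
  then obtain r1 where r1: "r1 > 0" "\<And>v. dist v (\<phi> u0) < r1 \<Longrightarrow> dist (f v) (f (\<phi> u0)) < e"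
    using e(1) unfolding continuous_at_eps_delta by blast
  obtain r2 where r2: "r2 > 0" "ball (\<phi> u0) r2 \<subseteq> V" using V open_contains_ball by meson
  define r where "r = min e (min r1 r2)"
  have r: "r > 0" "r \<le> e" "r \<le> r1" "r \<le> r2" using e r1 r2 by (auto simp: r_def)
  have rV: "ball (pr i j p) r \<subseteq> V" using r2 r(4) unfolding \<phi>0 by (meson subset_ball subset_trans)
  have "local_graph M i j k p r e f"
    unfolding local_graph_def
  proof (intro conjI ballI allI impI)
    show "smooth_on (ball (pr i j p) r) f" by (rule smooth_on_subset[OF fs rV])
    show "\<bar>f v - p $ k\<bar> < e" if "v \<in> ball (pr i j p) r" for v
      using r1(2)[of v] that r(3) f0 \<phi>0 by (simp add: dist_real_def dist_commute)
    fix x assume x: "pr i j x \<in> ball (pr i j p) r \<and> \<bar>x $ k - p $ k\<bar> < e"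
    have "norm (x - p) \<le> 2 * norm (pr i j (x - p)) + \<bar>(x - p) $ k\<bar>" by (rule norm_le_pr[OF fr])
    also have "pr i j (x - p) = pr i j x - pr i j p"
      using bounded_linear_pr linear_simps(2) by blast
    also have "norm (pr i j x - pr i j p) = dist (pr i j p) (pr i j x)"
      by (metis dist_commute dist_norm)
    also have "2 * dist (pr i j p) (pr i j x) + \<bar>(x - p) $ k\<bar> < d"
      using x r(2) e(1,3) by simp
    finally have xW: "x \<in> W" using d by (auto simp: dist_norm norm_minus_commute)
    show "x \<in> M \<longleftrightarrow> x $ k = f (pr i j x)"
    proof
      assume "x \<in> M"
      then obtain u where u: "u \<in> U'" "x = X u" using xW W(2) by blast
      then show "x $ k = f (pr i j x)" using g\<phi>[OF u(1)] by (simp add: f_def \<phi>_def)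
    next
      assume *: "x $ k = f (pr i j x)"
      have v: "pr i j x \<in> V" using x rV by blast
      have gu: "g (pr i j x) \<in> U'" using gV v by blast
      have "X (g (pr i j x)) = gpt i j k (pr i j x) (f (pr i j x))"
        using X_eq[OF gu] \<phi>g[OF v] by simp
      also have "\<dots> = x" using gpt_pr[OF fr, of x] * by simp
      finally show "x \<in> M" using gu W(2) by (metis IntD1 imageI)
    qed
  qed (use r e in auto)
  then show thesis using that r e by (metis order_le_less_trans)
qed

section \<open>The strong maximum principle in the plane\<close>

text \<open>The differential inequality satisfied by the difference of two solutions of a quasilinear elliptic
  equation. The coefficients are arbitrary functions with uniform ellipticity bounds: pointwise
  information at one extremal point is enough for the maximum principle.\<close>

definition elliptic_ineq :: "(real^2) set \<Rightarrow> (real^2 \<Rightarrow> real) \<Rightarrow> bool" where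
  "elliptic_ineq \<Omega> w \<longleftrightarrow> open \<Omega> \<and> smooth_on \<Omega> w \<and>
     (\<exists>A11 A12 A22 K \<mu> \<Lambda>. \<mu> > 0 \<and> (\<forall>x\<in>\<Omega>.
        (\<forall>\<xi> \<eta>. \<mu> * (\<xi>\<^sup>2 + \<eta>\<^sup>2) \<le> A11 x * \<xi>\<^sup>2 + 2 * A12 x * (\<xi> * \<eta>) + A22 x * \<eta>\<^sup>2) \<and>
        A11 x + A22 x \<le> \<Lambda> \<and>
        \<bar>A11 x * partial 1 (partial 1 w) x + A12 x * (partial 1 (partial 2 w) x + partial 2 (partial 1 w) x)
          + A22 x * partial 2 (partial 2 w) x\<bar>
        \<le> K * (\<bar>w x\<bar> + \<bar>partial 1 w x\<bar> + \<bar>partial 2 w x\<bar>)))"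

lemma elliptic_ineq_subset:
  assumes "elliptic_ineq \<Omega> w" "open \<Omega>'" "\<Omega>' \<subseteq> \<Omega>"
  shows "elliptic_ineq \<Omega>' w"
proof -
  obtain A11 A12 A22 K \<mu> \<Lambda> where *: "\<mu> > 0" "\<forall>x\<in>\<Omega>.
        (\<forall>\<xi> \<eta>. \<mu> * (\<xi>\<^sup>2 + \<eta>\<^sup>2) \<le> A11 x * \<xi>\<^sup>2 + 2 * A12 x * (\<xi> * \<eta>) + A22 x * \<eta>\<^sup>2) \<and>
        A11 x + A22 x \<le> \<Lambda> \<and>
        \<bar>A11 x * partial 1 (partial 1 w) x + A12 x * (partial 1 (partial 2 w) x + partial 2 (partial 1 w) x)
          + A22 x * partial 2 (partial 2 w) x\<bar>
        \<le> K * (\<bar>w x\<bar> + \<bar>partial 1 w x\<bar> + \<bar>partial 2 w x\<bar>)"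
    using assms(1) unfolding elliptic_ineq_def by blast
  show ?thesis
    unfolding elliptic_ineq_def
  proof (intro conjI exI)
    show "smooth_on \<Omega>' w" using assms smooth_on_subset unfolding elliptic_ineq_def by blast
    show "\<forall>x\<in>\<Omega>'.
        (\<forall>\<xi> \<eta>. \<mu> * (\<xi>\<^sup>2 + \<eta>\<^sup>2) \<le> A11 x * \<xi>\<^sup>2 + 2 * A12 x * (\<xi> * \<eta>) + A22 x * \<eta>\<^sup>2) \<and>
        A11 x + A22 x \<le> \<Lambda> \<and>
        \<bar>A11 x * partial 1 (partial 1 w) x + A12 x * (partial 1 (partial 2 w) x + partial 2 (partial 1 w) x)
          + A22 x * partial 2 (partial 2 w) x\<bar>
        \<le> K * (\<bar>w x\<bar> + \<bar>partial 1 w x\<bar> + \<bar>partial 2 w x\<bar>)" using * assms(3) by blast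
  qed (use * assms in auto)
qed

lemma has_real_derivative_line:
  fixes g :: "real^2 \<Rightarrow> real"
  assumes "(g has_derivative (\<lambda>h. a * h $ 1 + b * h $ 2)) (at (q + t *\<^sub>R \<xi>))"
  shows "((\<lambda>t. g (q + t *\<^sub>R \<xi>)) has_real_derivative (a * \<xi> $ 1 + b * \<xi> $ 2)) (at t)"
proof -
  have "((\<lambda>t. q + t *\<^sub>R \<xi>) has_derivative (\<lambda>s. s *\<^sub>R \<xi>)) (at t)"
    by (auto intro!: derivative_eq_intros)
  from has_derivative_compose[OF this assms]
  have "((\<lambda>t. g (q + t *\<^sub>R \<xi>)) has_derivative (\<lambda>s. a * (s *\<^sub>R \<xi>) $ 1 + b * (s *\<^sub>R \<xi>) $ 2)) (at t)" .
  moreover have "(\<lambda>s. a * (s *\<^sub>R \<xi>) $ 1 + b * (s *\<^sub>R \<xi>) $ 2) = (*) (a * \<xi> $ 1 + b * \<xi> $ 2)"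
    by (rule ext) (simp add: algebra_simps)
  ultimately show ?thesis by (simp add: has_field_derivative_def)
qed

text \<open>The conditions at an interior minimum, obtained by restricting \<open>g\<close> to straight lines. The derivatives are
  given by explicit functions so that the barrier below can be differentiated by hand.\<close>

lemma second_order_min:
  fixes g :: "real^2 \<Rightarrow> real"
  assumes "d > 0" and g: "\<And>x. x \<in> ball q d \<Longrightarrow> (g has_derivative (\<lambda>h. g1 x * h $ 1 + g2 x * h $ 2)) (at x)"
    and g1: "(g1 has_derivative (\<lambda>h. g11 * h $ 1 + g12 * h $ 2)) (at q)"
    and g2: "(g2 has_derivative (\<lambda>h. g21 * h $ 1 + g22 * h $ 2)) (at q)"
    and min: "\<And>x. x \<in> ball q d \<Longrightarrow> g q \<le> g x"
  shows "g1 q = 0" "g2 q = 0" 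
    "0 \<le> g11 * \<xi>\<^sup>2 + (g12 + g21) * (\<xi> * \<eta>) + g22 * \<eta>\<^sup>2"
proof -
  have main: "g1 q * v $ 1 + g2 q * v $ 2 = 0 \<and> 
    0 \<le> g11 * (v $ 1)\<^sup>2 + (g12 + g21) * (v $ 1 * v $ 2) + g22 * (v $ 2)\<^sup>2" for v :: "real^2"
  proof -
    define \<delta> where "\<delta> = d / (norm v + 1)"
    have "norm v + 1 > 0" by (smt (verit) norm_ge_zero)
    then have \<delta>: "\<delta> > 0" using \<open>d > 0\<close> by (simp add: \<delta>_def)
    have inb: "q + t *\<^sub>R v \<in> ball q d" if "\<bar>t\<bar> < \<delta>" for t
    proof -
      have "\<bar>t\<bar> * norm v \<le> \<bar>t\<bar> * (norm v + 1)" by (intro mult_left_mono) auto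
      also have "\<dots> < \<delta> * (norm v + 1)" using that \<open>norm v + 1 > 0\<close> by simp
      also have "\<dots> = d" using \<open>norm v + 1 > 0\<close> by (simp add: \<delta>_def)
      finally show ?thesis by (simp add: dist_norm)
    qed
    define \<phi> where "\<phi> t = g (q + t *\<^sub>R v)" for t
    define \<psi> where "\<psi> t = g1 (q + t *\<^sub>R v) * v $ 1 + g2 (q + t *\<^sub>R v) * v $ 2" for t
    have \<phi>: "(\<phi> has_real_derivative \<psi> t) (at t)" if "\<bar>t\<bar> < \<delta>" for t
      unfolding \<phi>_def \<psi>_def by (rule has_real_derivative_line[OF g[OF inb[OF that]]])
    have "((\<lambda>t. g1 (q + t *\<^sub>R v)) has_real_derivative (g11 * v $ 1 + g12 * v $ 2)) (at 0)"
      "((\<lambda>t. g2 (q + t *\<^sub>R v)) has_real_derivative (g21 * v $ 1 + g22 * v $ 2)) (at 0)"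
      by (rule has_real_derivative_line, use g1 g2 in simp)+
    then have "(\<psi> has_real_derivative ((g11 * v $ 1 + g12 * v $ 2) * v $ 1 + (g21 * v $ 1 + g22 * v $ 2) * v $ 2)) (at 0)"
      unfolding \<psi>_def by (auto intro!: derivative_eq_intros)
    moreover have "(g11 * v $ 1 + g12 * v $ 2) * v $ 1 + (g21 * v $ 1 + g22 * v $ 2) * v $ 2
       = g11 * (v $ 1)\<^sup>2 + (g12 + g21) * (v $ 1 * v $ 2) + g22 * (v $ 2)\<^sup>2" (is "_ = ?Q")
      by (simp add: power2_eq_square algebra_simps)
    ultimately have \<psi>: "(\<psi> has_real_derivative ?Q) (at 0)" by simp
    have min': "\<phi> 0 \<le> \<phi> t" if "\<bar>t\<bar> < \<delta>" for t
      using min[OF inb[OF that]] by (simp add: \<phi>_def)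
    have z: "\<psi> 0 = 0"
      by (rule DERIV_local_min[OF \<phi> \<delta>]) (use \<delta> min' in auto)
    have "?Q \<ge> 0"
    proof (rule ccontr)
      assume "\<not> ?Q \<ge> 0"
      then obtain \<delta>' where \<delta>': "\<delta>' > 0" "\<And>h. 0 < h \<Longrightarrow> h < \<delta>' \<Longrightarrow> \<psi> (0 + h) < \<psi> 0"
        using DERIV_neg_dec_right[OF \<psi>] by auto
      define t where "t = min \<delta> \<delta>' / 2"
      have t: "0 < t" "t < \<delta>" "t < \<delta>'" using \<delta> \<delta>'(1) by (auto simp: t_def)
      obtain s where s: "0 < s" "s < t" "\<phi> t - \<phi> 0 = (t - 0) * \<psi> s"
        using MVT2[OF t(1), of \<phi> \<psi>] \<phi> t by auto
      have "\<psi> s < 0" using \<delta>'(2)[of s] s t z by simp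
      then have "\<phi> t < \<phi> 0" using s t by (smt (verit) mult_pos_neg)
      then show False using min'[of t] t by simp
    qed
    then show ?thesis using z by (simp add: \<psi>_def)
  qed
  show "g1 q = 0" using main[of "axis 1 1"] by (simp add: axis_def)
  show "g2 q = 0" using main[of "axis 2 1"] by (simp add: axis_def)
  show "0 \<le> g11 * \<xi>\<^sup>2 + (g12 + g21) * (\<xi> * \<eta>) + g22 * \<eta>\<^sup>2"
    using main[of "vector [\<xi>, \<eta>]"] by simp
qed

text \<open>The trace of a product of two nonnegative symmetric matrices is nonnegative: completing the square in
  the first one reduces the claim to the values of the second at \<open>(a11, a12)\<close> and \<open>(0, 1)\<close>.\<close>

lemma elliptic_trace_nonneg:
  fixes a11 a12 a22 q11 q12 q22 :: real
  assumes "\<mu> > 0" and A: "\<And>\<xi> \<eta>. \<mu> * (\<xi>\<^sup>2 + \<eta>\<^sup>2) \<le> a11 * \<xi>\<^sup>2 + 2 * a12 * (\<xi> * \<eta>) + a22 * \<eta>\<^sup>2"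
    and Q: "\<And>\<xi> \<eta>. 0 \<le> q11 * \<xi>\<^sup>2 + q12 * (\<xi> * \<eta>) + q22 * \<eta>\<^sup>2"
  shows "0 \<le> a11 * q11 + a12 * q12 + a22 * q22"
proof -
  have a11: "a11 > 0" using A[of 1 0] \<open>\<mu> > 0\<close> by simp
  have q22: "q22 \<ge> 0" using Q[of 0 1] by simp
  have "0 \<le> a11 * a12\<^sup>2 - 2 * a12 * (a12 * a11) + a22 * a11\<^sup>2"
    using A[of "- a12" a11] \<open>\<mu> > 0\<close>
    by (smt (verit, best) mult_minus_left mult_minus_right mult_nonneg_nonneg power2_minus zero_le_power2 mult.assoc)
  then have "0 \<le> a11 * (a11 * a22 - a12\<^sup>2)" by (simp add: algebra_simps power2_eq_square)
  then have det: "0 \<le> a11 * a22 - a12\<^sup>2" using a11 by (simp add: zero_le_mult_iff)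
  have "0 \<le> (q11 * a11\<^sup>2 + q12 * (a11 * a12) + q22 * a12\<^sup>2) + (a11 * a22 - a12\<^sup>2) * q22"
    using Q[of a11 a12] det q22 by simp
  also have "\<dots> = a11 * (a11 * q11 + a12 * q12 + a22 * q22)" by (simp add: algebra_simps power2_eq_square)
  finally show ?thesis using a11 by (simp add: zero_le_mult_iff)
qed

lemma smooth_partials:
  fixes w :: "real^2 \<Rightarrow> real"
  assumes "open \<Omega>" "smooth_on \<Omega> w" "x \<in> \<Omega>"
  shows "(w has_derivative (\<lambda>h. partial 1 w x * h $ 1 + partial 2 w x * h $ 2)) (at x)"
    "(partial a w has_derivative (\<lambda>h. partial 1 (partial a w) x * h $ 1 + partial 2 (partial a w) x * h $ 2)) (at x)"
  by (intro differentiable_has_derivative_2 smooth_on_differentiable[OF assms(1) _ assms(3)] smooth_on_partial assms(2))+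

text \<open>The exponent of the barrier: for large \<open>\<alpha>\<close> the quadratic term dominates the first order ones.\<close>

lemma Hopf_constant:
  fixes K \<mu> \<Lambda> R :: real
  assumes "\<mu> > 0" "R > 0" "K \<ge> 0" "\<Lambda> \<ge> 0"
  obtains \<alpha> where "\<alpha> > 0" "\<alpha>\<^sup>2 * (\<mu> * R\<^sup>2) - 2 * \<alpha> * \<Lambda> > K * (1 + 4 * \<alpha> * R)"
proof -
  define \<alpha> where "\<alpha> = (2 * \<Lambda> + 4 * K * R + K + 1) / (\<mu> * R\<^sup>2) + 1"
  have p: "\<mu> * R\<^sup>2 > 0" using assms by simp
  have \<alpha>1: "\<alpha> \<ge> 1" using assms p by (simp add: \<alpha>_def)
  have "\<alpha> * (\<mu> * R\<^sup>2) = (2 * \<Lambda> + 4 * K * R + K + 1) + \<mu> * R\<^sup>2"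
    unfolding \<alpha>_def distrib_right using assms by simp
  then have "\<alpha> * (\<mu> * R\<^sup>2) - 2 * \<Lambda> - 4 * K * R \<ge> K + 1" using p by linarith
  then have "\<alpha> * (\<alpha> * (\<mu> * R\<^sup>2) - 2 * \<Lambda> - 4 * K * R) \<ge> \<alpha> * (K + 1)" using \<alpha>1 by (intro mult_left_mono) auto
  moreover have "\<alpha> * (K + 1) \<ge> 1 * (K + 1)" using \<alpha>1 assms by (intro mult_right_mono) auto
  ultimately have "\<alpha>\<^sup>2 * (\<mu> * R\<^sup>2) - 2 * \<alpha> * \<Lambda> > K * (1 + 4 * \<alpha> * R)"
    by (simp add: power2_eq_square algebra_simps)
  then show thesis using that[of \<alpha>] \<alpha>1 by auto
qed

text \<open>Hopf's lemma. On the annulus \<open>R/2 \<le> \<bar>x - y\<bar> \<le> R\<close> the barrier \<open>h = exp (-\<alpha>\<bar>x - y\<bar>\<^sup>2) - exp (-\<alpha>R\<^sup>2)\<close> satisfies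
  \<open>a:D\<^sup>2h > K (\<bar>h\<bar> + \<bar>Dh\<bar>)\<close>. If \<open>w - \<epsilon> h\<close> had a negative minimum inside, there \<open>0 \<le> w < \<epsilon> h\<close>, \<open>Dw = \<epsilon> Dh\<close> and
  \<open>a:D\<^sup>2w \<ge> \<epsilon> a:D\<^sup>2h\<close>, against the inequality for \<open>w\<close>. So \<open>w \<ge> \<epsilon> h\<close>, and \<open>w\<close> leaves \<open>p\<close> with a nonzero slope.\<close>

lemma Hopf_lemma:
  assumes ell: "elliptic_ineq \<Omega> w" and sub: "cball y R \<subseteq> \<Omega>" and "R > 0"
    and pos: "\<And>x. x \<in> ball y R \<Longrightarrow> w x > 0" and p: "dist y p = R" "w p = 0"
    and crit: "partial 1 w p = 0" "partial 2 w p = 0"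
  shows False
proof -
  have \<Omega>: "open \<Omega>" "smooth_on \<Omega> w" using ell by (auto simp: elliptic_ineq_def)
  obtain A11 A12 A22 K0 \<mu> \<Lambda>0 where "\<mu> > 0" and
    A: "\<And>x \<xi> \<eta>. x \<in> \<Omega> \<Longrightarrow> \<mu> * (\<xi>\<^sup>2 + \<eta>\<^sup>2) \<le> A11 x * \<xi>\<^sup>2 + 2 * A12 x * (\<xi> * \<eta>) + A22 x * \<eta>\<^sup>2" and
    trA0: "\<And>x. x \<in> \<Omega> \<Longrightarrow> A11 x + A22 x \<le> \<Lambda>0" and
    ineq0: "\<And>x. x \<in> \<Omega> \<Longrightarrow> \<bar>A11 x * partial 1 (partial 1 w) x + A12 x * (partial 1 (partial 2 w) x + partial 2 (partial 1 w) x)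
          + A22 x * partial 2 (partial 2 w) x\<bar>
        \<le> K0 * (\<bar>w x\<bar> + \<bar>partial 1 w x\<bar> + \<bar>partial 2 w x\<bar>)"
    using ell unfolding elliptic_ineq_def by metis
  define K where "K = max K0 0"
  define \<Lambda> where "\<Lambda> = max \<Lambda>0 0"
  have "K \<ge> 0" "\<Lambda> \<ge> 0" by (auto simp: K_def \<Lambda>_def)
  have trA: "A11 x + A22 x \<le> \<Lambda>" if "x \<in> \<Omega>" for x using trA0[OF that] by (simp add: \<Lambda>_def)
  have ineq: "A11 x * partial 1 (partial 1 w) x + A12 x * (partial 1 (partial 2 w) x + partial 2 (partial 1 w) x)
          + A22 x * partial 2 (partial 2 w) x
        \<le> K * (\<bar>w x\<bar> + \<bar>partial 1 w x\<bar> + \<bar>partial 2 w x\<bar>)" if "x \<in> \<Omega>" for x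
  proof -
    have "K0 * (\<bar>w x\<bar> + \<bar>partial 1 w x\<bar> + \<bar>partial 2 w x\<bar>) \<le> K * (\<bar>w x\<bar> + \<bar>partial 1 w x\<bar> + \<bar>partial 2 w x\<bar>)"
      by (intro mult_right_mono) (auto simp: K_def)
    then show ?thesis using ineq0[OF that] by linarith
  qed
  obtain \<alpha> where "\<alpha> > 0" and \<alpha>: "\<alpha>\<^sup>2 * (\<mu> * R\<^sup>2) - 2 * \<alpha> * \<Lambda> > K * (1 + 4 * \<alpha> * R)"
    using Hopf_constant[OF \<open>\<mu> > 0\<close> \<open>R > 0\<close> \<open>K \<ge> 0\<close> \<open>\<Lambda> \<ge> 0\<close>] by blast
  define E where "E x = exp (- \<alpha> * ((x $ 1 - y $ 1)\<^sup>2 + (x $ 2 - y $ 2)\<^sup>2))" for x :: "real^2"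
  define h where "h x = E x - exp (- \<alpha> * R\<^sup>2)" for x
  define h1 where "h1 x = - 2 * \<alpha> * (x $ 1 - y $ 1) * E x" for x
  define h2 where "h2 x = - 2 * \<alpha> * (x $ 2 - y $ 2) * E x" for x
  have nsq: "(dist y x)\<^sup>2 = (x $ 1 - y $ 1)\<^sup>2 + (x $ 2 - y $ 2)\<^sup>2" for x :: "real^2"
  proof -
    have "(dist y x)\<^sup>2 = (y - x) \<bullet> (y - x)" by (simp add: dist_norm power2_norm_eq_inner)
    then show ?thesis by (simp add: inner_vec_def sum_2 power2_eq_square algebra_simps)
  qed
  have dnth: "((\<lambda>x::real^2. x $ a) has_derivative (\<lambda>h. h $ a)) (at x)" for a x
    by (rule bounded_linear_imp_has_derivative[OF bounded_linear_vec_nth])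
  have dE: "(E has_derivative (\<lambda>v. h1 x * v $ 1 + h2 x * v $ 2)) (at x)" for x
    unfolding E_def[abs_def] h1_def h2_def
    by (rule derivative_eq_intros dnth refl)+ (simp add: algebra_simps power2_eq_square E_def fun_eq_iff)
  have dh: "(h has_derivative (\<lambda>v. h1 x * v $ 1 + h2 x * v $ 2)) (at x)" for x
    using has_derivative_diff[OF dE[of x] has_derivative_const[where c = "exp (- \<alpha> * R\<^sup>2)"]]
    unfolding h_def[abs_def] by simp
  define h11 where "h11 x = (4 * \<alpha>\<^sup>2 * (x $ 1 - y $ 1)\<^sup>2 - 2 * \<alpha>) * E x" for x
  define h12 where "h12 x = 4 * \<alpha>\<^sup>2 * (x $ 1 - y $ 1) * (x $ 2 - y $ 2) * E x" for x
  define h22 where "h22 x = (4 * \<alpha>\<^sup>2 * (x $ 2 - y $ 2)\<^sup>2 - 2 * \<alpha>) * E x" for x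
  have dh1: "(h1 has_derivative (\<lambda>v. h11 x * v $ 1 + h12 x * v $ 2)) (at x)" for x
    unfolding h1_def[abs_def] h11_def h12_def
    by (rule derivative_eq_intros dnth dE refl)+ (simp add: h1_def h2_def algebra_simps power2_eq_square fun_eq_iff)
  have dh2: "(h2 has_derivative (\<lambda>v. h12 x * v $ 1 + h22 x * v $ 2)) (at x)" for x
    unfolding h2_def[abs_def] h12_def h22_def
    by (rule derivative_eq_intros dnth dE refl)+ (simp add: h1_def h2_def algebra_simps power2_eq_square fun_eq_iff)
  have Epos: "E x > 0" for x by (simp add: E_def)
  have hE: "E x = exp (- \<alpha> * (dist y x)\<^sup>2)" for x by (simp add: E_def nsq)
  have h_le: "h x \<le> E x" "h x < 1" for x
  proof -
    show "h x \<le> E x" by (simp add: h_def)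
    have "E x \<le> 1" unfolding hE using \<open>\<alpha> > 0\<close> by simp
    then show "h x < 1" by (simp add: h_def) (smt (verit) exp_gt_zero)
  qed
  have hR: "h x = 0" if "dist y x = R" for x by (simp add: h_def hE that)
  \<comment> \<open>\<open>w\<close> has a positive lower bound on the inner disc\<close>
  have cw: "continuous_on \<Omega> w" by (rule smooth_on_continuous[OF \<Omega>(2)])
  have half: "cball y (R/2) \<subseteq> ball y R" using \<open>R > 0\<close> by auto
  have "\<exists>x\<in>cball y (R/2). \<forall>z\<in>cball y (R/2). w x \<le> w z"
    using \<open>R > 0\<close> half sub by (intro continuous_attains_inf continuous_on_subset[OF cw]) auto
  then obtain x0 where x0: "x0 \<in> cball y (R/2)" "\<And>z. z \<in> cball y (R/2) \<Longrightarrow> w x0 \<le> w z" by blast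
  define \<epsilon> where "\<epsilon> = w x0"
  have \<epsilon>: "\<epsilon> > 0" using pos x0(1) half by (auto simp: \<epsilon>_def)
  have w_nonneg: "w x \<ge> 0" if "x \<in> cball y R" for x
  proof (rule continuous_ge_on_closure[of "ball y R" w x 0])
    show "continuous_on (closure (ball y R)) w" 
      using continuous_on_subset[OF cw sub] \<open>R > 0\<close> by simp
    show "x \<in> closure (ball y R)" using that \<open>R > 0\<close> by simp
  qed (use pos in \<open>auto intro: less_imp_le\<close>)
  define Ann where "Ann = cball y R - ball y (R/2)"
  have "compact Ann" unfolding Ann_def by (intro compact_diff) auto
  have "Ann \<subseteq> \<Omega>" using sub by (auto simp: Ann_def)
  have contv: "continuous_on Ann (\<lambda>x. w x - \<epsilon> * h x)"
  proof (intro continuous_intros)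
    show "continuous_on Ann w" using cw \<open>Ann \<subseteq> \<Omega>\<close> continuous_on_subset by blast
    show "continuous_on Ann h"
      by (intro continuous_at_imp_continuous_on ballI has_derivative_continuous[OF dh])
  qed
  have "p \<in> Ann" using p \<open>R > 0\<close> by (auto simp: Ann_def)
  then have "\<exists>x\<in>Ann. \<forall>z\<in>Ann. w x - \<epsilon> * h x \<le> w z - \<epsilon> * h z"
    using \<open>compact Ann\<close> contv by (intro continuous_attains_inf) auto
  then obtain q where q: "q \<in> Ann" "\<And>z. z \<in> Ann \<Longrightarrow> w q - \<epsilon> * h q \<le> w z - \<epsilon> * h z" by blast
  have v_nonneg: "w q - \<epsilon> * h q \<ge> 0"
  proof (rule ccontr)
    assume "\<not> w q - \<epsilon> * h q \<ge> 0"
    then have neg: "w q < \<epsilon> * h q" by simp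
    have qR: "R/2 \<le> dist y q" "dist y q \<le> R" using q(1) by (auto simp: Ann_def)
    have "dist y q \<noteq> R"
      using neg hR[of q] w_nonneg[of q] by auto
    moreover have "dist y q \<noteq> R/2"
    proof
      assume "dist y q = R/2"
      then have "\<epsilon> \<le> w q" using x0(2)[of q] by (auto simp: \<epsilon>_def)
      moreover have "\<epsilon> * h q < \<epsilon> * 1" using h_le(2)[of q] \<epsilon> by (intro mult_strict_left_mono)
      ultimately show False using neg by simp
    qed
    ultimately have qi: "R/2 < dist y q" "dist y q < R" using qR by auto
    have "open (ball y R - cball y (R/2))" by (intro open_Diff) auto
    moreover have "q \<in> ball y R - cball y (R/2)" using qi by auto
    ultimately obtain d where d: "d > 0" "ball q d \<subseteq> ball y R - cball y (R/2)"
      using open_contains_ball by meson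
    have dAnn: "ball q d \<subseteq> Ann" using d(2) by (force simp: Ann_def)
    have q\<Omega>: "q \<in> \<Omega>" using q(1) \<open>Ann \<subseteq> \<Omega>\<close> by blast
    have D: "((\<lambda>x. w x - \<epsilon> * h x) has_derivative 
       (\<lambda>v. (partial 1 w x - \<epsilon> * h1 x) * v $ 1 + (partial 2 w x - \<epsilon> * h2 x) * v $ 2)) (at x)" if "x \<in> ball q d" for x
    proof -
      have "x \<in> \<Omega>" using that dAnn \<open>Ann \<subseteq> \<Omega>\<close> by blast
      show ?thesis
        by (rule derivative_eq_intros smooth_partials(1)[OF \<Omega> \<open>x \<in> \<Omega>\<close>] dh refl)+ (simp add: algebra_simps fun_eq_iff)
    qed
    have D1: "((\<lambda>x. partial 1 w x - \<epsilon> * h1 x) has_derivative 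
       (\<lambda>v. (partial 1 (partial 1 w) q - \<epsilon> * h11 q) * v $ 1 + (partial 2 (partial 1 w) q - \<epsilon> * h12 q) * v $ 2)) (at q)"
      by (rule derivative_eq_intros smooth_partials(2)[OF \<Omega> q\<Omega>] dh1 refl)+ (simp add: algebra_simps fun_eq_iff)
    have D2: "((\<lambda>x. partial 2 w x - \<epsilon> * h2 x) has_derivative 
       (\<lambda>v. (partial 1 (partial 2 w) q - \<epsilon> * h12 q) * v $ 1 + (partial 2 (partial 2 w) q - \<epsilon> * h22 q) * v $ 2)) (at q)"
      by (rule derivative_eq_intros smooth_partials(2)[OF \<Omega> q\<Omega>] dh2 refl)+ (simp add: algebra_simps fun_eq_iff)
    have mn: "w q - \<epsilon> * h q \<le> w x - \<epsilon> * h x" if "x \<in> ball q d" for x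
      using q(2) dAnn that by blast
    note so = second_order_min[OF d(1) D D1 D2 mn]
    have w12: "partial 1 w q = \<epsilon> * h1 q" "partial 2 w q = \<epsilon> * h2 q" using so(1,2) by auto
    have "0 \<le> A11 q * (partial 1 (partial 1 w) q - \<epsilon> * h11 q) + 
      A12 q * ((partial 2 (partial 1 w) q - \<epsilon> * h12 q) + (partial 1 (partial 2 w) q - \<epsilon> * h12 q)) + 
      A22 q * (partial 2 (partial 2 w) q - \<epsilon> * h22 q)"
      by (rule elliptic_trace_nonneg[OF \<open>\<mu> > 0\<close> A[OF q\<Omega>] so(3)])
    then have 1: "\<epsilon> * (A11 q * h11 q + 2 * A12 q * h12 q + A22 q * h22 q) 
       \<le> K * (\<bar>w q\<bar> + \<bar>partial 1 w q\<bar> + \<bar>partial 2 w q\<bar>)"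
      using ineq[OF q\<Omega>] by (simp add: algebra_simps)
    define d1 d2 where "d1 = q $ 1 - y $ 1" and "d2 = q $ 2 - y $ 2"
    have dd: "d1\<^sup>2 + d2\<^sup>2 = (dist y q)\<^sup>2" by (simp add: nsq d1_def d2_def)
    have "A11 q * h11 q + 2 * A12 q * h12 q + A22 q * h22 q = 
      E q * (4 * \<alpha>\<^sup>2 * (A11 q * d1\<^sup>2 + 2 * A12 q * (d1 * d2) + A22 q * d2\<^sup>2) - 2 * \<alpha> * (A11 q + A22 q))"
      by (simp add: h11_def h12_def h22_def d1_def[symmetric] d2_def[symmetric] algebra_simps)
    also have "\<dots> \<ge> E q * (4 * \<alpha>\<^sup>2 * (\<mu> * (R/2)\<^sup>2) - 2 * \<alpha> * \<Lambda>)"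
    proof (intro mult_left_mono diff_mono)
      have "\<mu> * (R/2)\<^sup>2 \<le> \<mu> * (d1\<^sup>2 + d2\<^sup>2)"
        unfolding dd using \<open>\<mu> > 0\<close> qR(1) \<open>R > 0\<close> by (intro mult_left_mono power_mono) auto
      also have "\<dots> \<le> A11 q * d1\<^sup>2 + 2 * A12 q * (d1 * d2) + A22 q * d2\<^sup>2" by (rule A[OF q\<Omega>])
      finally show "\<mu> * (R/2)\<^sup>2 \<le> A11 q * d1\<^sup>2 + 2 * A12 q * (d1 * d2) + A22 q * d2\<^sup>2" .
    qed (use \<open>\<alpha> > 0\<close> trA[OF q\<Omega>] Epos[of q] in auto)
    finally have "E q * (\<alpha>\<^sup>2 * (\<mu> * R\<^sup>2) - 2 * \<alpha> * \<Lambda>) \<le> A11 q * h11 q + 2 * A12 q * h12 q + A22 q * h22 q"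
      by (simp add: power_divide)
    moreover have "E q * (K * (1 + 4 * \<alpha> * R)) < E q * (\<alpha>\<^sup>2 * (\<mu> * R\<^sup>2) - 2 * \<alpha> * \<Lambda>)"
      using \<alpha> Epos[of q] by simp
    ultimately have "\<epsilon> * (E q * (K * (1 + 4 * \<alpha> * R))) < K * (\<bar>w q\<bar> + \<bar>partial 1 w q\<bar> + \<bar>partial 2 w q\<bar>)"
      using 1 \<epsilon> by (smt (verit) mult_less_cancel_left_pos)
    also have "\<dots> \<le> K * (\<epsilon> * (E q * (1 + 4 * \<alpha> * R)))"
    proof (intro mult_left_mono \<open>K \<ge> 0\<close>)
      have "w q \<ge> 0" using w_nonneg[of q] qR by auto
      then have a: "\<bar>w q\<bar> \<le> \<epsilon> * E q" using neg h_le(1)[of q] \<epsilon> by (smt (verit) mult_left_mono)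
      have "\<bar>d1\<bar> \<le> R" "\<bar>d2\<bar> \<le> R"
        using component_le_norm_cart[of "q - y" 1] component_le_norm_cart[of "q - y" 2] qR(2)
        by (auto simp: d1_def d2_def dist_norm norm_minus_commute)
      then have "\<bar>h1 q\<bar> \<le> 2 * \<alpha> * R * E q" "\<bar>h2 q\<bar> \<le> 2 * \<alpha> * R * E q"
        using \<open>\<alpha> > 0\<close> Epos[of q] by (auto simp: h1_def h2_def abs_mult d1_def[symmetric] d2_def[symmetric])
      then have "\<bar>partial 1 w q\<bar> \<le> \<epsilon> * (2 * \<alpha> * R * E q)" "\<bar>partial 2 w q\<bar> \<le> \<epsilon> * (2 * \<alpha> * R * E q)"
        unfolding w12 using \<epsilon> by (simp_all add: abs_mult)
      with a show "\<bar>w q\<bar> + \<bar>partial 1 w q\<bar> + \<bar>partial 2 w q\<bar> \<le> \<epsilon> * (E q * (1 + 4 * \<alpha> * R))"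
        by (simp add: algebra_simps)
    qed
    finally show False by (simp add: algebra_simps)
  qed
  \<comment> \<open>hence \<open>w\<close> grows linearly from \<open>p\<close> towards the centre\<close>
  define \<phi> where "\<phi> t = w (p + t *\<^sub>R (y - p)) - \<epsilon> * h (p + t *\<^sub>R (y - p))" for t
  have p\<Omega>: "p \<in> \<Omega>" using sub p by auto
  have ph: "h1 p * (y - p) $ 1 + h2 p * (y - p) $ 2 = 2 * \<alpha> * R\<^sup>2 * E p"
  proof -
    have "h1 p * (y - p) $ 1 + h2 p * (y - p) $ 2 = 2 * \<alpha> * E p * (dist y p)\<^sup>2"
      unfolding nsq by (simp add: h1_def h2_def power2_eq_square algebra_simps)
    then show ?thesis by (simp add: p(1))
  qed
  have "((\<lambda>x. w x - \<epsilon> * h x) has_derivative 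
       (\<lambda>v. (partial 1 w p - \<epsilon> * h1 p) * v $ 1 + (partial 2 w p - \<epsilon> * h2 p) * v $ 2)) (at p)"
    by (rule derivative_eq_intros smooth_partials(1)[OF \<Omega> p\<Omega>] dh refl)+ (simp add: algebra_simps fun_eq_iff)
  then have "((\<lambda>x. w x - \<epsilon> * h x) has_derivative 
       (\<lambda>v. (- \<epsilon> * h1 p) * v $ 1 + (- \<epsilon> * h2 p) * v $ 2)) (at (p + 0 *\<^sub>R (y - p)))"
    using crit by simp
  from has_real_derivative_line[OF this]
  have "(\<phi> has_real_derivative ((- \<epsilon> * h1 p) * (y - p) $ 1 + (- \<epsilon> * h2 p) * (y - p) $ 2)) (at 0)"
    unfolding \<phi>_def .
  moreover have "(- \<epsilon> * h1 p) * (y - p) $ 1 + (- \<epsilon> * h2 p) * (y - p) $ 2 = - \<epsilon> * (2 * \<alpha> * R\<^sup>2 * E p)"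
    unfolding ph[symmetric] by (simp add: algebra_simps)
  moreover have "- \<epsilon> * (2 * \<alpha> * R\<^sup>2 * E p) < 0" using \<epsilon> \<open>\<alpha> > 0\<close> \<open>R > 0\<close> Epos[of p] by simp
  ultimately obtain \<delta> where \<delta>: "\<delta> > 0" "\<And>t. 0 < t \<Longrightarrow> t < \<delta> \<Longrightarrow> \<phi> (0 + t) < \<phi> 0"
    using DERIV_neg_dec_right by metis
  define t where "t = min \<delta> (1/2) / 2"
  have t: "0 < t" "t < \<delta>" "t < 1/2" using \<delta>(1) by (auto simp: t_def)
  have "dist y (p + t *\<^sub>R (y - p)) = (1 - t) * R"
  proof -
    have "y - (p + t *\<^sub>R (y - p)) = (1 - t) *\<^sub>R (y - p)" by (simp add: algebra_simps)
    then show ?thesis using t p(1) by (simp add: dist_norm)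
  qed
  moreover have "(1 - t) * R \<le> R" "R/2 \<le> (1 - t) * R"
    using t \<open>R > 0\<close> mult_right_mono[of "1/2" "1 - t" R] by auto
  ultimately have "p + t *\<^sub>R (y - p) \<in> Ann" by (simp add: Ann_def)
  then have "\<phi> t \<ge> 0" using q(2) v_nonneg unfolding \<phi>_def by (meson order_trans)
  moreover have "\<phi> 0 = 0" using p hR by (simp add: \<phi>_def)
  ultimately show False using \<delta>(2)[of t] t by simp
qed

text \<open>Were the zero set not open, a disc free of zeros could be enlarged inside \<open>\<Omega>\<close> until it touches a zero;
  there the gradient vanishes because the zero is a minimum, contrary to Hopf's lemma.\<close>

lemma strong_maximum_principle:
  assumes ell: "elliptic_ineq \<Omega> w" and con: "connected \<Omega>"
    and nonneg: "\<And>x. x \<in> \<Omega> \<Longrightarrow> w x \<ge> 0" and z: "z \<in> \<Omega>" "w z = 0" and x: "x \<in> \<Omega>"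
  shows "w x = 0"
proof -
  have \<Omega>: "open \<Omega>" "smooth_on \<Omega> w" using ell by (auto simp: elliptic_ineq_def)
  have cw: "continuous_on \<Omega> w" by (rule smooth_on_continuous[OF \<Omega>(2)])
  define Z where "Z = {x \<in> \<Omega>. w x = 0}"
  have crit: "partial 1 w q = 0" "partial 2 w q = 0" if "q \<in> Z" for q
  proof -
    have q: "q \<in> \<Omega>" "w q = 0" using that by (auto simp: Z_def)
    obtain d where d: "d > 0" "ball q d \<subseteq> \<Omega>" using \<Omega>(1) q(1) open_contains_ball by meson
    have mn: "w q \<le> w x" if "x \<in> ball q d" for x using nonneg d q that by auto
    have D: "(w has_derivative (\<lambda>h. partial 1 w x * h $ 1 + partial 2 w x * h $ 2)) (at x)" if "x \<in> ball q d" for x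
      using smooth_partials(1)[OF \<Omega>] d that by blast
    show "partial 1 w q = 0" "partial 2 w q = 0"
      using second_order_min(1,2)[OF d(1) D smooth_partials(2)[OF \<Omega> q(1)] smooth_partials(2)[OF \<Omega> q(1)] mn] by auto
  qed
  have "openin (top_of_set \<Omega>) Z"
    unfolding openin_contains_ball
  proof (intro conjI ballI)
    show "Z \<subseteq> \<Omega>" by (auto simp: Z_def)
    fix v0 assume v0: "v0 \<in> Z"
    then have "v0 \<in> \<Omega>" by (simp add: Z_def)
    then obtain \<rho> where \<rho>: "\<rho> > 0" "ball v0 \<rho> \<subseteq> \<Omega>" using \<Omega>(1) open_contains_ball by meson
    have "y \<in> Z" if y: "y \<in> ball v0 (\<rho>/2)" for y
    proof (rule ccontr)
      assume "y \<notin> Z"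
      have y\<Omega>: "y \<in> \<Omega>" using y \<rho> by auto
      \<comment> \<open>a disc about \<open>v0\<close> large enough to contain every zero at distance at most \<open>dist y v0\<close> from \<open>y\<close>\<close>
      define \<sigma> where "\<sigma> = 2 * dist v0 y"
      have \<rho>\<sigma>: "dist v0 y = \<sigma> / 2" by (simp add: \<sigma>_def)
      define Z' where "Z' = {x \<in> cball v0 \<sigma>. w x = 0}"
      have "\<sigma> < \<rho>" "\<sigma> \<ge> 0" using y by (auto simp: \<sigma>_def)
      then have sub2: "cball v0 \<sigma> \<subseteq> \<Omega>" using \<rho> by auto
      have "closed Z'"
        unfolding Z'_def 
        by (rule continuous_closed_preimage_constant[OF continuous_on_subset[OF cw sub2]]) simp
      moreover have v0Z': "v0 \<in> Z'" using v0 \<open>\<sigma> \<ge> 0\<close> by (auto simp: Z'_def Z_def)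
      ultimately obtain p where p: "p \<in> Z'" "\<And>x. x \<in> Z' \<Longrightarrow> dist y p \<le> dist y x"
        using distance_attains_inf[of Z' y] by blast
      define R where "R = dist y p"
      have R: "R \<le> dist y v0" using p(2)[OF v0Z'] by (simp add: R_def)
      have pZ: "p \<in> Z" using p(1) sub2 by (auto simp: Z'_def Z_def)
      have "R > 0" using pZ \<open>y \<notin> Z\<close> by (auto simp: R_def)
      have yv: "dist v0 y < \<rho>/2" using y by simp
      have sub: "cball y R \<subseteq> \<Omega>"
      proof
        fix x assume "x \<in> cball y R"
        then have "dist v0 x < \<rho>" using dist_triangle[of v0 x y] R yv by (simp add: dist_commute)
        then show "x \<in> \<Omega>" using \<rho>(2) by auto
      qed
      have pos: "w x > 0" if "x \<in> ball y R" for x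
      proof -
        have "x \<in> \<Omega>" using that sub by auto
        have "w x \<noteq> 0"
        proof
          assume "w x = 0"
          moreover have "x \<in> cball v0 \<sigma>"
            using that dist_triangle[of v0 x y] R yv by (simp add: dist_commute \<rho>\<sigma>)
          ultimately show False using p(2)[of x] that by (auto simp: Z'_def R_def)
        qed
        then show ?thesis using nonneg[OF \<open>x \<in> \<Omega>\<close>] by simp
      qed
      show False
        by (rule Hopf_lemma[OF ell sub \<open>R > 0\<close> pos R_def[symmetric] _ crit[OF pZ]])
           (use pZ in \<open>auto simp: Z_def\<close>)
    qed
    then show "\<exists>e>0. ball v0 e \<inter> \<Omega> \<subseteq> Z" using \<rho>(1) by (intro exI[of _ "\<rho>/2"]) auto
  qed
  moreover have "closedin (top_of_set \<Omega>) Z"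
    unfolding Z_def by (rule continuous_closedin_preimage_constant[OF cw])
  ultimately have "Z = \<Omega>" using con z unfolding connected_clopen Z_def by blast
  then show ?thesis using x by (auto simp: Z_def)
qed

text \<open>The inequality holds on a full disc but the sign is known on one half only. A zero inside the half
  disc spreads by the strong maximum principle; if there is none, the disc of radius \<open>\<rho>/4\<close> touching the
  diameter at \<open>p\<close> contradicts Hopf's lemma.\<close>

lemma boundary_point_principle:
  assumes ell: "elliptic_ineq (ball p \<rho>) w" and "\<rho> > 0"
    and nonneg: "\<And>v. v \<in> ball p \<rho> \<Longrightarrow> v $ 1 > p $ 1 \<Longrightarrow> w v \<ge> 0"
    and p: "w p = 0" "partial 1 w p = 0" "partial 2 w p = 0"
    and v: "v \<in> ball p \<rho>" "v $ 1 > p $ 1"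
  shows "w v = 0"
proof -
  define H where "H = ball p \<rho> \<inter> {v. v $ 1 > p $ 1}"
  have "open H" unfolding H_def by (intro open_Int open_ball open_halfspace_component_gt_cart)
  have "convex {v::real^2. v $ 1 > p $ 1}"
    using convex_halfspace_gt[of "p $ 1" "axis 1 1 :: real^2"] by (simp add: inner_axis' )
  then have "connected H" unfolding H_def by (intro convex_connected convex_Int convex_ball)
  have ellH: "elliptic_ineq H w" by (rule elliptic_ineq_subset[OF ell \<open>open H\<close>]) (auto simp: H_def)
  have nn: "w x \<ge> 0" if "x \<in> H" for x using nonneg that by (auto simp: H_def)
  show ?thesis
  proof (cases "\<exists>z\<in>H. w z = 0")
    case True
    then obtain z where z: "z \<in> H" "w z = 0" by blast
    have "v \<in> H" using v by (simp add: H_def)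
    from strong_maximum_principle[OF ellH \<open>connected H\<close> nn z this] show ?thesis .
  next
    case False
    define y :: "real^2" where "y = p + (\<rho>/4) *\<^sub>R axis 1 1"
    have dyp: "dist y p = \<rho>/4" using \<open>\<rho> > 0\<close> by (simp add: y_def dist_norm)
    have "cball y (\<rho>/4) \<subseteq> ball p \<rho>"
    proof
      fix x assume "x \<in> cball y (\<rho>/4)"
      then show "x \<in> ball p \<rho>" using dist_triangle[of p x y] dyp \<open>\<rho> > 0\<close> by (simp add: dist_commute)
    qed
    moreover have "w x > 0" if "x \<in> ball y (\<rho>/4)" for x
    proof -
      have "\<bar>(y - x) $ 1\<bar> \<le> norm (y - x)" by (rule component_le_norm_cart)
      then have "x $ 1 > p $ 1" using that by (simp add: y_def dist_norm axis_def)
      moreover have "x \<in> cball y (\<rho>/4)" using that by simp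
      ultimately have "x \<in> H" using \<open>cball y (\<rho>/4) \<subseteq> ball p \<rho>\<close> unfolding H_def by blast
      then show ?thesis using nn[of x] False by force
    qed
    ultimately have False
      using \<open>\<rho> > 0\<close> by (intro Hopf_lemma[OF ell _ _ _ dyp p]) auto
    then show ?thesis ..
  qed
qed

section \<open>The mean curvature equation of a graph\<close>

text \<open>The diagonal entries of the metric, and their derivatives with respect to \<open>z\<close>.\<close>

definition gdiag :: "real^3 \<Rightarrow> 3 \<Rightarrow> real" where
  "gdiag p i = (if i = 1 then exp (2 * p $ 3) else if i = 2 then exp (- 2 * p $ 3) else 1)"

definition gdiag_dz :: "real^3 \<Rightarrow> 3 \<Rightarrow> real" where
  "gdiag_dz p i = (if i = 1 then 2 * exp (2 * p $ 3) else if i = 2 then - 2 * exp (- 2 * p $ 3) else 0)"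

lemma gdiag_pos: "gdiag p i > 0"
  by (simp add: gdiag_def)

lemma sol_metric_nth: "sol_metric p $ i $ j = (if i = j then gdiag p i else 0)"
  by (simp add: sol_metric_def gdiag_def)

lemma sol_inner_eq: "sol_inner p v w = (\<Sum>l\<in>UNIV. gdiag p l * v $ l * w $ l)"
proof -
  have "(sol_metric p *v w) $ l = gdiag p l * w $ l" for l
    by (simp add: matrix_vector_mult_def sol_metric_nth if_distrib[where f="\<lambda>z. z * _"] cong: if_cong)
  then show ?thesis by (simp add: sol_inner_def inner_vec_def algebra_simps)
qed

lemma matrix_inv_eqI:
  fixes A B :: "real^'n^'n"
  assumes "A ** B = mat 1" "B ** A = mat 1"
  shows "matrix_inv A = B"
proof -
  have "A ** matrix_inv A = mat 1 \<and> matrix_inv A ** A = mat 1"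
    unfolding matrix_inv_def by (rule someI[of _ B]) (use assms in blast)
  then show ?thesis using assms by (metis matrix_mul_assoc matrix_mul_lid matrix_mul_rid)
qed

lemma matrix_inv_sol_metric: "matrix_inv (sol_metric p) $ i $ j = (if i = j then 1 / gdiag p i else 0)"
proof -
  have "matrix_inv (sol_metric p) = (\<chi> i j. if i = j then 1 / gdiag p i else 0)"
    using gdiag_pos[of p, THEN less_imp_neq]
    by (intro matrix_inv_eqI)
       (auto simp: vec_eq_iff matrix_matrix_mult_def mat_def sol_metric_nth if_distrib[where f="\<lambda>z. z * _"] cong: if_cong)
  then show ?thesis by simp
qed

lemma partial_sol_metric:
  "partial i (\<lambda>q. sol_metric q $ j $ l) p = (if i = 3 \<and> j = l then gdiag_dz p j else 0)"
proof -
  have z: "((\<lambda>q::real^3. q $ 3) has_derivative (\<lambda>h. h $ 3)) (at p)"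
    by (rule bounded_linear_imp_has_derivative[OF bounded_linear_vec_nth])
  have "((\<lambda>q. gdiag q j) has_derivative (\<lambda>h. gdiag_dz p j * h $ 3)) (at p)"
    unfolding gdiag_def gdiag_dz_def
    by (cases "j = 1"; cases "j = 2") (auto intro!: derivative_eq_intros z)
  from partial_eqI[OF this, of i] have "partial i (\<lambda>q. gdiag q j) p = (if i = 3 then gdiag_dz p j else 0)"
    by (simp add: axis_def)
  then show ?thesis
    by (cases "j = l") (simp_all add: sol_metric_nth partial_def)
qed

lemma christoffel_eq:
  "christoffel p k i j = ((if i = 3 \<and> j = k then gdiag_dz p j else 0) + (if j = 3 \<and> i = k then gdiag_dz p i else 0)
     - (if k = 3 \<and> i = j then gdiag_dz p i else 0)) / (2 * gdiag p k)"
  by (simp add: christoffel_def matrix_inv_sol_metric partial_sol_metric if_distrib[where f="\<lambda>z. z * _"] cong: if_cong)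

text \<open>For a graph \<open>x\<^sub>k = f(x\<^sub>i, x\<^sub>j)\<close> with slopes \<open>p1, p2\<close>, the coordinate tangent vectors are \<open>tvec i k p1\<close> and
  \<open>tvec j k p2\<close>, the conormal normalized by its \<open>k\<close>-component is \<open>cvec\<close>, and \<open>slope_norm\<close> is the norm of that
  conormal. The first fundamental form has the entries \<open>cE i k x p1\<close>, \<open>cF k x p1 p2\<close>, \<open>cE j k x p2\<close>. All
  terms of the mean curvature equation without second derivatives are collected in \<open>cB\<close>, where \<open>c\<close> is twice
  the mean curvature up to the sign of the normal; the equation itself is \<open>cmc_solution\<close>.\<close>

definition tvec :: "3 \<Rightarrow> 3 \<Rightarrow> real \<Rightarrow> real^3" where
  "tvec i k s = axis i 1 + s *\<^sub>R axis k 1"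

definition cvec :: "3 \<Rightarrow> 3 \<Rightarrow> 3 \<Rightarrow> real \<Rightarrow> real \<Rightarrow> real^3" where
  "cvec i j k p1 p2 = axis k 1 - p1 *\<^sub>R axis i 1 - p2 *\<^sub>R axis j 1"

lemma cvec_nth:
  assumes "frame3 i j k"
  shows "cvec i j k p1 p2 $ i = - p1" "cvec i j k p1 p2 $ j = - p2" "cvec i j k p1 p2 $ k = 1"
  using assms by (auto simp: cvec_def axis_def frame3_def)

definition chr_term :: "real^3 \<Rightarrow> real^3 \<Rightarrow> real^3 \<Rightarrow> real^3 \<Rightarrow> real" where
  "chr_term x c s t = (\<Sum>l\<in>UNIV. \<Sum>m\<in>UNIV. \<Sum>n\<in>UNIV. c $ l * (christoffel x l m n * s $ m * t $ n))"

definition slope_norm :: "3 \<Rightarrow> 3 \<Rightarrow> 3 \<Rightarrow> real^3 \<Rightarrow> real \<Rightarrow> real \<Rightarrow> real" where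
  "slope_norm i j k x p1 p2 = sqrt (1 / gdiag x k + p1\<^sup>2 / gdiag x i + p2\<^sup>2 / gdiag x j)"

definition cE :: "3 \<Rightarrow> 3 \<Rightarrow> real^3 \<Rightarrow> real \<Rightarrow> real" where
  "cE i k x p = gdiag x i + p\<^sup>2 * gdiag x k"

definition cF :: "3 \<Rightarrow> real^3 \<Rightarrow> real \<Rightarrow> real \<Rightarrow> real" where
  "cF k x p1 p2 = p1 * p2 * gdiag x k"

definition cB :: "3 \<Rightarrow> 3 \<Rightarrow> 3 \<Rightarrow> real \<Rightarrow> real^3 \<Rightarrow> real \<Rightarrow> real \<Rightarrow> real" where
  "cB i j k c x p1 p2 =
     cE j k x p2 * chr_term x (cvec i j k p1 p2) (tvec i k p1) (tvec i k p1)
     - cF k x p1 p2 * (chr_term x (cvec i j k p1 p2) (tvec i k p1) (tvec j k p2)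
        + chr_term x (cvec i j k p1 p2) (tvec j k p2) (tvec i k p1))
     + cE i k x p1 * chr_term x (cvec i j k p1 p2) (tvec j k p2) (tvec j k p2)
     - c * (cE i k x p1 * cE j k x p2 - (cF k x p1 p2)\<^sup>2) * slope_norm i j k x p1 p2"

definition cmc_solution :: "3 \<Rightarrow> 3 \<Rightarrow> 3 \<Rightarrow> real \<Rightarrow> (real^2) set \<Rightarrow> (real^2 \<Rightarrow> real) \<Rightarrow> bool" where
  "cmc_solution i j k c \<Omega> f \<longleftrightarrow> open \<Omega> \<and> smooth_on \<Omega> f \<and>
     (\<forall>v\<in>\<Omega>. let x = gpt i j k v (f v); p1 = partial 1 f v; p2 = partial 2 f v in
        cE j k x p2 * partial 1 (partial 1 f) v
        - cF k x p1 p2 * (partial 1 (partial 2 f) v + partial 2 (partial 1 f) v)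
        + cE i k x p1 * partial 2 (partial 2 f) v + cB i j k c x p1 p2 = 0)"

lemma matrix_inv_2:
  fixes A :: "real^2^2"
  assumes "A $ 1 $ 1 * A $ 2 $ 2 - A $ 1 $ 2 * A $ 2 $ 1 \<noteq> 0" (is "?d \<noteq> 0")
  shows "matrix_inv A = vector [vector [A $ 2 $ 2 / ?d, - A $ 1 $ 2 / ?d], vector [- A $ 2 $ 1 / ?d, A $ 1 $ 1 / ?d]]"
proof (rule matrix_inv_eqI)
  define d where "d = ?d"
  have "d \<noteq> 0" using assms by (simp add: d_def)
  show "A ** vector [vector [A $ 2 $ 2 / ?d, - A $ 1 $ 2 / ?d], vector [- A $ 2 $ 1 / ?d, A $ 1 $ 1 / ?d]] = mat 1"
    unfolding d_def[symmetric] using \<open>d \<noteq> 0\<close>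
    by (simp add: vec_eq_iff forall_2 matrix_matrix_mult_def sum_2 mat_def divide_simps) (simp add: d_def algebra_simps)
  show "vector [vector [A $ 2 $ 2 / ?d, - A $ 1 $ 2 / ?d], vector [- A $ 2 $ 1 / ?d, A $ 1 $ 1 / ?d]] ** A = mat 1"
    unfolding d_def[symmetric] using \<open>d \<noteq> 0\<close>
    by (simp add: vec_eq_iff forall_2 matrix_matrix_mult_def sum_2 mat_def divide_simps) (simp add: d_def algebra_simps)
qed

lemma trace_matrix_inv_2:
  fixes A B :: "real^2^2"
  assumes "A $ 1 $ 1 * A $ 2 $ 2 - A $ 1 $ 2 * A $ 2 $ 1 \<noteq> 0" (is "?d \<noteq> 0")
  shows "trace (matrix_inv A ** B) * ?d
    = A $ 2 $ 2 * B $ 1 $ 1 - A $ 1 $ 2 * B $ 2 $ 1 - A $ 2 $ 1 * B $ 1 $ 2 + A $ 1 $ 1 * B $ 2 $ 2"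
  unfolding matrix_inv_2[OF assms] using assms
  by (simp add: trace_def matrix_matrix_mult_def sum_2 add_divide_distrib[symmetric] diff_divide_distrib[symmetric] divide_simps)

lemma sol_inner_tvec:
  assumes "frame3 i j k"
  shows "sol_inner x (tvec i k p1) (tvec i k p1) = cE i k x p1"
    "sol_inner x (tvec j k p2) (tvec j k p2) = cE j k x p2"
    "sol_inner x (tvec i k p1) (tvec j k p2) = cF k x p1 p2"
    "sol_inner x (tvec j k p2) (tvec i k p1) = cF k x p1 p2"
  using assms by (auto simp: sol_inner_eq frame3_sum[OF assms] tvec_def axis_def frame3_def cE_def cF_def power2_eq_square)

lemma area_pos:
  "cE i k x p1 * cE j k x p2 - (cF k x p1 p2)\<^sup>2 > 0"
proof -
  have "cE i k x p1 * cE j k x p2 - (cF k x p1 p2)\<^sup>2 = gdiag x i * gdiag x j + gdiag x i * gdiag x k * p2\<^sup>2 + gdiag x j * gdiag x k * p1\<^sup>2"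
    by (simp add: cE_def cF_def algebra_simps power2_eq_square)
  also have "\<dots> > 0"
    by (intro add_pos_nonneg mult_nonneg_nonneg mult_pos_pos gdiag_pos less_imp_le[OF gdiag_pos] zero_le_power2)
  finally show ?thesis .
qed

lemma slope_norm_pos: "slope_norm i j k x p1 p2 > 0"
  unfolding slope_norm_def real_sqrt_gt_0_iff
  by (intro add_pos_nonneg divide_nonneg_pos divide_pos_pos gdiag_pos zero_le_power2) simp

text \<open>The lowered normal annihilates both tangent vectors, hence is a multiple of \<open>cvec\<close>; the factor is fixed up
  to its sign by the unit length of the normal.\<close>

lemma local_graph_normal:
  assumes N: "cmc_normal M N H" and fr: "frame3 i j k" and lg: "local_graph M i j k p r e f"
    and v: "v \<in> ball (pr i j p) r"
  defines "x \<equiv> gpt i j k v (f v)"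
  shows "gdiag x l * N x $ l = (gdiag x k * N x $ k) * cvec i j k (partial 1 f v) (partial 2 f v) $ l"
    and "N x $ k \<noteq> 0"
    and "(gdiag x k * N x $ k * slope_norm i j k x (partial 1 f v) (partial 2 f v))\<^sup>2 = 1"
proof -
  let ?X = "\<lambda>v. gpt i j k v (f v)"
  have op: "open_param M (ball (pr i j p) r) ?X" by (rule local_graph_open_param[OF fr lg])
  have df: "f differentiable (at v)" by (rule smooth_on_differentiable[OF open_ball local_graphD(3)[OF lg] v])
  have x: "x \<in> M" unfolding x_def by (rule local_graph_mem[OF fr lg v])
  have ax: "axis a (1::real) $ b = (if a = b then 1 else 0)" for a b :: 3 by (simp add: axis_def)
  have "sol_inner x (axis i 1 + partial 1 f v *\<^sub>R axis k 1) (N x) = 0" "sol_inner x (axis j 1 + partial 2 f v *\<^sub>R axis k 1) (N x) = 0"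
    using cmc_normal_open_param(1)[OF N op v, of 1] cmc_normal_open_param(1)[OF N op v, of 2]
    unfolding partial_gpt[OF df] x_def by simp_all
  then have o: "gdiag x i * N x $ i = - (gdiag x k * N x $ k) * partial 1 f v" "gdiag x j * N x $ j = - (gdiag x k * N x $ k) * partial 2 f v"
    using fr by (auto simp: sol_inner_eq frame3_sum[OF fr] ax frame3_def algebra_simps)
  show nl: "gdiag x l * N x $ l = (gdiag x k * N x $ k) * cvec i j k (partial 1 f v) (partial 2 f v) $ l" for l
    using frame3_cases[OF fr, of l] o fr by (auto simp: cvec_def ax frame3_def)
  have one: "sol_inner x (N x) (N x) = 1" using N x by (auto simp: cmc_normal_def unit_normal_field_def)
  show k: "N x $ k \<noteq> 0"
  proof
    assume "N x $ k = 0"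
    then have "gdiag x l * N x $ l = 0" for l using nl[of l] by simp
    then have "N x $ l = 0" for l using gdiag_pos[of x l] by (metis less_irrefl mult_eq_0_iff)
    then show False using one by (simp add: sol_inner_eq)
  qed
  define \<mu> where "\<mu> = gdiag x k * N x $ k"
  have "gdiag x l * N x $ l * N x $ l = \<mu>\<^sup>2 * (cvec i j k (partial 1 f v) (partial 2 f v) $ l)\<^sup>2 / gdiag x l" for l
  proof -
    have "gdiag x l * N x $ l * N x $ l = (gdiag x l * N x $ l)\<^sup>2 / gdiag x l" using gdiag_pos[of x l] by (simp add: power2_eq_square)
    then show ?thesis unfolding nl[of l] \<mu>_def by (simp add: power_mult_distrib)
  qed
  then have "1 = \<mu>\<^sup>2 * (1 / gdiag x k + (partial 1 f v)\<^sup>2 / gdiag x i + (partial 2 f v)\<^sup>2 / gdiag x j)"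
    using one by (simp add: sol_inner_eq frame3_sum[OF fr] cvec_nth[OF fr] algebra_simps)
  moreover have "(slope_norm i j k x (partial 1 f v) (partial 2 f v))\<^sup>2
    = 1 / gdiag x k + (partial 1 f v)\<^sup>2 / gdiag x i + (partial 2 f v)\<^sup>2 / gdiag x j"
    unfolding slope_norm_def
    by (intro real_sqrt_pow2 add_nonneg_nonneg divide_nonneg_pos gdiag_pos zero_le_power2 zero_le_one)
  ultimately show "(gdiag x k * N x $ k * slope_norm i j k x (partial 1 f v) (partial 2 f v))\<^sup>2 = 1"
    by (simp add: power_mult_distrib \<mu>_def)
qed

text \<open>Multiplying \<open>trace (I\<^sup>-\<^sup>1 II) = 2 H\<close> by \<open>det I\<close> replaces the inverse by the adjugate, and dividing by the
  \<open>k\<close>-component \<open>\<mu>\<close> of the lowered normal leaves the second derivatives of \<open>f\<close> with coefficients free of the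
  normal, because \<open>\<mu>\<close> is the sign \<open>s\<close> divided by \<open>slope_norm\<close>.\<close>

lemma local_graph_cmc_solution:
  assumes N: "cmc_normal M N H" and fr: "frame3 i j k" and lg: "local_graph M i j k p r e f"
    and s: "s\<^sup>2 = 1" "\<And>v. v \<in> ball (pr i j p) r \<Longrightarrow> s * N (gpt i j k v (f v)) $ k > 0"
  shows "cmc_solution i j k (2 * H * s) (ball (pr i j p) r) f"
  unfolding cmc_solution_def Let_def
proof (intro conjI ballI)
  let ?B = "ball (pr i j p) r" and ?X = "\<lambda>v. gpt i j k v (f v)"
  show fs: "smooth_on ?B f" by (rule local_graphD(3)[OF lg])
  fix v assume v: "v \<in> ?B"
  define x where "x = ?X v"
  define p1 p2 where "p1 = partial 1 f v" and "p2 = partial 2 f v"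
  define \<mu> where "\<mu> = gdiag x k * N x $ k"
  define W where "W = slope_norm i j k x p1 p2"
  note nrm = local_graph_normal[OF N fr lg v, folded x_def p1_def p2_def, folded \<mu>_def W_def]
  have "W > 0" unfolding W_def by (rule slope_norm_pos)
  have "s * \<mu> > 0"
    using mult_pos_pos[OF gdiag_pos[of x k] s(2)[OF v, folded x_def]] by (simp add: \<mu>_def mult_ac)
  have "\<mu> * W = s"
  proof -
    have "(\<mu> * W - s) * (\<mu> * W + s) = 0" using nrm(3) s(1) by (simp add: algebra_simps power2_eq_square)
    moreover have "s * (\<mu> * W + s) > 0"
      using mult_pos_pos[OF \<open>s * \<mu> > 0\<close> \<open>W > 0\<close>] s(1) by (simp add: algebra_simps power2_eq_square)
    ultimately show ?thesis by auto
  qed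
  have "\<mu> \<noteq> 0" using \<open>s * \<mu> > 0\<close> by auto
  have op: "open_param M ?B ?X" by (rule local_graph_open_param[OF fr lg])
  have df: "f differentiable (at w)" if "w \<in> ?B" for w
    by (rule smooth_on_differentiable[OF open_ball fs that])
  define tt where "tt a = (if a = 1 then tvec i k p1 else tvec j k p2)" for a :: 2
  have two: "a = 1 \<or> a = 2" for a :: 2 using exhaust_2 by blast
  have pX: "partial a ?X w = (if a = 1 then axis i 1 else axis j 1) + partial a f w *\<^sub>R axis k 1" if "w \<in> ?B" for a w
    using two[of a] partial_gpt[OF df[OF that]] by auto
  have pXv: "partial a ?X v = tt a" for a
    using two[of a] pX[OF v, of a] by (auto simp: tt_def tvec_def p1_def p2_def)
  have ppX: "partial a (partial b ?X) v = partial a (partial b f) v *\<^sub>R axis k 1" for a b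
  proof -
    have "partial b f differentiable (at v)" by (rule smooth_on_differentiable[OF open_ball smooth_on_partial[OF fs] v])
    from differentiable_has_derivative_2[OF this]
    have "((\<lambda>w. (if b = 1 then axis i 1 else axis j 1) + partial b f w *\<^sub>R axis k 1) has_derivative
       (\<lambda>h. (partial 1 (partial b f) v * h $ 1 + partial 2 (partial b f) v * h $ 2) *\<^sub>R axis k 1)) (at v)"
      by (auto intro!: derivative_eq_intros)
    then have "(partial b ?X has_derivative
       (\<lambda>h. (partial 1 (partial b f) v * h $ 1 + partial 2 (partial b f) v * h $ 2) *\<^sub>R axis k 1)) (at v)"
      by (rule has_derivative_transform_within_open[OF _ open_ball v]) (simp add: pX)
    from partial_eqI[OF this, of a] show ?thesis using two[of a] by (auto simp: axis_def)
  qed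
  define c where "c = cvec i j k p1 p2"
  have ck: "c $ k = 1" by (simp add: c_def cvec_nth[OF fr])
  define I where "I = first_fundamental_form ?X v"
  define II where "II = second_fundamental_form ?X (N x) v"
  have I: "I $ 1 $ 1 = cE i k x p1" "I $ 2 $ 2 = cE j k x p2" "I $ 1 $ 2 = cF k x p1 p2" "I $ 2 $ 1 = cF k x p1 p2"
    by (simp_all add: I_def first_fundamental_form_def pXv tt_def sol_inner_tvec[OF fr] x_def[symmetric])
  have II: "II $ a $ b = \<mu> * (partial a (partial b f) v + chr_term x c (tt a) (tt b))" for a b
  proof -
    let ?c = "cov_deriv ?X a b v"
    have "II $ a $ b = (\<Sum>l\<in>UNIV. ?c $ l * (gdiag x l * N x $ l))"
      by (simp add: II_def second_fundamental_form_def sol_inner_eq x_def[symmetric] mult_ac)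
    also have "\<dots> = (\<Sum>l\<in>UNIV. \<mu> * (c $ l * ?c $ l))"
      by (simp add: nrm(1) c_def mult_ac)
    also have "\<dots> = \<mu> * (\<Sum>l\<in>UNIV. c $ l * ?c $ l)" by (simp add: sum_distrib_left)
    also have "(\<Sum>l\<in>UNIV. c $ l * ?c $ l) = 
      (\<Sum>l\<in>UNIV. c $ l * (partial a (partial b f) v *\<^sub>R axis k 1) $ l) + chr_term x c (tt a) (tt b)"
      unfolding cov_deriv_def ppX pXv chr_term_def x_def
      by (simp add: distrib_left sum.distrib sum_distrib_left)
    also have "(\<Sum>l\<in>UNIV. c $ l * (partial a (partial b f) v *\<^sub>R axis k 1) $ l) = partial a (partial b f) v"
      using ck by (simp add: axis_def if_distrib[where f="\<lambda>z. _ * z"] cong: if_cong)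
    finally show ?thesis .
  qed
  have d: "I $ 1 $ 1 * I $ 2 $ 2 - I $ 1 $ 2 * I $ 2 $ 1 = cE i k x p1 * cE j k x p2 - (cF k x p1 p2)\<^sup>2" (is "_ = ?d")
    by (simp add: I power2_eq_square)
  have dpos: "?d > 0" by (rule area_pos)
  have "trace (matrix_inv I ** II) / 2 = H"
    using cmc_normal_open_param(2)[OF N op v] by (simp add: mean_curvature_def I_def II_def x_def)
  then have "2 * H * ?d = I $ 2 $ 2 * II $ 1 $ 1 - I $ 1 $ 2 * II $ 2 $ 1 - I $ 2 $ 1 * II $ 1 $ 2 + I $ 1 $ 1 * II $ 2 $ 2"
    using trace_matrix_inv_2[of I II] d dpos by simp
  also have "\<dots> = \<mu> * (cE j k x p2 * (partial 1 (partial 1 f) v + chr_term x c (tt 1) (tt 1))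
     - cF k x p1 p2 * (partial 2 (partial 1 f) v + chr_term x c (tt 2) (tt 1) + partial 1 (partial 2 f) v + chr_term x c (tt 1) (tt 2))
     + cE i k x p1 * (partial 2 (partial 2 f) v + chr_term x c (tt 2) (tt 2)))" (is "_ = \<mu> * ?R")
    unfolding I II by (simp add: algebra_simps)
  finally have "2 * H * ?d = \<mu> * ?R" .
  then have e1: "s * W * (2 * H * ?d) = (s * (\<mu> * W)) * ?R" by simp
  have "s * (\<mu> * W) = 1" using \<open>\<mu> * W = s\<close> s(1) by (simp add: power2_eq_square)
  then have "?R = s * W * (2 * H * ?d)" unfolding e1 by (simp only: mult_1)
  then have "?R = 2 * H * s * ?d * W" by (simp only: mult_ac)
  then show "cE j k (?X v) (partial 2 f v) * partial 1 (partial 1 f) v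
        - cF k (?X v) (partial 1 f v) (partial 2 f v) * (partial 1 (partial 2 f) v + partial 2 (partial 1 f) v)
        + cE i k (?X v) (partial 1 f v) * partial 2 (partial 2 f) v + cB i j k (2 * H * s) (?X v) (partial 1 f v) (partial 2 f v) = 0"
    unfolding cB_def x_def[symmetric] p1_def[symmetric] p2_def[symmetric] W_def[symmetric] c_def[symmetric]
    by (simp add: tt_def algebra_simps)
qed simp


subsection \<open>Differences of solutions\<close>

text \<open>Lipschitz continuity near one point, a property inherited by all algebraic operations in the coefficients.
  Only a neighbourhood of the common 1-jet of two touching solutions matters.\<close>

definition lip_at :: "('a::metric_space \<Rightarrow> real) \<Rightarrow> 'a \<Rightarrow> bool" where
  "lip_at f a \<longleftrightarrow> (\<exists>L r. 0 < r \<and> 0 \<le> L \<and> (\<forall>x\<in>ball a r. \<forall>y\<in>ball a r. \<bar>f x - f y\<bar> \<le> L * dist x y))"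

lemma lip_atE:
  assumes "lip_at f a"
  obtains L r where "0 < r" "0 \<le> L" "\<forall>x\<in>ball a r. \<forall>y\<in>ball a r. \<bar>f x - f y\<bar> \<le> L * dist x y"
  using assms unfolding lip_at_def by blast

lemma lip_atI:
  assumes "0 < r" "0 \<le> L" "\<And>x y. x \<in> ball a r \<Longrightarrow> y \<in> ball a r \<Longrightarrow> \<bar>f x - f y\<bar> \<le> L * dist x y"
  shows "lip_at f a"
  using assms unfolding lip_at_def by blast

lemma lip_at_const: "lip_at (\<lambda>x. c) a"
  by (rule lip_atI[of 1 0]) auto

lemma lip_at_bounded_linear:
  fixes L :: "'a::real_normed_vector \<Rightarrow> real"
  assumes "bounded_linear L" shows "lip_at L a"
proof -
  obtain K where K: "K > 0" "\<And>x. norm (L x) \<le> norm x * K"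
    using bounded_linear.pos_bounded[OF assms] by blast
  show ?thesis
  proof (rule lip_atI[of 1 K])
    fix x y
    have "L x - L y = L (x - y)" using assms by (simp add: linear_simps)
    then show "\<bar>L x - L y\<bar> \<le> K * dist x y" using K(2)[of "x - y"] by (simp add: dist_norm mult.commute)
  qed (use K in auto)
qed

lemma lip_at_add:
  assumes "lip_at f a" "lip_at g a" shows "lip_at (\<lambda>x. f x + g x) a"
proof -
  obtain L1 r1 where 1: "0 < r1" "0 \<le> L1" "\<forall>x\<in>ball a r1. \<forall>y\<in>ball a r1. \<bar>f x - f y\<bar> \<le> L1 * dist x y"
    using lip_atE[OF assms(1)] by metis
  obtain L2 r2 where 2: "0 < r2" "0 \<le> L2" "\<forall>x\<in>ball a r2. \<forall>y\<in>ball a r2. \<bar>g x - g y\<bar> \<le> L2 * dist x y"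
    using lip_atE[OF assms(2)] by metis
  show ?thesis
  proof (rule lip_atI[of "min r1 r2" "L1 + L2"])
    fix x y assume "x \<in> ball a (min r1 r2)" "y \<in> ball a (min r1 r2)"
    then have "\<bar>f x - f y\<bar> \<le> L1 * dist x y" "\<bar>g x - g y\<bar> \<le> L2 * dist x y" using 1(3) 2(3) by auto
    then show "\<bar>f x + g x - (f y + g y)\<bar> \<le> (L1 + L2) * dist x y" by (simp add: algebra_simps)
  qed (use 1 2 in auto)
qed

lemma lip_at_sum:
  assumes "\<And>i. i \<in> I \<Longrightarrow> lip_at (f i) a"
  shows "lip_at (\<lambda>x. \<Sum>i\<in>I. f i x) a"
  using assms by (induction I rule: infinite_finite_induct) (auto intro: lip_at_const lip_at_add)

lemma lip_at_bounded:
  assumes "lip_at f a"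
  obtains r C where "0 < r" "0 \<le> C" "\<And>x. x \<in> ball a r \<Longrightarrow> \<bar>f x\<bar> \<le> C"
proof -
  obtain L r where 1: "0 < r" "0 \<le> L" "\<forall>x\<in>ball a r. \<forall>y\<in>ball a r. \<bar>f x - f y\<bar> \<le> L * dist x y"
    using lip_atE[OF assms] by metis
  show thesis
  proof (rule that[OF 1(1), of "\<bar>f a\<bar> + L * r"])
    fix x assume x: "x \<in> ball a r"
    then have "\<bar>f x - f a\<bar> \<le> L * dist x a" using 1 by auto
    also have "\<dots> \<le> L * r" using x 1(2) by (intro mult_left_mono) (auto simp: dist_commute)
    finally show "\<bar>f x\<bar> \<le> \<bar>f a\<bar> + L * r" by linarith
  qed (use 1 in auto)
qed

lemma lip_at_mult:
  assumes "lip_at f a" "lip_at g a" shows "lip_at (\<lambda>x. f x * g x) a"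
proof -
  obtain L1 r1 where 1: "0 < r1" "0 \<le> L1" "\<forall>x\<in>ball a r1. \<forall>y\<in>ball a r1. \<bar>f x - f y\<bar> \<le> L1 * dist x y"
    using lip_atE[OF assms(1)] by metis
  obtain L2 r2 where 2: "0 < r2" "0 \<le> L2" "\<forall>x\<in>ball a r2. \<forall>y\<in>ball a r2. \<bar>g x - g y\<bar> \<le> L2 * dist x y"
    using lip_atE[OF assms(2)] by metis
  obtain r3 C1 where 3: "0 < r3" "0 \<le> C1" "\<And>x. x \<in> ball a r3 \<Longrightarrow> \<bar>f x\<bar> \<le> C1"
    using lip_at_bounded[OF assms(1)] by metis
  obtain r4 C2 where 4: "0 < r4" "0 \<le> C2" "\<And>x. x \<in> ball a r4 \<Longrightarrow> \<bar>g x\<bar> \<le> C2"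
    using lip_at_bounded[OF assms(2)] by metis
  show ?thesis
  proof (rule lip_atI[of "min (min r1 r2) (min r3 r4)" "C1 * L2 + L1 * C2"])
    fix x y assume "x \<in> ball a (min (min r1 r2) (min r3 r4))" "y \<in> ball a (min (min r1 r2) (min r3 r4))"
    then have *: "\<bar>f x - f y\<bar> \<le> L1 * dist x y" "\<bar>g x - g y\<bar> \<le> L2 * dist x y" "\<bar>f x\<bar> \<le> C1" "\<bar>g y\<bar> \<le> C2"
      using 1(3) 2(3) 3(3) 4(3) by auto
    have "\<bar>f x * g x - f y * g y\<bar> = \<bar>f x * (g x - g y) + (f x - f y) * g y\<bar>" by (simp add: algebra_simps)
    also have "\<dots> \<le> \<bar>f x\<bar> * \<bar>g x - g y\<bar> + \<bar>f x - f y\<bar> * \<bar>g y\<bar>"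
      by (metis abs_mult abs_triangle_ineq)
    also have "\<dots> \<le> C1 * (L2 * dist x y) + (L1 * dist x y) * C2"
      using * 1 2 3 4 by (intro add_mono mult_mono) auto
    finally show "\<bar>f x * g x - f y * g y\<bar> \<le> (C1 * L2 + L1 * C2) * dist x y" by (simp add: algebra_simps)
  qed (use 1 2 3 4 in auto)
qed

lemma lip_at_diff:
  assumes "lip_at f a" "lip_at g a" shows "lip_at (\<lambda>x. f x - g x) a"
  using lip_at_add[OF assms(1) lip_at_mult[OF lip_at_const[of "-1"] assms(2)]] by simp

lemma continuous_on_compact_bounded:
  fixes \<phi> :: "'a::topological_space \<Rightarrow> real"
  assumes "compact S" "continuous_on S \<phi>"
  obtains C where "C \<ge> 0" "\<forall>x\<in>S. \<bar>\<phi> x\<bar> \<le> C"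
proof -
  obtain C where "\<forall>y\<in>\<phi> ` S. norm y \<le> C"
    using compact_imp_bounded[OF compact_continuous_image[OF assms(2,1)]] unfolding bounded_iff by blast
  then have "\<forall>x\<in>S. \<bar>\<phi> x\<bar> \<le> max C 0" by fastforce
  then show thesis using that[of "max C 0"] by simp
qed

lemma lip_at_compose_real:
  assumes f: "lip_at f a" and \<phi>: "\<And>t. t \<in> S \<Longrightarrow> (\<phi> has_real_derivative \<phi>' t) (at t)" and S: "open S" "f a \<in> S"
    and cont: "continuous_on S \<phi>'"
  shows "lip_at (\<lambda>x. \<phi> (f x)) a"
proof -
  obtain L r where 1: "0 < r" "0 \<le> L" "\<forall>x\<in>ball a r. \<forall>y\<in>ball a r. \<bar>f x - f y\<bar> \<le> L * dist x y"
    using lip_atE[OF f] by metis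
  obtain d where d: "d > 0" "cball (f a) d \<subseteq> S" using S open_contains_cball by meson
  obtain C where "C \<ge> 0" and C: "\<forall>t\<in>cball (f a) d. \<bar>\<phi>' t\<bar> \<le> C"
    using continuous_on_compact_bounded[OF compact_cball continuous_on_subset[OF cont d(2)]] by blast
  define r' where "r' = min r (d / (L + 1))"
  have r': "0 < r'" "r' \<le> r" "r' \<le> d / (L + 1)" using 1 d by (auto simp: r'_def)
  have fd: "f x \<in> cball (f a) d" if "x \<in> ball a r'" for x
  proof -
    have "\<bar>f a - f x\<bar> \<le> L * dist a x" using 1 that r'(2) by auto
    also have "\<dots> \<le> L * (d / (L + 1))" using that r'(3) 1(2) by (intro mult_left_mono) auto
    also have "\<dots> \<le> d" using 1(2) d(1) by (simp add: divide_simps)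
    finally show ?thesis by (simp add: dist_real_def)
  qed
  show ?thesis
  proof (rule lip_atI[OF r'(1), of "C * L"])
    fix x y assume xy: "x \<in> ball a r'" "y \<in> ball a r'"
    have "norm (\<phi> (f x) - \<phi> (f y)) \<le> C * norm (f x - f y)"
    proof (rule field_differentiable_bound[of "cball (f a) d" \<phi> \<phi>'])
      show "(\<phi> has_real_derivative \<phi>' z) (at z within cball (f a) d)" if "z \<in> cball (f a) d" for z
        using \<phi> that d(2) by (blast intro: has_field_derivative_at_within)
      show "norm (\<phi>' z) \<le> C" if "z \<in> cball (f a) d" for z using C that by auto
    qed (use fd[OF xy(1)] fd[OF xy(2)] in auto)
    also have "\<dots> \<le> C * (L * dist x y)" using xy r'(2) 1(3) \<open>C \<ge> 0\<close> by (intro mult_left_mono) auto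
    finally show "\<bar>\<phi> (f x) - \<phi> (f y)\<bar> \<le> C * L * dist x y" by (simp add: mult.assoc)
  qed (use \<open>C \<ge> 0\<close> 1 in auto)
qed

lemma lip_at_exp: "lip_at f a \<Longrightarrow> lip_at (\<lambda>x. exp (f x)) a"
  by (rule lip_at_compose_real[where S = UNIV and \<phi> = exp and \<phi>' = exp]) (auto intro!: derivative_eq_intros continuous_intros)

lemma lip_at_inverse: "lip_at f a \<Longrightarrow> f a \<noteq> 0 \<Longrightarrow> lip_at (\<lambda>x. inverse (f x)) a"
proof (rule lip_at_compose_real[where S = "- {0}" and \<phi> = inverse])
  show "(inverse has_real_derivative - (inverse t ^ Suc (Suc 0))) (at t)" if "t \<in> - {0}" for t :: real
    using that by (intro DERIV_inverse) simp
qed (auto intro!: continuous_intros)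

lemma lip_at_divide: "lip_at f a \<Longrightarrow> lip_at g a \<Longrightarrow> g a \<noteq> 0 \<Longrightarrow> lip_at (\<lambda>x. f x / g x) a"
  unfolding divide_inverse by (intro lip_at_mult lip_at_inverse)

lemma lip_at_sqrt: "lip_at f a \<Longrightarrow> f a > 0 \<Longrightarrow> lip_at (\<lambda>x. sqrt (f x)) a"
  by (rule lip_at_compose_real[where S = "{0<..}" and \<phi> = sqrt and \<phi>' = "\<lambda>t. inverse (sqrt t) / 2"])
     (auto intro!: DERIV_real_sqrt continuous_intros)

type_synonym jet = "(real^3) \<times> real \<times> real"

lemma lip_at_jet:
  fixes a :: jet
  shows "lip_at (\<lambda>a. fst a $ l) a" "lip_at (\<lambda>a. fst (snd a)) a" "lip_at (\<lambda>a. snd (snd a)) a"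
  by (rule lip_at_bounded_linear, 
      intro bounded_linear_compose[OF bounded_linear_vec_nth bounded_linear_fst] 
            bounded_linear_compose[OF bounded_linear_fst bounded_linear_snd]
            bounded_linear_compose[OF bounded_linear_snd bounded_linear_snd])+

lemma lip_at_gdiag:
  fixes a :: jet
  shows "lip_at (\<lambda>a. gdiag (fst a) l) a" "lip_at (\<lambda>a. gdiag_dz (fst a) l) a"
proof -
  have "lip_at (\<lambda>a::jet. exp (2 * fst a $ 3)) a" "lip_at (\<lambda>a::jet. exp (- 2 * fst a $ 3)) a"
    "lip_at (\<lambda>a::jet. 2 * exp (2 * fst a $ 3)) a" "lip_at (\<lambda>a::jet. - 2 * exp (- 2 * fst a $ 3)) a"
    by (intro lip_at_exp lip_at_mult lip_at_const lip_at_jet)+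
  then show "lip_at (\<lambda>a. gdiag (fst a) l) a" "lip_at (\<lambda>a. gdiag_dz (fst a) l) a"
    unfolding gdiag_def gdiag_dz_def by (cases "l = 1"; cases "l = 2"; simp add: lip_at_const)+
qed

lemma lip_at_christoffel:
  fixes a :: jet
  shows "lip_at (\<lambda>a. christoffel (fst a) l m n) a"
proof -
  have if_lip: "lip_at (\<lambda>a. if b then g a else 0) a" if "lip_at g a" for b and g :: "jet \<Rightarrow> real"
    using that by (cases b) (auto intro: lip_at_const)
  show ?thesis
    unfolding christoffel_eq using gdiag_pos[of "fst a" l]
    by (intro lip_at_divide lip_at_diff lip_at_add lip_at_mult lip_at_const if_lip lip_at_gdiag) auto
qed

lemma lip_at_power2: "lip_at f a \<Longrightarrow> lip_at (\<lambda>x. (f x)\<^sup>2) a"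
  unfolding power2_eq_square by (rule lip_at_mult)

lemma lip_at_coefficients:
  fixes a :: jet
  shows "lip_at (\<lambda>a. cE i k (fst a) (fst (snd a))) a"
    "lip_at (\<lambda>a. cE j k (fst a) (snd (snd a))) a"
    "lip_at (\<lambda>a. cF k (fst a) (fst (snd a)) (snd (snd a))) a"
    "lip_at (\<lambda>a. cB i j k c (fst a) (fst (snd a)) (snd (snd a))) a"
proof -
  show E: "lip_at (\<lambda>a. cE i k (fst a) (fst (snd a))) a" for i and a :: jet
    unfolding cE_def by (intro lip_at_add lip_at_mult lip_at_power2 lip_at_gdiag lip_at_jet)
  show G: "lip_at (\<lambda>a. cE j k (fst a) (snd (snd a))) a" for j and a :: jet
    unfolding cE_def by (intro lip_at_add lip_at_mult lip_at_power2 lip_at_gdiag lip_at_jet)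
  show F: "lip_at (\<lambda>a. cF k (fst a) (fst (snd a)) (snd (snd a))) a" for a :: jet
    unfolding cF_def by (intro lip_at_mult lip_at_gdiag lip_at_jet)
  have t: "lip_at (\<lambda>a. tvec i k (fst (snd a)) $ l) a" "lip_at (\<lambda>a. tvec j k (snd (snd a)) $ l) a" for l
    unfolding tvec_def vector_add_component vector_scaleR_component real_scaleR_def
    by (intro lip_at_add lip_at_mult lip_at_const lip_at_jet)+
  have c: "lip_at (\<lambda>a. cvec i j k (fst (snd a)) (snd (snd a)) $ l) a" for l
    unfolding cvec_def vector_minus_component vector_scaleR_component real_scaleR_def
    by (intro lip_at_diff lip_at_mult lip_at_const lip_at_jet)
  have ch: "lip_at (\<lambda>a. chr_term (fst a) (C a) (s a) (t a)) a"
    if "\<And>l. lip_at (\<lambda>a. C a $ l) a" "\<And>l. lip_at (\<lambda>a. s a $ l) a" "\<And>l. lip_at (\<lambda>a. t a $ l) a" for C s t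
    unfolding chr_term_def by (intro lip_at_sum lip_at_mult lip_at_christoffel that)
  have "1 / gdiag (fst a) k + (fst (snd a))\<^sup>2 / gdiag (fst a) i + (snd (snd a))\<^sup>2 / gdiag (fst a) j > 0"
    using slope_norm_pos[of i j k "fst a" "fst (snd a)" "snd (snd a)"] by (simp add: slope_norm_def)
  then have W: "lip_at (\<lambda>a. slope_norm i j k (fst a) (fst (snd a)) (snd (snd a))) a"
    unfolding slope_norm_def
    by (intro lip_at_sqrt lip_at_add lip_at_divide lip_at_power2 lip_at_const lip_at_gdiag lip_at_jet gdiag_pos less_imp_neq[OF gdiag_pos, symmetric])
  show "lip_at (\<lambda>a. cB i j k c (fst a) (fst (snd a)) (snd (snd a))) a"
    unfolding cB_def by (intro lip_at_add lip_at_diff lip_at_mult lip_at_power2 lip_at_const E F G W ch t c)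
qed


lemma partial_diff:
  fixes f g :: "real^2 \<Rightarrow> real"
  assumes \<Omega>: "open \<Omega>" and fs: "smooth_on \<Omega> f" and gs: "smooth_on \<Omega> g" and v: "v \<in> \<Omega>"
  shows "partial a (\<lambda>v. g v - f v) v = partial a g v - partial a f v"
    "partial b (partial a (\<lambda>v. g v - f v)) v = partial b (partial a g) v - partial b (partial a f) v"
proof -
  have *: "partial a (\<lambda>v. g v - f v) v = partial a g v - partial a f v"
    if "smooth_on \<Omega> f" "smooth_on \<Omega> g" "v \<in> \<Omega>" for a f g v
  proof -
    have "((\<lambda>v. g v - f v) has_derivative (\<lambda>h. frechet_derivative g (at v) h - frechet_derivative f (at v) h)) (at v)"
      using smooth_on_differentiable[OF \<Omega> that(1,3)] smooth_on_differentiable[OF \<Omega> that(2,3)]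
      by (intro has_derivative_diff) (simp_all add: frechet_derivative_works)
    from partial_eqI[OF this] show ?thesis by (simp add: partial_def)
  qed
  show "partial a (\<lambda>v. g v - f v) v = partial a g v - partial a f v" by (rule *[OF fs gs v])
  have "((\<lambda>v. partial a g v - partial a f v) has_derivative (\<lambda>h. frechet_derivative (partial a g) (at v) h - frechet_derivative (partial a f) (at v) h)) (at v)"
    using smooth_on_differentiable[OF \<Omega> smooth_on_partial[OF fs] v] smooth_on_differentiable[OF \<Omega> smooth_on_partial[OF gs] v]
    by (intro has_derivative_diff) (simp_all add: frechet_derivative_works)
  then have "(partial a (\<lambda>v. g v - f v) has_derivative (\<lambda>h. frechet_derivative (partial a g) (at v) h - frechet_derivative (partial a f) (at v) h)) (at v)"
    by (rule has_derivative_transform_within_open[OF _ \<Omega> v]) (simp add: *[OF fs gs])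
  from partial_eqI[OF this] show "partial b (partial a (\<lambda>v. g v - f v)) v = partial b (partial a g) v - partial b (partial a f) v"
    by (simp add: partial_def)
qed

lemma smooth_on_diff:
  fixes f g :: "real^2 \<Rightarrow> real"
  assumes "open \<Omega>" "smooth_on \<Omega> f" "smooth_on \<Omega> g"
  shows "smooth_on \<Omega> (\<lambda>v. g v - f v)"
proof -
  have "Ck_on k (\<lambda>v. g v + (-1) * f v) \<Omega>" for k
    using assms unfolding smooth_on_def by (intro Ck_on_add Ck_on_mult Ck_on_const) auto
  then show ?thesis by (simp add: smooth_on_def)
qed

text \<open>Subtracting the equations of \<open>f\<close> and \<open>g\<close> leaves the second order part of \<open>w = g - f\<close> with the coefficients of
  \<open>f\<close>, plus differences of coefficients times second derivatives of \<open>g\<close>. Near \<open>v0\<close> the two 1-jets stay in a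
  region where the coefficients are Lipschitz, so these differences are at most a multiple of
  \<open>\<bar>w\<bar> + \<bar>Dw\<bar>\<close>.\<close>

lemma elliptic_difference:
  assumes fr: "frame3 i j k" and f: "cmc_solution i j k c \<Omega> f" and g: "cmc_solution i j k c \<Omega> g"
    and v0: "v0 \<in> \<Omega>" and fg: "f v0 = g v0" "partial 1 f v0 = partial 1 g v0" "partial 2 f v0 = partial 2 g v0"
  obtains \<rho> where "\<rho> > 0" "ball v0 \<rho> \<subseteq> \<Omega>" "elliptic_ineq (ball v0 \<rho>) (\<lambda>v. g v - f v)"
proof -
  have \<Omega>: "open \<Omega>" and fs: "smooth_on \<Omega> f" and gs: "smooth_on \<Omega> g"
    using f g by (auto simp: cmc_solution_def)
  define jet where "jet u v = (gpt i j k v (u v), partial 1 u v, partial 2 u v)" for u v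
  have cjet: "continuous_on \<Omega> (jet u)" if "smooth_on \<Omega> u" for u
    unfolding jet_def using that
    by (intro continuous_intros smooth_on_continuous smooth_on_partial)
  define A11 where "A11 a = cE j k (fst a) (snd (snd a))" for a :: jet
  define A12 where "A12 a = - cF k (fst a) (fst (snd a)) (snd (snd a))" for a :: jet
  define A22 where "A22 a = cE i k (fst a) (fst (snd a))" for a :: jet
  define Bc where "Bc a = cB i j k c (fst a) (fst (snd a)) (snd (snd a))" for a :: jet
  have eqn: "A11 (jet u v) * partial 1 (partial 1 u) v + A12 (jet u v) * (partial 1 (partial 2 u) v + partial 2 (partial 1 u) v)
     + A22 (jet u v) * partial 2 (partial 2 u) v + Bc (jet u v) = 0"
    if "cmc_solution i j k c \<Omega> u" "v \<in> \<Omega>" for u v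
    using that unfolding cmc_solution_def Let_def by (simp add: jet_def A11_def A12_def A22_def Bc_def)
  define a0 where "a0 = jet f v0"
  have a0g: "jet g v0 = a0" using fg by (simp add: a0_def jet_def)
  have lips: "lip_at A11 a0" "lip_at A12 a0" "lip_at A22 a0" "lip_at Bc a0"
    unfolding A11_def A12_def A22_def Bc_def
    using lip_at_mult[OF lip_at_const[of "-1"] lip_at_coefficients(3)[of k a0]]
    by (auto intro: lip_at_coefficients)
  obtain L1 r1 where 1: "0 < r1" "0 \<le> L1" "\<forall>x\<in>ball a0 r1. \<forall>y\<in>ball a0 r1. \<bar>A11 x - A11 y\<bar> \<le> L1 * dist x y"
    using lips(1) unfolding lip_at_def by blast
  obtain L2 r2 where 2: "0 < r2" "0 \<le> L2" "\<forall>x\<in>ball a0 r2. \<forall>y\<in>ball a0 r2. \<bar>A12 x - A12 y\<bar> \<le> L2 * dist x y"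
    using lips(2) unfolding lip_at_def by blast
  obtain L3 r3 where 3: "0 < r3" "0 \<le> L3" "\<forall>x\<in>ball a0 r3. \<forall>y\<in>ball a0 r3. \<bar>A22 x - A22 y\<bar> \<le> L3 * dist x y"
    using lips(3) unfolding lip_at_def by blast
  obtain L4 r4 where 4: "0 < r4" "0 \<le> L4" "\<forall>x\<in>ball a0 r4. \<forall>y\<in>ball a0 r4. \<bar>Bc x - Bc y\<bar> \<le> L4 * dist x y"
    using lips(4) unfolding lip_at_def by blast
  define r where "r = min (min r1 r2) (min r3 r4)"
  have r: "r > 0" using 1 2 3 4 by (auto simp: r_def)
  have near: "\<exists>d>0. \<forall>v\<in>ball v0 d. jet u v \<in> ball a0 r" if "smooth_on \<Omega> u" "jet u v0 = a0" for u
  proof -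
    have "continuous (at v0) (jet u)" using cjet[OF that(1)] v0 \<Omega> continuous_on_eq_continuous_at by blast
    then obtain d where "d > 0" "\<And>v. dist v v0 < d \<Longrightarrow> dist (jet u v) (jet u v0) < r"
      using r unfolding continuous_at_eps_delta by blast
    then show ?thesis by (intro exI[of _ d]) (auto simp: that(2) dist_commute)
  qed
  obtain df where df: "df > 0" "\<forall>v\<in>ball v0 df. jet f v \<in> ball a0 r" using near[OF fs] a0_def by blast
  obtain dg where dg: "dg > 0" "\<forall>v\<in>ball v0 dg. jet g v \<in> ball a0 r" using near[OF gs a0g] by blast
  obtain d0 where d0: "d0 > 0" "cball v0 d0 \<subseteq> \<Omega>" using \<Omega> v0 open_contains_cball by meson
  define \<rho> where "\<rho> = min (min df dg) d0"
  have \<rho>: "\<rho> > 0" using df dg d0 by (simp add: \<rho>_def)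
  have \<rho>in: "v \<in> \<Omega>" "jet f v \<in> ball a0 r" "jet g v \<in> ball a0 r" "v \<in> cball v0 d0" if "v \<in> ball v0 \<rho>" for v
    using that df(2) dg(2) d0(2) by (auto simp: \<rho>_def)
  \<comment> \<open>uniform bounds on a compact disc\<close>
  have bd: "\<exists>C\<ge>0. \<forall>v\<in>cball v0 d0. \<bar>\<phi> v\<bar> \<le> C" if "continuous_on \<Omega> \<phi>" for \<phi> :: "real^2 \<Rightarrow> real"
    using continuous_on_compact_bounded[OF compact_cball continuous_on_subset[OF that d0(2)]] by blast
  obtain C11 where C11: "C11 \<ge> 0" "\<forall>v\<in>cball v0 d0. \<bar>partial 1 (partial 1 g) v\<bar> \<le> C11"
    using bd[OF smooth_on_continuous[OF smooth_on_partial[OF smooth_on_partial[OF gs]]]] by blast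
  obtain C22 where C22: "C22 \<ge> 0" "\<forall>v\<in>cball v0 d0. \<bar>partial 2 (partial 2 g) v\<bar> \<le> C22"
    using bd[OF smooth_on_continuous[OF smooth_on_partial[OF smooth_on_partial[OF gs]]]] by blast
  have "continuous_on \<Omega> (\<lambda>v. partial 1 (partial 2 g) v + partial 2 (partial 1 g) v)"
    by (intro continuous_on_add smooth_on_continuous[OF smooth_on_partial[OF smooth_on_partial[OF gs]]])
  then obtain C12 where C12: "C12 \<ge> 0" "\<forall>v\<in>cball v0 d0. \<bar>partial 1 (partial 2 g) v + partial 2 (partial 1 g) v\<bar> \<le> C12"
    using bd by blast
  have c3: "continuous_on \<Omega> (\<lambda>v. gpt i j k v (f v) $ 3)"
    by (intro continuous_intros smooth_on_continuous[OF fs])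
  obtain Z where Z: "Z \<ge> 0" "\<forall>v\<in>cball v0 d0. \<bar>gpt i j k v (f v) $ 3\<bar> \<le> Z"
    using bd[OF c3] by blast
  have cgdiag: "continuous_on \<Omega> (\<lambda>v. gdiag (gpt i j k v (f v)) l)" for l
    unfolding gdiag_def
    by (cases "l = 1"; cases "l = 2"; simp; intro continuous_intros c3)
  have "continuous_on \<Omega> (\<lambda>v. A11 (jet f v) + A22 (jet f v))"
    unfolding A11_def A22_def cE_def jet_def fst_conv snd_conv
    by (intro continuous_intros cgdiag smooth_on_continuous smooth_on_partial fs)
  then obtain \<Lambda> where \<Lambda>: "\<forall>v\<in>cball v0 d0. \<bar>A11 (jet f v) + A22 (jet f v)\<bar> \<le> \<Lambda>"
    using bd by blast
  define m where "m = exp (- 2 * Z)"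
  have m: "m > 0" by (simp add: m_def)
  have gm: "gdiag (gpt i j k v (f v)) l \<ge> m" if "v \<in> cball v0 d0" for v l
  proof -
    have "\<bar>gpt i j k v (f v) $ 3\<bar> \<le> Z" using Z that by blast
    then show ?thesis using Z(1) by (auto simp: gdiag_def m_def)
  qed
  define K where "K = L1 * C11 + L2 * C12 + L3 * C22 + L4"
  have "K \<ge> 0" unfolding K_def
    by (intro add_nonneg_nonneg mult_nonneg_nonneg 1(2) 2(2) 3(2) 4(2) C11(1) C12(1) C22(1))
  have "elliptic_ineq (ball v0 \<rho>) (\<lambda>v. g v - f v)"
    unfolding elliptic_ineq_def
  proof (intro conjI exI ballI allI)
    show "smooth_on (ball v0 \<rho>) (\<lambda>v. g v - f v)"
      by (rule smooth_on_subset[OF smooth_on_diff[OF \<Omega> fs gs]]) (use \<rho>in in blast)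
    show "m > 0" by (rule m)
    fix v assume v: "v \<in> ball v0 \<rho>"
    note vin = \<rho>in[OF v]
    let ?x = "gpt i j k v (f v)" and ?p1 = "partial 1 f v" and ?p2 = "partial 2 f v"
    show "m * (\<xi>\<^sup>2 + \<eta>\<^sup>2) \<le> A11 (jet f v) * \<xi>\<^sup>2 + 2 * A12 (jet f v) * (\<xi> * \<eta>) + A22 (jet f v) * \<eta>\<^sup>2" for \<xi> \<eta>
    proof -
      have "m * \<xi>\<^sup>2 \<le> gdiag ?x j * \<xi>\<^sup>2" "m * \<eta>\<^sup>2 \<le> gdiag ?x i * \<eta>\<^sup>2"
        by (intro mult_right_mono gm vin zero_le_power2)+
      moreover have "0 \<le> gdiag ?x k * (?p2 * \<xi> - ?p1 * \<eta>)\<^sup>2" using gdiag_pos[of ?x k] by simp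
      moreover have "A11 (jet f v) * \<xi>\<^sup>2 + 2 * A12 (jet f v) * (\<xi> * \<eta>) + A22 (jet f v) * \<eta>\<^sup>2
        = gdiag ?x j * \<xi>\<^sup>2 + gdiag ?x i * \<eta>\<^sup>2 + gdiag ?x k * (?p2 * \<xi> - ?p1 * \<eta>)\<^sup>2"
        by (simp add: A11_def A12_def A22_def jet_def cE_def cF_def power2_eq_square algebra_simps)
      ultimately show ?thesis by (simp add: distrib_left)
    qed
    show "A11 (jet f v) + A22 (jet f v) \<le> \<Lambda>" using \<Lambda> vin(4) abs_le_D1 by blast
    define D where "D = dist (jet f v) (jet g v)"
    have "D \<ge> 0" by (simp add: D_def)
    have D: "D \<le> \<bar>g v - f v\<bar> + \<bar>partial 1 g v - partial 1 f v\<bar> + \<bar>partial 2 g v - partial 2 f v\<bar>"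
    proof -
      have "gpt i j k v (f v) - gpt i j k v (g v) = (f v - g v) *\<^sub>R axis k 1"
        by (simp add: gpt_def algebra_simps)
      then have "dist (gpt i j k v (f v)) (gpt i j k v (g v)) = \<bar>f v - g v\<bar>"
        by (simp add: dist_norm)
      moreover have "dist (a, b) (c, d) \<le> dist a c + dist b d" for a c :: "real^3" and b d :: "real \<times> real"
        unfolding dist_Pair_Pair by (rule sqrt_sum_squares_le_sum) auto
      moreover have "dist (a, b) (c, d) \<le> dist a c + dist b d" for a c b d :: real
        unfolding dist_Pair_Pair by (rule sqrt_sum_squares_le_sum) auto
      ultimately have "D \<le> \<bar>f v - g v\<bar> + (dist (partial 1 f v) (partial 1 g v) + dist (partial 2 f v) (partial 2 g v))"
        unfolding D_def jet_def by (smt (verit))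
      then show ?thesis by (simp add: dist_real_def abs_minus_commute)
    qed
    have ins: "jet f v \<in> ball a0 r1" "jet g v \<in> ball a0 r1" "jet f v \<in> ball a0 r2" "jet g v \<in> ball a0 r2"
      "jet f v \<in> ball a0 r3" "jet g v \<in> ball a0 r3" "jet f v \<in> ball a0 r4" "jet g v \<in> ball a0 r4"
      using vin(2,3) by (auto simp: r_def)
    have dA: "\<bar>A11 (jet f v) - A11 (jet g v)\<bar> \<le> L1 * D" "\<bar>A12 (jet f v) - A12 (jet g v)\<bar> \<le> L2 * D"
      "\<bar>A22 (jet f v) - A22 (jet g v)\<bar> \<le> L3 * D" "\<bar>Bc (jet f v) - Bc (jet g v)\<bar> \<le> L4 * D"
      using ins 1(3) 2(3) 3(3) 4(3) unfolding D_def by blast+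
    let ?w = "\<lambda>v. g v - f v"
    have "A11 (jet f v) * partial 1 (partial 1 ?w) v + A12 (jet f v) * (partial 1 (partial 2 ?w) v + partial 2 (partial 1 ?w) v)
          + A22 (jet f v) * partial 2 (partial 2 ?w) v
      = (A11 (jet f v) - A11 (jet g v)) * partial 1 (partial 1 g) v
        + (A12 (jet f v) - A12 (jet g v)) * (partial 1 (partial 2 g) v + partial 2 (partial 1 g) v)
        + (A22 (jet f v) - A22 (jet g v)) * partial 2 (partial 2 g) v + (Bc (jet f v) - Bc (jet g v))"
      unfolding partial_diff[OF \<Omega> fs gs vin(1)]
      using eqn[OF f vin(1)] eqn[OF g vin(1)] by (simp add: algebra_simps)
    also have "\<bar>\<dots>\<bar> \<le> L1 * D * C11 + L2 * D * C12 + L3 * D * C22 + L4 * D"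
    proof -
      have "\<bar>(A11 (jet f v) - A11 (jet g v)) * partial 1 (partial 1 g) v\<bar> \<le> L1 * D * C11"
        "\<bar>(A12 (jet f v) - A12 (jet g v)) * (partial 1 (partial 2 g) v + partial 2 (partial 1 g) v)\<bar> \<le> L2 * D * C12"
        "\<bar>(A22 (jet f v) - A22 (jet g v)) * partial 2 (partial 2 g) v\<bar> \<le> L3 * D * C22"
        unfolding abs_mult using C11(2) C12(2) C22(2) vin(4) \<open>D \<ge> 0\<close> 1(2) 2(2) 3(2)
        by (blast intro: mult_mono dA mult_nonneg_nonneg abs_ge_zero)+
      then show ?thesis using dA(4) by linarith
    qed
    also have "\<dots> = K * D" by (simp add: K_def algebra_simps)
    also have "\<dots> \<le> K * (\<bar>?w v\<bar> + \<bar>partial 1 ?w v\<bar> + \<bar>partial 2 ?w v\<bar>)"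
      unfolding partial_diff[OF \<Omega> fs gs vin(1)]
      by (rule mult_left_mono[OF D \<open>K \<ge> 0\<close>])
    finally show "\<bar>A11 (jet f v) * partial 1 (partial 1 ?w) v + A12 (jet f v) * (partial 1 (partial 2 ?w) v + partial 2 (partial 1 ?w) v)
          + A22 (jet f v) * partial 2 (partial 2 ?w) v\<bar> \<le> K * (\<bar>?w v\<bar> + \<bar>partial 1 ?w v\<bar> + \<bar>partial 2 ?w v\<bar>)" .
  qed simp
  then show thesis using that[OF \<rho>] \<rho>in(1) by blast
qed

lemma cmc_solution_subset:
  "cmc_solution i j k c \<Omega> f \<Longrightarrow> open \<Omega>' \<Longrightarrow> \<Omega>' \<subseteq> \<Omega> \<Longrightarrow> cmc_solution i j k c \<Omega>' f"
  unfolding cmc_solution_def using smooth_on_subset by blast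

section \<open>Reflections in the planes \<open>x = T\<close>\<close>

definition flip :: "real^3 \<Rightarrow> real^3" where
  "flip v = v - (2 * v $ 1) *\<^sub>R axis 1 1"

definition mirror :: "real \<Rightarrow> real^3 \<Rightarrow> real^3" where
  "mirror T x = flip x + (2 * T) *\<^sub>R axis 1 1"

definition flip_sign :: "3 \<Rightarrow> real" where
  "flip_sign l = (if l = 1 then -1 else 1)"

lemma flip_nth: "flip v $ l = flip_sign l * v $ l"
  by (simp add: flip_def flip_sign_def axis_def)

lemma flip_sign_sq [simp]: "flip_sign l * flip_sign l = 1" "flip_sign l * (flip_sign l * z) = z"
  by (simp_all add: flip_sign_def)

lemma flip_flip [simp]: "flip (flip v) = v"
  by (simp add: vec_eq_iff flip_nth)

lemma mirror_nth: "mirror T x $ l = (if l = 1 then 2 * T - x $ 1 else x $ l)"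
  by (simp add: mirror_def flip_nth flip_sign_def axis_def)

lemma mirror_mirror [simp]: "mirror T (mirror T x) = x"
  by (simp add: vec_eq_iff mirror_nth)

lemma mirror_image_iff: "x \<in> mirror T ` M \<longleftrightarrow> mirror T x \<in> M"
  by (metis image_iff mirror_mirror)

lemma bounded_linear_flip: "bounded_linear flip"
  by (rule linear_conv_bounded_linear[THEN iffD1], rule linearI)
     (simp_all add: vec_eq_iff flip_nth algebra_simps)

lemma continuous_on_flip [continuous_intros]:
  "continuous_on S f \<Longrightarrow> continuous_on S (\<lambda>x. flip (f x))"
  by (rule bounded_linear.continuous_on[OF bounded_linear_flip])

lemma continuous_on_mirror [continuous_intros]:
  "continuous_on S f \<Longrightarrow> continuous_on S (\<lambda>x. mirror T (f x))"
  unfolding mirror_def by (intro continuous_intros)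

lemma homeomorphism_mirror: "homeomorphism A (mirror T ` A) (mirror T) (mirror T)"
  unfolding homeomorphism_def
  by (auto simp: image_image intro!: continuous_on_mirror continuous_on_id)

lemma openin_mirror:
  assumes "openin (top_of_set M) A" shows "openin (top_of_set (mirror T ` M)) (mirror T ` A)"
proof -
  obtain W where W: "open W" "A = M \<inter> W" using assms by (auto simp: openin_open)
  have "open (mirror T -` W)" using W(1) by (intro open_vimage continuous_intros)
  moreover have "mirror T ` A = mirror T ` M \<inter> mirror T -` W" unfolding W(2) by auto
  ultimately show ?thesis by (auto simp: openin_open)
qed

lemma has_derivative_mirror:
  "(X has_derivative D) F \<Longrightarrow> ((\<lambda>u. mirror T (X u)) has_derivative (\<lambda>h. flip (D h))) F"
  unfolding mirror_def
  using has_derivative_add[OF bounded_linear.has_derivative[OF bounded_linear_flip] has_derivative_const]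
  by fastforce

lemma Ck_on_mirror: "open U \<Longrightarrow> Ck_on k X U \<Longrightarrow> Ck_on k (\<lambda>u. mirror T (X u)) U"
  unfolding mirror_def by (intro Ck_on_add Ck_on_const Ck_on_bounded_linear[OF _ bounded_linear_flip])

lemma local_param_mirror:
  assumes "local_param M U X"
  shows "local_param (mirror T ` M) U (\<lambda>u. mirror T (X u))"
proof -
  have U: "open U" and X: "smooth_on U X" using assms by (auto simp: local_param_def)
  have im: "(\<lambda>u. mirror T (X u)) ` A = mirror T ` X ` A" for A by (simp add: image_image)
  obtain Y where Y: "homeomorphism (U \<inter> half_plane) (X ` (U \<inter> half_plane)) X Y"
    using assms by (auto simp: local_param_def)
  show ?thesis
    unfolding local_param_def im
  proof (intro conjI ballI exI)
    show "open U" by (rule U)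
    show "smooth_on U (\<lambda>u. mirror T (X u))" using X U by (auto simp: smooth_on_def intro: Ck_on_mirror)
    show "inj (frechet_derivative (\<lambda>u. mirror T (X u)) (at u))" if u: "u \<in> U \<inter> half_plane" for u
    proof -
      have "X differentiable (at u)" using smooth_on_differentiable[OF U X] u by blast
      then have "(X has_derivative frechet_derivative X (at u)) (at u)" by (simp add: frechet_derivative_works)
      from frechet_derivative_at[OF has_derivative_mirror[OF this, of T]]
      have e: "frechet_derivative (\<lambda>u. mirror T (X u)) (at u) = (\<lambda>h. flip (frechet_derivative X (at u) h))" by simp
      have "inj flip" by (rule inj_on_inverseI) (rule flip_flip)
      moreover have "inj (frechet_derivative X (at u))" using assms u by (simp add: local_param_def)
      ultimately show ?thesis unfolding e by (auto simp: inj_def)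
    qed
    show "openin (top_of_set (mirror T ` M)) (mirror T ` X ` (U \<inter> half_plane))"
      using assms by (intro openin_mirror) (simp add: local_param_def)
    show "homeomorphism (U \<inter> half_plane) (mirror T ` X ` (U \<inter> half_plane)) (\<lambda>u. mirror T (X u)) (Y \<circ> mirror T)"
      using homeomorphism_compose[OF Y homeomorphism_mirror, of T] by (simp add: o_def)
  qed
qed

lemma mirror_image_image [simp]: "mirror T ` mirror T ` M = M"
  by (simp add: image_image)

lemma embedded_surface_mirror:
  assumes "embedded_surface M" shows "embedded_surface (mirror T ` M)"
  unfolding embedded_surface_def
proof
  fix p assume "p \<in> mirror T ` M"
  then obtain q where q: "q \<in> M" "p = mirror T q" by blast
  then obtain U X where UX: "local_param M U X" "q \<in> X ` (U \<inter> half_plane)"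
    using assms by (auto simp: embedded_surface_def)
  then have "p \<in> (\<lambda>u. mirror T (X u)) ` (U \<inter> half_plane)" using q by auto
  then show "\<exists>U X. local_param (mirror T ` M) U X \<and> p \<in> X ` (U \<inter> half_plane)"
    using local_param_mirror[OF UX(1)] by blast
qed

lemma surface_boundary_mirror: "surface_boundary (mirror T ` M) = mirror T ` surface_boundary M"
proof -
  have *: "mirror T p \<in> surface_boundary (mirror T ` M)" if p: "p \<in> surface_boundary M" for M p
  proof -
    obtain U X u where "local_param M U X" "u \<in> U" "u $ 1 = 0" "X u = p"
      using p unfolding surface_boundary_def by blast
    then have "local_param (mirror T ` M) U (\<lambda>u. mirror T (X u)) \<and> u \<in> U \<and> u $ 1 = 0 \<and> mirror T (X u) = mirror T p"
      using local_param_mirror by blast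
    then show ?thesis unfolding surface_boundary_def by blast
  qed
  show ?thesis
  proof (intro set_eqI iffI)
    fix p assume "p \<in> surface_boundary (mirror T ` M)"
    from *[OF this] show "p \<in> mirror T ` surface_boundary M" by (simp add: mirror_image_iff)
  next
    fix p assume "p \<in> mirror T ` surface_boundary M"
    then show "p \<in> surface_boundary (mirror T ` M)" using * by auto
  qed
qed

lemma gdiag_mirror [simp]: "gdiag (mirror T x) l = gdiag x l" and gdiag_dz_mirror [simp]: "gdiag_dz (mirror T x) l = gdiag_dz x l"
  by (simp_all add: gdiag_def gdiag_dz_def mirror_nth)

lemma christoffel_mirror: "christoffel (mirror T x) k i j = christoffel x k i j"
  by (simp add: christoffel_eq)

text \<open>A nonzero Christoffel symbol contains the index 1 an even number of times; this is the infinitesimal form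
  of the invariance under \<open>x \<mapsto> -x\<close>.\<close>

lemma christoffel_parity: "christoffel x k i j * (flip_sign i * flip_sign j) = flip_sign k * christoffel x k i j"
proof (cases "christoffel x k i j = 0")
  case False
  then have "i = 3 \<and> j = k \<or> j = 3 \<and> i = k \<or> k = 3 \<and> i = j"
    unfolding christoffel_eq by (auto split: if_splits)
  then show ?thesis by (auto simp: flip_sign_def)
qed simp

lemma sol_inner_mirror: "sol_inner (mirror T x) (flip v) (flip w) = sol_inner x v w"
proof -
  have "gdiag x l * (flip_sign l * v $ l) * (flip_sign l * w $ l) = gdiag x l * v $ l * w $ l" for l by (simp add: flip_sign_def)
  then show ?thesis unfolding sol_inner_eq flip_nth by (intro sum.cong) simp_all
qed

lemma partial_mirror:
  assumes "X differentiable (at u)"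
  shows "partial a (\<lambda>u. mirror T (X u)) u = flip (partial a X u)"
  unfolding partial_def[of a X]
  by (rule partial_eqI[OF has_derivative_mirror]) (use assms frechet_derivative_works in blast)

lemma mean_curvature_mirror:
  assumes U: "open U" and X: "smooth_on U X" and u: "u \<in> U"
  shows "mean_curvature (\<lambda>u. mirror T (X u)) (flip n) u = mean_curvature X n u"
proof -
  let ?Z = "\<lambda>u. mirror T (X u)"
  have pZ: "partial a ?Z w = flip (partial a X w)" if "w \<in> U" for a w
    by (rule partial_mirror[OF smooth_on_differentiable[OF U X that]])
  have ppZ: "partial a (partial b ?Z) u = flip (partial a (partial b X) u)" for a b
  proof -
    have "partial b X differentiable (at u)" by (rule smooth_on_differentiable[OF U smooth_on_partial[OF X] u])
    then have "((\<lambda>w. flip (partial b X w)) has_derivative (\<lambda>h. flip (frechet_derivative (partial b X) (at u) h))) (at u)"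
      by (intro bounded_linear.has_derivative[OF bounded_linear_flip]) (simp add: frechet_derivative_works)
    then have "(partial b ?Z has_derivative (\<lambda>h. flip (frechet_derivative (partial b X) (at u) h))) (at u)"
      by (rule has_derivative_transform_within_open[OF _ U u]) (simp add: pZ)
    from partial_eqI[OF this] show ?thesis by (simp add: partial_def)
  qed
  have cov: "cov_deriv ?Z a b u = flip (cov_deriv X a b u)" for a b
  proof (rule vec_eq_iff[THEN iffD2], rule allI)
    fix k
    have "(\<Sum>i\<in>UNIV. \<Sum>j\<in>UNIV. christoffel (X u) k i j * (flip_sign i * partial a X u $ i) * (flip_sign j * partial b X u $ j))
       = (\<Sum>i\<in>UNIV. \<Sum>j\<in>UNIV. flip_sign k * (christoffel (X u) k i j * partial a X u $ i * partial b X u $ j))"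
    proof (intro sum.cong refl)
      fix i j
      have "christoffel (X u) k i j * (flip_sign i * partial a X u $ i) * (flip_sign j * partial b X u $ j)
         = (christoffel (X u) k i j * (flip_sign i * flip_sign j)) * (partial a X u $ i * partial b X u $ j)" by (simp only: mult_ac)
      also have "\<dots> = flip_sign k * (christoffel (X u) k i j * partial a X u $ i * partial b X u $ j)"
        unfolding christoffel_parity by (simp only: mult_ac)
      finally show "christoffel (X u) k i j * (flip_sign i * partial a X u $ i) * (flip_sign j * partial b X u $ j)
         = flip_sign k * (christoffel (X u) k i j * partial a X u $ i * partial b X u $ j)" .
    qed
    then show "cov_deriv ?Z a b u $ k = flip (cov_deriv X a b u) $ k"
      by (simp add: cov_deriv_def pZ[OF u] ppZ christoffel_mirror flip_nth distrib_left sum_distrib_left)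
  qed
  show ?thesis
    by (simp add: mean_curvature_def first_fundamental_form_def second_fundamental_form_def
        pZ[OF u] cov sol_inner_mirror)
qed

definition mirror_field :: "real \<Rightarrow> (real^3 \<Rightarrow> real^3) \<Rightarrow> real^3 \<Rightarrow> real^3" where
  "mirror_field T N x = flip (N (mirror T x))"

lemma cmc_normal_mirror:
  assumes N: "cmc_normal M N H"
  shows "cmc_normal (mirror T ` M) (mirror_field T N) H"
proof -
  have nf: "continuous_on M N" "\<And>p. p \<in> M \<Longrightarrow> sol_inner p (N p) (N p) = 1"
    "\<And>U X u a. local_param M U X \<Longrightarrow> u \<in> U \<inter> half_plane \<Longrightarrow> sol_inner (X u) (partial a X u) (N (X u)) = 0"
    and mc: "\<And>U X u. local_param M U X \<Longrightarrow> u \<in> U \<inter> half_plane \<Longrightarrow> mean_curvature X (N (X u)) u = H"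
    using N unfolding cmc_normal_def unit_normal_field_def by blast+
  have *: "sol_inner (X u) (partial a X u) (mirror_field T N (X u)) = 0 \<and> mean_curvature X (mirror_field T N (X u)) u = H"
    if X: "local_param (mirror T ` M) U X" and u: "u \<in> U \<inter> half_plane" for U X u a
  proof -
    define Z where "Z = (\<lambda>u. mirror T (X u))"
    have Z: "local_param M U Z" using local_param_mirror[OF X, of T] by (simp add: Z_def)
    have XZ: "X = (\<lambda>u. mirror T (Z u))" by (simp add: Z_def)
    have U: "open U" "smooth_on U Z" "u \<in> U" using Z u by (auto simp: local_param_def)
    have n: "mirror_field T N (X u) = flip (N (Z u))" by (simp add: mirror_field_def Z_def)
    have pa: "partial a X u = flip (partial a Z u)"
      unfolding XZ by (rule partial_mirror[OF smooth_on_differentiable[OF U]])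
    have "sol_inner (X u) (partial a X u) (mirror_field T N (X u)) = sol_inner (Z u) (partial a Z u) (N (Z u))"
      unfolding n pa by (simp add: XZ sol_inner_mirror)
    moreover have "mean_curvature X (mirror_field T N (X u)) u = mean_curvature Z (N (Z u)) u"
      unfolding n using mean_curvature_mirror[OF U, of T "N (Z u)"] by (simp add: XZ)
    ultimately show ?thesis using nf(3)[OF Z u] mc[OF Z u] by simp
  qed
  have "continuous_on (mirror T ` M) (mirror_field T N)"
    unfolding mirror_field_def
    by (intro continuous_on_flip continuous_on_compose2[OF nf(1)] continuous_on_mirror continuous_on_id) auto
  moreover have "sol_inner p (mirror_field T N p) (mirror_field T N p) = 1" if "p \<in> mirror T ` M" for p
    using nf(2)[of "mirror T p"] that sol_inner_mirror[of T "mirror T p"] by (simp add: mirror_field_def mirror_image_iff)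
  ultimately show ?thesis unfolding cmc_normal_def unit_normal_field_def using * by blast
qed

section \<open>Contact of a surface with its reflection\<close>

lemma connected_positive:
  fixes \<phi> :: "'a::topological_space \<Rightarrow> real"
  assumes "connected B" "continuous_on B \<phi>" "\<And>v. v \<in> B \<Longrightarrow> \<phi> v \<noteq> 0" "a \<in> B" "\<phi> a > 0" "b \<in> B"
  shows "\<phi> b > 0"
proof (rule ccontr)
  assume "\<not> \<phi> b > 0"
  then have "0 \<in> \<phi> ` B"
    using connectedD_interval[OF connected_continuous_image[OF assms(2,1)], of "\<phi> b" "\<phi> a" 0] assms by auto
  then show False using assms(3) by force
qed

text \<open>The \<open>k\<close>-component of the normal does not vanish along a graph in direction \<open>k\<close>, so it keeps its sign.\<close>

lemma local_graph_sign:
  assumes N: "cmc_normal M N H" and fr: "frame3 i j k" and lg: "local_graph M i j k p r e f" and p: "p \<in> M"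
    and s: "s\<^sup>2 = 1" "s * N p $ k > 0" and v: "v \<in> ball (pr i j p) r"
  shows "s * N (gpt i j k v (f v)) $ k > 0"
proof (rule connected_positive[of "ball (pr i j p) r" "\<lambda>v. s * N (gpt i j k v (f v)) $ k" "pr i j p"])
  let ?B = "ball (pr i j p) r"
  have "continuous_on ?B (\<lambda>v. N (gpt i j k v (f v)))"
    by (rule continuous_on_compose2[of M N])
       (use N local_graph_mem[OF fr lg] in \<open>auto simp: cmc_normal_def unit_normal_field_def
          intro!: continuous_on_gpt continuous_on_id smooth_on_continuous[OF local_graphD(3)[OF lg]]\<close>)
  then show "continuous_on ?B (\<lambda>v. s * N (gpt i j k v (f v)) $ k)" by (intro continuous_intros)
  show "s * N (gpt i j k v (f v)) $ k \<noteq> 0" if "v \<in> ?B" for v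
    using local_graph_normal(2)[OF N fr lg that] s(1) by auto
  show "0 < s * N (gpt i j k (pr i j p) (f (pr i j p))) $ k"
    using s local_graph_center[OF lg p] gpt_pr[OF fr, of p] by simp
qed (use v local_graphD(1)[OF lg] in auto)

lemma frame3_231: "frame3 2 3 1" by (simp add: frame3_def)

lemma local_graph_mirror_231:
  assumes lg: "local_graph M 2 3 1 p r e f"
  shows "local_graph (mirror T ` M) 2 3 1 (mirror T p) r e (\<lambda>v. 2 * T - f v)"
proof -
  have pr: "pr 2 3 (mirror T x) = pr 2 3 x" for x by (simp add: vec_eq_iff forall_2 mirror_nth)
  note d = local_graphD[OF lg]
  have "smooth_on (ball (pr 2 3 p) r) (\<lambda>v. 2 * T - f v)"
    using smooth_on_diff[OF open_ball d(3), of "\<lambda>_. 2 * T"] by (simp add: smooth_on_def Ck_on_const)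
  moreover have "\<bar>2 * T - f v - mirror T p $ 1\<bar> < e" if "v \<in> ball (pr 2 3 p) r" for v
    using d(4)[OF that] by (simp add: mirror_nth)
  moreover have "x \<in> mirror T ` M \<longleftrightarrow> x $ 1 = 2 * T - f (pr 2 3 x)"
    if "pr 2 3 x \<in> ball (pr 2 3 p) r" "\<bar>x $ 1 - mirror T p $ 1\<bar> < e" for x
    using d(5)[of "mirror T x"] that by (auto simp: mirror_image_iff pr mirror_nth)
  ultimately show ?thesis
    unfolding local_graph_def pr using d(1,2) by blast
qed

text \<open>The graph \<open>2 T - f\<close> is the mirror image of the upper sheet. It lies above \<open>g\<close>, touches it over \<open>pr 2 3 p\<close>, and
  has there the same gradient. The hypothesis \<open>opp\<close> on the normals makes both functions solve the same equation,
  so they coincide near the contact point.\<close>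

lemma contact_interior:
  assumes N: "cmc_normal M N H" 
    and p: "p \<in> M" "local_graph M 2 3 1 p r e f" and q: "q \<in> M" "local_graph M 2 3 1 q r' e' g"
    and pq: "pr 2 3 p = pr 2 3 q" "p $ 1 + q $ 1 = 2 * T" and opp: "N p $ 1 * N q $ 1 < 0"
    and \<delta>: "\<delta> > 0" and le: "\<And>v. v \<in> ball (pr 2 3 p) \<delta> \<Longrightarrow> f v + g v \<le> 2 * T"
  shows "\<exists>\<delta>>0. \<forall>v\<in>ball (pr 2 3 p) \<delta>. f v + g v = 2 * T"
proof -
  let ?y = "pr 2 3 p"
  define s where "s = sgn (N q $ 1)"
  have s: "s\<^sup>2 = 1" "s * N q $ 1 > 0" "- s * N p $ 1 > 0"
    using opp by (auto simp: s_def sgn_if power2_eq_square mult_less_0_iff split: if_splits)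
  define h where "h = (\<lambda>v. 2 * T - f v)"
  have lgh: "local_graph (mirror T ` M) 2 3 1 (mirror T p) r e h" unfolding h_def by (rule local_graph_mirror_231[OF p(2)])
  have prp: "pr 2 3 (mirror T p) = ?y" by (simp add: vec_eq_iff forall_2 mirror_nth)
  have "cmc_solution 2 3 1 (2 * H * s) (ball (pr 2 3 (mirror T p)) r) h"
  proof (rule local_graph_cmc_solution[OF cmc_normal_mirror[OF N] frame3_231 lgh s(1)])
    fix v assume v: "v \<in> ball (pr 2 3 (mirror T p)) r"
    show "0 < s * mirror_field T N (gpt 2 3 1 v (h v)) $ 1"
    proof (rule local_graph_sign[OF cmc_normal_mirror[OF N] frame3_231 lgh _ s(1) _ v])
      show "mirror T p \<in> mirror T ` M" using p(1) by blast
      show "0 < s * mirror_field T N (mirror T p) $ 1" using s(3) by (simp add: mirror_field_def flip_nth flip_sign_def)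
    qed
  qed
  then have solh: "cmc_solution 2 3 1 (2 * H * s) (ball ?y r) h" by (simp add: prp)
  have "cmc_solution 2 3 1 (2 * H * s) (ball (pr 2 3 q) r') g"
    by (rule local_graph_cmc_solution[OF N frame3_231 q(2) s(1)])
       (rule local_graph_sign[OF N frame3_231 q(2,1) s(1,2)])
  then have solg: "cmc_solution 2 3 1 (2 * H * s) (ball ?y r') g" by (simp add: pq)
  define R where "R = min (min r r') \<delta>"
  have R: "R > 0" using local_graphD(1)[OF p(2)] local_graphD(1)[OF q(2)] \<delta> by (simp add: R_def)
  have solh: "cmc_solution 2 3 1 (2 * H * s) (ball ?y R) h"
    by (rule cmc_solution_subset[OF solh]) (auto simp: R_def)
  have solg: "cmc_solution 2 3 1 (2 * H * s) (ball ?y R) g"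
    by (rule cmc_solution_subset[OF solg]) (auto simp: R_def)
  have nn: "h v - g v \<ge> 0" if "v \<in> ball ?y R" for v using le[of v] that by (simp add: R_def h_def)
  have z: "h ?y - g ?y = 0"
    using local_graph_center[OF p(2,1)] local_graph_center[OF q(2,1)] pq by (simp add: h_def)
  have sm: "smooth_on (ball ?y R) h" "smooth_on (ball ?y R) g" using solh solg by (auto simp: cmc_solution_def)
  have smd: "smooth_on (ball ?y R) (\<lambda>v. h v - g v)" by (rule smooth_on_diff[OF open_ball sm(2,1)])
  have yR: "?y \<in> ball ?y R" using R by simp
  note sp = smooth_partials[OF open_ball smd]
  note min = second_order_min(1,2)[OF R sp(1) sp(2)[OF yR] sp(2)[OF yR]]
  have "partial 1 (\<lambda>v. h v - g v) ?y = 0" "partial 2 (\<lambda>v. h v - g v) ?y = 0"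
    using min nn z by simp_all
  then have pe: "partial 1 g ?y = partial 1 h ?y" "partial 2 g ?y = partial 2 h ?y"
    unfolding partial_diff[OF open_ball sm(2,1) yR] by simp_all
  obtain \<rho> where \<rho>: "\<rho> > 0" "ball ?y \<rho> \<subseteq> ball ?y R" "elliptic_ineq (ball ?y \<rho>) (\<lambda>v. h v - g v)"
    using elliptic_difference[OF frame3_231 solg solh yR _ pe] z by auto
  have nn\<rho>: "h v - g v \<ge> 0" if "v \<in> ball ?y \<rho>" for v using nn that \<rho>(2) by blast
  have "?y \<in> ball ?y \<rho>" using \<rho>(1) by simp
  note smp = strong_maximum_principle[OF \<rho>(3) connected_ball nn\<rho> this z]
  have "h v - g v = 0" if "v \<in> ball ?y \<rho>" for v by (rule smp[OF _ that])
  then have "f v + g v = 2 * T" if "v \<in> ball ?y \<rho>" for v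
    using that unfolding h_def by (simp add: algebra_simps del: mem_ball)
  then show ?thesis using \<rho>(1) by blast
qed

definition mirror2 :: "real \<Rightarrow> real^2 \<Rightarrow> real^2" where
  "mirror2 T v = vector [2 * T - v $ 1, v $ 2]"

lemma mirror2_nth [simp]: "mirror2 T v $ 1 = 2 * T - v $ 1" "mirror2 T v $ 2 = v $ 2"
  by (simp_all add: mirror2_def)

lemma dist_mirror2: "dist (mirror2 T v) (mirror2 T w) = dist v w"
  by (simp add: dist_norm norm_vec_def L2_set_def sum_2 power2_commute)

lemma mirror2_mirror2 [simp]: "mirror2 T (mirror2 T v) = v"
  by (simp add: vec_eq_iff forall_2)

lemma has_derivative_mirror2: "(mirror2 T has_derivative (\<lambda>h. vector [- h $ 1, h $ 2])) (at v)"
proof -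
  have e: "mirror2 T = (\<lambda>v. (2 * T - v $ 1) *\<^sub>R axis 1 1 + (v $ 2) *\<^sub>R axis 2 1)"
    by (simp add: fun_eq_iff vec_eq_iff forall_2 axis_def)
  have dn: "((\<lambda>x::real^2. x $ a) has_derivative (\<lambda>h. h $ a)) (at x)" for a x
    by (rule bounded_linear_imp_has_derivative[OF bounded_linear_vec_nth])
  show ?thesis
    unfolding e
    by (rule derivative_eq_intros dn refl)+ (simp add: fun_eq_iff vec_eq_iff forall_2 axis_def)
qed

lemma Ck_on_mirror2: "open S \<Longrightarrow> Ck_on k (mirror2 T) S"
proof -
  assume S: "open S"
  have "Ck_on k (\<lambda>v. mirror2 T v $ a) S" for a
  proof (cases "a = 1")
    case True
    have "Ck_on k (\<lambda>v::real^2. 2 * T + (-1) * v $ 1) S"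
      by (intro Ck_on_add Ck_on_mult Ck_on_const S Ck_on_bounded_linear[OF S bounded_linear_vec_nth Ck_on_ident])
    then show ?thesis using True by simp
  next
    case False
    then have "a = 2" using exhaust_2 by blast
    then show ?thesis using Ck_on_bounded_linear[OF S bounded_linear_vec_nth Ck_on_ident[OF S], of k 2] by simp
  qed
  then show ?thesis by (simp add: Ck_on_vec_iff[OF S])
qed

text \<open>Here the surface is a graph in a direction parallel to the mirror, with \<open>x\<close> as first coordinate, and is
  compared with its own mirror image. Both agree on the mirror; the gradients agree at \<open>p\<close> because the tangent
  plane contains the \<open>x\<close>-direction. The sign \<open>\<sigma>\<close> covers both possible orders of the two functions.\<close>

lemma contact_vertical:
  assumes N: "cmc_normal M N H" and fr: "frame3 1 j k"
    and p: "p \<in> M" "local_graph M 1 j k p r e f" "p $ 1 = T" "N p $ 1 = 0"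
    and \<sigma>: "\<sigma>\<^sup>2 = 1" and \<delta>: "\<delta> > 0"
    and le: "\<And>v. v \<in> ball (pr 1 j p) \<delta> \<Longrightarrow> v $ 1 > T \<Longrightarrow> \<sigma> * f v \<le> \<sigma> * f (mirror2 T v)"
  shows "\<exists>\<delta>>0. \<forall>v\<in>ball (pr 1 j p) \<delta>. f v = f (mirror2 T v)"
proof -
  let ?y = "pr 1 j p"
  have jk: "j \<noteq> 1" "k \<noteq> 1" using fr by (auto simp: frame3_def)
  have y1: "?y $ 1 = T" using p(3) by simp
  have ry: "mirror2 T ?y = ?y" using y1 by (simp add: vec_eq_iff forall_2)
  note d = local_graphD[OF p(2)]
  have inb: "mirror2 T v \<in> ball ?y \<rho> \<longleftrightarrow> v \<in> ball ?y \<rho>" for v \<rho>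
    using dist_mirror2[of T ?y v] by (simp add: ry)
  define g where "g = (\<lambda>v. f (mirror2 T v))"
  have gs: "smooth_on (ball ?y r) g"
    using d(3) inb unfolding g_def smooth_on_def
    by (intro allI Ck_on_compose[OF open_ball open_ball _ Ck_on_mirror2]) auto
  have prr: "pr 1 j (mirror T x) = mirror2 T (pr 1 j x)" for x
    using jk by (simp add: vec_eq_iff forall_2 mirror_nth)
  have rp: "mirror T p = p" using p(3) by (simp add: vec_eq_iff mirror_nth)
  have lgg: "local_graph (mirror T ` M) 1 j k p r e g"
    unfolding local_graph_def
  proof (intro conjI ballI allI impI)
    show "\<bar>g v - p $ k\<bar> < e" if "v \<in> ball ?y r" for v using d(4)[of "mirror2 T v"] inb that by (simp add: g_def)
    show "x \<in> mirror T ` M \<longleftrightarrow> x $ k = g (pr 1 j x)" if "pr 1 j x \<in> ball ?y r \<and> \<bar>x $ k - p $ k\<bar> < e" for x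
      using d(5)[of "mirror T x"] that inb jk by (simp add: mirror_image_iff prr mirror_nth g_def)
  qed (use d gs in auto)
  have yr: "?y \<in> ball ?y r" using d(1) by simp
  have gp: "gpt 1 j k ?y (f ?y) = p" using local_graph_center[OF p(2,1)] gpt_pr[OF fr, of p] by simp
  have Nk: "N p $ k \<noteq> 0" using local_graph_normal(2)[OF N fr p(2) yr] by (simp add: gp)
  have "gdiag p 1 * N p $ 1 = gdiag p k * N p $ k * cvec 1 j k (partial 1 f ?y) (partial 2 f ?y) $ 1"
    using local_graph_normal(1)[OF N fr p(2) yr, of 1] by (simp add: gp)
  then have p1: "partial 1 f ?y = 0"
    using p(4) Nk gdiag_pos[of p k] by (simp add: cvec_nth[OF fr])
  define s where "s = sgn (N p $ k)"
  have s: "s\<^sup>2 = 1" "s * N p $ k > 0" using Nk by (auto simp: s_def sgn_if power2_eq_square)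
  have s': "s * mirror_field T N p $ k > 0" using s jk by (simp add: mirror_field_def rp flip_nth flip_sign_def)
  have solf: "cmc_solution 1 j k (2 * H * s) (ball ?y r) f"
    by (rule local_graph_cmc_solution[OF N fr p(2) s(1)]) (rule local_graph_sign[OF N fr p(2,1) s])
  have pr': "p \<in> mirror T ` M" using p(1) rp by (simp add: mirror_image_iff)
  have solg: "cmc_solution 1 j k (2 * H * s) (ball ?y r) g"
    by (rule local_graph_cmc_solution[OF cmc_normal_mirror[OF N] fr lgg s(1)])
       (rule local_graph_sign[OF cmc_normal_mirror[OF N] fr lgg pr' s(1) s'])
  have "(f has_derivative (\<lambda>h. partial 1 f ?y * h $ 1 + partial 2 f ?y * h $ 2)) (at (mirror2 T ?y))"
    unfolding ry by (rule smooth_partials(1)[OF open_ball d(3) yr])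
  from has_derivative_compose[OF has_derivative_mirror2 this]
  have dg: "(g has_derivative (\<lambda>h. partial 2 f ?y * h $ 2)) (at ?y)" by (simp add: g_def p1)
  have pg: "partial 1 g ?y = 0" "partial 2 g ?y = partial 2 f ?y"
    using partial_eqI[OF dg, of 1] partial_eqI[OF dg, of 2] by (simp_all add: axis_def)
  have fg: "f ?y = g ?y" by (simp add: g_def ry)
  have key: "\<exists>\<rho>>0. \<forall>v\<in>ball ?y \<rho>. v $ 1 > T \<longrightarrow> u v = w v"
    if sol: "cmc_solution 1 j k (2 * H * s) (ball ?y r) u" "cmc_solution 1 j k (2 * H * s) (ball ?y r) w"
      and e: "u ?y = w ?y" "partial 1 u ?y = partial 1 w ?y" "partial 2 u ?y = partial 2 w ?y"
      and le': "\<And>v. v \<in> ball ?y \<delta> \<Longrightarrow> v $ 1 > T \<Longrightarrow> u v \<le> w v" for u w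
  proof -
    obtain \<rho>0 where \<rho>0: "\<rho>0 > 0" "ball ?y \<rho>0 \<subseteq> ball ?y r" "elliptic_ineq (ball ?y \<rho>0) (\<lambda>v. w v - u v)"
      using elliptic_difference[OF fr sol yr e] by blast
    define \<rho> where "\<rho> = min \<rho>0 \<delta>"
    have \<rho>: "\<rho> > 0" using \<rho>0(1) \<delta> by (simp add: \<rho>_def)
    have el: "elliptic_ineq (ball ?y \<rho>) (\<lambda>v. w v - u v)"
      by (rule elliptic_ineq_subset[OF \<rho>0(3)]) (auto simp: \<rho>_def)
    have sm: "smooth_on (ball ?y r) u" "smooth_on (ball ?y r) w" using sol by (auto simp: cmc_solution_def)
    have "w v - u v = 0" if "v \<in> ball ?y \<rho>" "v $ 1 > T" for v
    proof (rule boundary_point_principle[OF el \<rho>])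
      show "0 \<le> w v - u v" if "v \<in> ball ?y \<rho>" "?y $ 1 < v $ 1" for v
        using le'[of v] that y1 by (simp add: \<rho>_def)
      show "w ?y - u ?y = 0" using e by simp
      show "partial 1 (\<lambda>v. w v - u v) ?y = 0" "partial 2 (\<lambda>v. w v - u v) ?y = 0"
        unfolding partial_diff[OF open_ball sm yr] using e by simp_all
    qed (use that y1 in simp_all)
    then show ?thesis using \<rho> by (intro exI[of _ \<rho>]) auto
  qed
  have "\<exists>\<rho>>0. \<forall>v\<in>ball ?y \<rho>. v $ 1 > T \<longrightarrow> f v = g v"
  proof (cases "\<sigma> = 1")
    case True
    then show ?thesis using key[OF solf solg fg] pg p1 le by (simp add: g_def)
  next
    case False
    then have "\<sigma> = -1" using \<sigma> by (simp add: power2_eq_1_iff)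
    then have "\<exists>\<rho>>0. \<forall>v\<in>ball ?y \<rho>. v $ 1 > T \<longrightarrow> g v = f v" using key[OF solg solf fg[symmetric]] pg p1 le by (simp add: g_def)
    then show ?thesis by (simp add: eq_commute)
  qed
  then obtain \<rho> where \<rho>: "\<rho> > 0" "\<And>v. v \<in> ball ?y \<rho> \<Longrightarrow> v $ 1 > T \<Longrightarrow> f v = g v" by blast
  have "f v = f (mirror2 T v)" if v: "v \<in> ball ?y \<rho>" for v
  proof (cases "v $ 1" T rule: linorder_cases)
    case less
    then have "f (mirror2 T v) = g (mirror2 T v)" using inb v by (intro \<rho>(2)) auto
    then show ?thesis by (simp add: g_def)
  next
    case equal
    then have "mirror2 T v = v" by (simp add: vec_eq_iff forall_2)
    then show ?thesis by simp
  next
    case greater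
    then show ?thesis using \<rho>(2)[OF v] by (simp add: g_def)
  qed
  then show ?thesis using \<rho>(1) by blast
qed

section \<open>Topology of the configuration\<close>

text \<open>The point over \<open>q\<close> of the plane at height \<open>s\<close>, that is, \<open>killing_flow s (P_point q)\<close>.\<close>

abbreviation pt :: "real^2 \<Rightarrow> real \<Rightarrow> real^3" where
  "pt q s \<equiv> gpt 2 3 1 q s"

lemma P_point_eq: "P_point q = pt q 0"
  by (rule frame3_eqI[OF frame3_231]) (simp_all add: P_point_def frame3_231)

lemma killing_flow_P_point: "killing_flow s (P_point q) = pt q s"
  by (simp add: killing_flow_def P_point_eq gpt_def)

lemma pt_nth [simp]: "pt q s $ 1 = s" "pt q s $ 2 = q $ 1" "pt q s $ 3 = q $ 2"
  using gpt_nth[OF frame3_231] by auto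

lemma pr_pt [simp]: "pr 2 3 (pt q s) = q"
  by (rule pr_gpt[OF frame3_231])

lemma pt_pr: "pt (pr 2 3 x) (x $ 1) = x"
  by (rule gpt_pr[OF frame3_231])

lemma pt_eqI: "pr 2 3 x = pr 2 3 y \<Longrightarrow> x $ 1 = y $ 1 \<Longrightarrow> x = y"
  by (metis pt_pr)

lemma dist_pt: "dist (pt q s) (pt q' s') \<le> dist q q' + \<bar>s - s'\<bar>"
proof -
  have "pt q s - pt q' s' = pt (q - q') 0 + (s - s') *\<^sub>R axis 1 1"
    by (simp add: gpt_def algebra_simps)
  then have "dist (pt q s) (pt q' s') \<le> norm (pt (q - q') 0) + norm ((s - s') *\<^sub>R axis 1 1 :: real^3)"
    by (metis dist_norm norm_triangle_ineq)
  also have "norm (pt (q - q') 0) = dist q q'"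
    by (simp add: dist_norm norm_vec_def L2_set_def sum_2 sum_3)
  finally show ?thesis by simp
qed

text \<open>The hypotheses of the theorem after normalization to \<open>x \<ge> 0\<close>, with a choice of the normal \<open>N\<close>, the mean
  curvature \<open>H\<close>, and a graph \<open>V\<close> of \<open>u\<close> over \<open>A\<close> that is a neighbourhood of \<open>\<Gamma>\<close> in \<open>M\<close>.\<close>

locale surface_over_domain =
  fixes M \<Gamma> :: "(real^3) set" and D :: "(real^2) set" and N :: "real^3 \<Rightarrow> real^3" and H :: real
    and V :: "(real^3) set" and A :: "(real^2) set" and u :: "real^2 \<Rightarrow> real"
  assumes compact: "compact M" and connected: "connected M" and embedded: "embedded_surface M"
    and cmc: "cmc_normal M N H"
    and \<Gamma>: "\<Gamma> = surface_boundary M" and curve: "closed_curve \<Gamma>" and plane: "\<Gamma> \<subseteq> plane_P"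
    and D: "D = bounded_domain \<Gamma>"
    and side: "M \<subseteq> {p. p $ 1 \<ge> 0}" "M - \<Gamma> \<subseteq> {p. p $ 1 > 0}"
    and V: "openin (top_of_set M) V" "\<Gamma> \<subseteq> V"
    and A: "openin (top_of_set (closure D)) A" "P_point -` \<Gamma> \<subseteq> A"
    and Vu: "V = (\<lambda>q. pt q (u q)) ` A"
begin

definition C :: "(real^2) set" where "C = P_point -` \<Gamma>"
definition Ext :: "(real^2) set" where "Ext = outside C"
definition S :: "(real^3) set" where "S = M - \<Gamma>"

lemma boundary_subset: "\<Gamma> \<subseteq> M"
  using V openin_subset by fastforce

lemma \<Gamma>_iff: "x \<in> \<Gamma> \<longleftrightarrow> x \<in> M \<and> x $ 1 = 0"
  using boundary_subset plane side by (force simp: plane_P_def)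

lemma M_nonneg: "x \<in> M \<Longrightarrow> x $ 1 \<ge> 0" using side by auto

lemma S_iff: "x \<in> S \<longleftrightarrow> x \<in> M \<and> x $ 1 > 0"
  using M_nonneg \<Gamma>_iff by (auto simp: S_def) (metis less_eq_real_def)

lemma C_iff: "q \<in> C \<longleftrightarrow> pt q 0 \<in> M"
  by (simp add: C_def P_point_eq \<Gamma>_iff)

lemma \<Gamma>_pt: "x \<in> \<Gamma> \<Longrightarrow> pr 2 3 x \<in> C \<and> x = pt (pr 2 3 x) 0"
  using pt_pr[of x] by (simp add: \<Gamma>_iff C_iff)

lemma C_homeomorphic: "C homeomorphic sphere (0::real^2) 1"
proof -
  obtain c where c: "simple_path c" "pathfinish c = pathstart c" "path_image c = \<Gamma>"
    using curve by (auto simp: closed_curve_def)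
  have \<Gamma>c: "\<Gamma> homeomorphic sphere (0::complex) 1"
    using homeomorphic_simple_path_image_circle[OF c(1,2), of 1 0] c(3) by simp
  have cr: "sphere (0::complex) 1 homeomorphic sphere (0::real^2) 1"
    by (rule homeomorphic_spheres_gen) auto
  have "homeomorphism C \<Gamma> (\<lambda>q. pt q 0) (pr 2 3)"
    unfolding homeomorphism_def
  proof (intro conjI ballI)
    show im: "(\<lambda>q. pt q 0) ` C = \<Gamma>"
    proof
      show "(\<lambda>q. pt q 0) ` C \<subseteq> \<Gamma>" by (auto simp: \<Gamma>_iff C_iff)
      show "\<Gamma> \<subseteq> (\<lambda>q. pt q 0) ` C" using \<Gamma>_pt by blast
    qed
    have "pr 2 3 ` ((\<lambda>q. pt q 0) ` C) = C" by (simp add: image_image)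
    then show "pr 2 3 ` \<Gamma> = C" by (simp only: im)
    show "pt (pr 2 3 x) 0 = x" if "x \<in> \<Gamma>" for x using \<Gamma>_pt[OF that] by simp
  qed (auto intro!: continuous_on_gpt continuous_on_pr continuous_on_id continuous_on_const)
  then have "C homeomorphic \<Gamma>" unfolding homeomorphic_def by blast
  from homeomorphic_trans[OF homeomorphic_trans[OF this \<Gamma>c] cr] show ?thesis .
qed

lemma compact_C: "compact C"
  using C_homeomorphic homeomorphic_compactness compact_sphere by blast

lemma D_inside: "D = inside C"
  by (simp add: D bounded_domain_def C_def)

lemma domains: "D \<union> Ext = - C" "D \<inter> Ext = {}" "open D" "open Ext" "bounded D" "connected Ext"
  using compact_C inside_Un_outside[of C] inside_Int_outside[of C] open_inside[of C] open_outside[of C]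
    bounded_inside[of C] connected_outside[of C]
  by (auto simp: D_inside Ext_def compact_imp_bounded compact_imp_closed)

lemma frontier_component: "K \<in> components (- C) \<Longrightarrow> frontier K = C"
  using Jordan_Brouwer_frontier[OF C_homeomorphic] by simp

lemma bounded_compl_Ext: "bounded (- Ext)"
  using cobounded_outside[OF compact_imp_bounded[OF compact_C]] by (simp add: Ext_def)

lemma Ext_nonempty: "Ext \<noteq> {}"
  using bounded_compl_Ext by auto

lemma C_subset_closure_Ext: "C \<subseteq> closure Ext"
proof -
  have "Ext \<in> components (- C)"
    using outside_in_components[of C] domains(6) Ext_nonempty by (simp add: Ext_def)
  then have "frontier Ext = C" by (rule frontier_component)
  then show ?thesis by (auto simp: frontier_def)
qed

lemma component_inside:
  assumes "y \<in> D"
  obtains K where "K \<in> components (- C)" "K \<subseteq> D" "y \<in> K"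
proof -
  let ?K = "connected_component_set (- C) y"
  have "y \<in> - C" using assms domains(1) by blast
  then have "?K \<in> components (- C)" "y \<in> ?K" by (auto simp: components_def)
  moreover have "?K \<subseteq> D" 
    using assms unfolding D_inside using inside_same_component by (metis mem_Collect_eq subsetI)
  ultimately show thesis using that by blast
qed

lemma C_nonempty: "C \<noteq> {}"
  using C_homeomorphic homeomorphic_empty by fastforce

lemma D_nonempty: "D \<noteq> {}"
proof
  assume "D = {}"
  then have "- C = Ext" using domains(1) by blast
  then show False using Jordan_Brouwer_separation[OF C_homeomorphic] domains(6) by simp
qed

lemma closure_D: "closure D = D \<union> C"
proof
  show "closure D \<subseteq> D \<union> C"
    using closure_inside_subset[OF compact_imp_closed[OF compact_C]] by (auto simp: D_inside)
  obtain y where "y \<in> D" using D_nonempty by blast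
  then obtain K where "K \<in> components (- C)" "K \<subseteq> D" using component_inside by blast
  then have "C \<subseteq> closure D" using frontier_component closure_mono[of K D] by (auto simp: frontier_def)
  then show "D \<union> C \<subseteq> closure D" using closure_subset by blast
qed

lemma Ext_iff: "q \<in> Ext \<longleftrightarrow> q \<notin> closure D"
  using domains(1,2) closure_D by blast

lemma interior_closure_D: "interior (closure D) = D"
proof
  show "D \<subseteq> interior (closure D)" by (rule interior_maximal[OF closure_subset domains(3)])
  show "interior (closure D) \<subseteq> D"
  proof
    fix q assume q: "q \<in> interior (closure D)"
    then have "q \<notin> C"
      using C_subset_closure_Ext Ext_iff open_Int_closure_eq_empty[OF open_interior, of "closure D" Ext]
        interior_subset by blast
    then show "q \<in> D" using q interior_subset closure_D by blast
  qed
qed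

lemma A_subset: "A \<subseteq> closure D" "C \<subseteq> A"
  using A openin_subset by (fastforce simp: C_def)+

lemma V_iff: "x \<in> V \<longleftrightarrow> pr 2 3 x \<in> A \<and> x $ 1 = u (pr 2 3 x)"
proof
  assume "pr 2 3 x \<in> A \<and> x $ 1 = u (pr 2 3 x)"
  then have "x = pt (pr 2 3 x) (u (pr 2 3 x))" "pr 2 3 x \<in> A" using pt_pr[of x] by auto
  then show "x \<in> V" unfolding Vu by blast
qed (auto simp: Vu)

lemma V_subset: "V \<subseteq> M" using V openin_subset by fastforce

lemma u_mem: "q \<in> A \<Longrightarrow> pt q (u q) \<in> M"
  using V_subset by (auto simp: Vu)

lemma near_boundary:
  assumes "q \<in> C"
  obtains \<epsilon> where "\<epsilon> > 0" "\<And>x. x \<in> M \<Longrightarrow> dist x (pt q 0) < \<epsilon> \<Longrightarrow> x \<in> V"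
proof -
  obtain W where W: "open W" "V = M \<inter> W" using V(1) by (auto simp: openin_open)
  have "pt q 0 \<in> W" using assms W V(2) by (auto simp: C_def P_point_eq)
  then obtain \<epsilon> where "\<epsilon> > 0" "ball (pt q 0) \<epsilon> \<subseteq> W" using W(1) open_contains_ball by meson
  then show thesis using that[of \<epsilon>] W(2) by (auto simp: dist_commute subset_iff)
qed

text \<open>Near \<open>\<Gamma>\<close> the surface projects injectively into the closure of \<open>D\<close>. A parametrization by an open disc would,
  by invariance of domain, have an open projection, which must lie in the interior \<open>D\<close> and so misses the curve.
  This makes boundary points and interior points of the manifold disjoint notions.\<close>

lemma no_interior_param:
  assumes X: "local_param M U X" and v: "v \<in> U" "v $ 1 > 0"
  shows "X v \<notin> \<Gamma>"
proof
  assume p: "X v \<in> \<Gamma>"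
  define B where "B = U \<inter> {v. v $ 1 > 0}"
  have "open B" unfolding B_def using X
    by (intro open_Int open_halfspace_component_gt_cart) (simp add: local_param_def)
  obtain Y where Y: "homeomorphism (U \<inter> half_plane) (X ` (U \<inter> half_plane)) X Y"
    using X by (auto simp: local_param_def)
  have BU: "B \<subseteq> U \<inter> half_plane" by (auto simp: B_def half_plane_def)
  have cX: "continuous_on B X" using Y BU by (meson continuous_on_subset homeomorphism_cont1)
  have iX: "inj_on X B" using Y BU by (metis homeomorphism_def inj_on_inverseI inj_on_subset)
  have XM: "X ` B \<subseteq> M" using X BU openin_subset by (fastforce simp: local_param_def)
  obtain W where W: "open W" "V = M \<inter> W" using V(1) by (auto simp: openin_open)
  define B' where "B' = B \<inter> X -` W"
  have oB': "open B'" unfolding B'_def by (rule continuous_open_preimage[OF cX \<open>open B\<close> W(1)])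
  have XV: "X ` B' \<subseteq> V" using XM W(2) by (auto simp: B'_def)
  have vB: "v \<in> B'" using v p V(2) W(2) by (auto simp: B'_def B_def)
  have "inj_on (pr 2 3) V" by (auto simp: inj_on_def V_iff intro: pt_eqI)
  then have "inj_on (\<lambda>w. pr 2 3 (X w)) B'"
    using XV iX unfolding inj_on_def B'_def by blast
  moreover have "continuous_on B' (\<lambda>w. pr 2 3 (X w))"
    by (intro continuous_on_pr continuous_on_subset[OF cX]) (simp add: B'_def)
  ultimately have "open ((\<lambda>w. pr 2 3 (X w)) ` B')"
    using invariance_of_domain oB' by blast
  moreover have "(\<lambda>w. pr 2 3 (X w)) ` B' \<subseteq> closure D"
    using XV A_subset by (auto simp: V_iff subset_iff)
  ultimately have "(\<lambda>w. pr 2 3 (X w)) ` B' \<subseteq> D"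
    using interior_closure_D interior_maximal by metis
  then have "pr 2 3 (X v) \<in> D" using vB by blast
  moreover have "pr 2 3 (X v) \<in> C" using \<Gamma>_pt[OF p] by blast
  ultimately show False using domains(1) by blast
qed

text \<open>A boundary point has a neighbourhood whose part in \<open>S\<close> is the image of an open half disc; so the boundary
  cannot hold together parts of \<open>M\<close> that are separated in \<open>S\<close>.\<close>

lemma half_disc:
  assumes p: "p \<in> \<Gamma>"
  obtains Q where "openin (top_of_set M) Q" "p \<in> Q" "connected (Q \<inter> S)" "p \<in> closure S"
proof -
  obtain U X v where X: "local_param M U X" and v: "v \<in> U" "v $ 1 = 0" "X v = p"
    using p unfolding \<Gamma> surface_boundary_def by blast
  have U: "open U" using X by (simp add: local_param_def)
  obtain Y where Y: "homeomorphism (U \<inter> half_plane) (X ` (U \<inter> half_plane)) X Y"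
    using X by (auto simp: local_param_def)
  have cX: "continuous_on (U \<inter> half_plane) X" using Y by (rule homeomorphism_cont1)
  obtain r where r: "r > 0" "ball v r \<subseteq> U" using U v(1) open_contains_ball by meson
  define Q where "Q = X ` (ball v r \<inter> half_plane)"
  have XM: "openin (top_of_set M) (X ` (U \<inter> half_plane))" using X by (simp add: local_param_def)
  have "openin (top_of_set (U \<inter> half_plane)) (ball v r \<inter> half_plane)"
    using r by (auto simp: openin_open)
  then have oQ: "openin (top_of_set M) Q"
    unfolding Q_def by (rule openin_homeomorphic_image[OF Y XM])
  have QM: "Q \<subseteq> M" using oQ openin_subset by fastforce
  have vhp: "v \<in> half_plane" using v by (simp add: half_plane_def)
  have pQ: "p \<in> Q" unfolding Q_def using r v vhp by force
  have QS: "Q \<inter> S = X ` (ball v r \<inter> {w. w $ 1 > 0})"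
  proof (intro set_eqI iffI)
    fix x assume "x \<in> Q \<inter> S"
    then obtain w where w: "w \<in> ball v r" "w $ 1 \<ge> 0" "x = X w" "x \<notin> \<Gamma>"
      by (auto simp: Q_def half_plane_def S_def)
    then have "w $ 1 \<noteq> 0" using X r unfolding \<Gamma> surface_boundary_def by blast
    then show "x \<in> X ` (ball v r \<inter> {w. w $ 1 > 0})" using w by auto
  next
    fix x assume "x \<in> X ` (ball v r \<inter> {w. w $ 1 > 0})"
    then obtain w where w: "w \<in> ball v r" "w $ 1 > 0" "x = X w" by blast
    then have "x \<in> Q" by (auto simp: Q_def half_plane_def)
    moreover have "x \<notin> \<Gamma>" using no_interior_param[OF X] w r by blast
    ultimately show "x \<in> Q \<inter> S" using QM by (auto simp: S_def)
  qed
  have "convex {w::real^2. w $ 1 > 0}"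
    using convex_halfspace_gt[of 0 "axis 1 1 :: real^2"] by (simp add: inner_axis')
  then have "connected (ball v r \<inter> {w. w $ 1 > 0})" by (intro convex_connected convex_Int convex_ball)
  moreover have "continuous_on (ball v r \<inter> {w. w $ 1 > 0}) X"
    by (rule continuous_on_subset[OF cX]) (use r in \<open>auto simp: half_plane_def\<close>)
  ultimately have con: "connected (Q \<inter> S)" unfolding QS by (rule connected_continuous_image[rotated])
  have "p \<in> closure S"
    unfolding closure_approachable
  proof (intro allI impI)
    fix e :: real assume "e > 0"
    then obtain d where d: "d > 0" "\<And>w. w \<in> U \<inter> half_plane \<Longrightarrow> dist w v < d \<Longrightarrow> dist (X w) (X v) < e"
      using cX v(1) vhp unfolding continuous_on_iff by (metis IntI)
    define w where "w = v + (min d r / 2) *\<^sub>R axis 1 (1::real)"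
    have "dist w v = min d r / 2" using d r by (simp add: w_def dist_norm)
    then have w: "dist w v < d" "dist w v < r" using d r by auto
    have w1: "w $ 1 > 0" using d r v by (simp add: w_def axis_def)
    have "w \<in> ball v r" using w by (simp add: dist_commute)
    then have "X w \<in> Q \<inter> S" unfolding QS using w1 by blast
    moreover have "w \<in> U \<inter> half_plane" using \<open>w \<in> ball v r\<close> r w1 by (auto simp: half_plane_def)
    ultimately show "\<exists>y\<in>S. dist y p < e" using d(2)[OF _ w(1)] v(3) by blast
  qed
  then show thesis using that oQ pQ con by blast
qed

lemma openin_S: "openin (top_of_set M) S"
proof -
  have "S = M \<inter> {x. x $ 1 > 0}" using S_iff by blast
  then show ?thesis by (simp add: openin_open_Int open_halfspace_component_gt_cart)
qed

text \<open>Relatively open sets of \<open>M\<close> that meet \<open>S\<close> inside one of two separating pieces cover \<open>M\<close>, since a half disc lies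
  in a single piece; so a separation of \<open>S\<close> would separate \<open>M\<close>.\<close>

lemma connected_S: "connected S"
  unfolding connected_openin
proof (intro notI, elim exE conjE)
  fix E1 E2 assume E: "openin (top_of_set S) E1" "openin (top_of_set S) E2" "S \<subseteq> E1 \<union> E2" "E1 \<inter> E2 = {}" "E1 \<noteq> {}" "E2 \<noteq> {}"
  define Ms where "Ms E = \<Union>{Q. openin (top_of_set M) Q \<and> Q \<inter> S \<subseteq> E}" for E
  have oM: "openin (top_of_set M) (Ms E)" for E unfolding Ms_def by blast
  have sub: "E \<subseteq> Ms E" if "openin (top_of_set S) E" for E
    using openin_trans[OF that openin_S] unfolding Ms_def by blast
  have SM: "S \<subseteq> M" by (auto simp: S_def)
  have "M \<subseteq> Ms E1 \<union> Ms E2"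
  proof
    fix p assume "p \<in> M"
    show "p \<in> Ms E1 \<union> Ms E2"
    proof (cases "p \<in> S")
      case True
      then show ?thesis using E sub by blast
    next
      case False
      then have "p \<in> \<Gamma>" using \<open>p \<in> M\<close> by (simp add: S_def)
      then obtain Q where Q: "openin (top_of_set M) Q" "p \<in> Q" "connected (Q \<inter> S)" using half_disc by blast
      have "openin (top_of_set (Q \<inter> S)) (Q \<inter> S \<inter> E1)" "openin (top_of_set (Q \<inter> S)) (Q \<inter> S \<inter> E2)"
        using E(1,2) by (auto simp: openin_open)
      moreover have "Q \<inter> S \<subseteq> Q \<inter> S \<inter> E1 \<union> Q \<inter> S \<inter> E2" "Q \<inter> S \<inter> E1 \<inter> (Q \<inter> S \<inter> E2) = {}"
        using E(3,4) by blast+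
      ultimately have "Q \<inter> S \<inter> E1 = {} \<or> Q \<inter> S \<inter> E2 = {}"
        using Q(3) unfolding connected_openin by metis
      then have "Q \<inter> S \<subseteq> E2 \<or> Q \<inter> S \<subseteq> E1" using E(3) by blast
      then show ?thesis using Q(1,2) unfolding Ms_def by blast
    qed
  qed
  moreover have "Ms E1 \<inter> Ms E2 = {}"
  proof (rule ccontr)
    assume "Ms E1 \<inter> Ms E2 \<noteq> {}"
    then obtain p Q1 Q2 where p: "p \<in> Q1" "p \<in> Q2" and Q: "openin (top_of_set M) Q1" "Q1 \<inter> S \<subseteq> E1"
      "openin (top_of_set M) Q2" "Q2 \<inter> S \<subseteq> E2"
      unfolding Ms_def by blast
    have e: "Q1 \<inter> Q2 \<inter> S = {}" using Q E(4) by blast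
    have pM: "p \<in> M" using p Q(1) openin_subset by fastforce
    have "p \<notin> S" using e p by blast
    then have "p \<in> closure S" using half_disc pM unfolding S_def by blast
    moreover obtain W where "open W" "Q1 \<inter> Q2 = M \<inter> W"
      using openin_Int[OF Q(1,3)] by (auto simp: openin_open)
    ultimately have "W \<inter> S \<noteq> {}" using p open_Int_closure_eq_empty[of W S] by blast
    then show False using e \<open>Q1 \<inter> Q2 = M \<inter> W\<close> SM by blast
  qed
  moreover have "Ms E1 \<noteq> {}" "Ms E2 \<noteq> {}" using sub E by blast+
  ultimately show False using connected oM unfolding connected_openin by blast
qed

subsection \<open>A function changing sign across the surface\<close>

text \<open>The complement of the closed half cylinder below the closure of \<open>D\<close>. It contains the interior of the surface
  as a closed subset, and its part below the plane connects the points just outside \<open>D\<close> to infinity.\<close>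

definition G :: "(real^3) set" where
  "G = {x. x $ 1 > 0 \<or> pr 2 3 x \<in> Ext}"

lemma G_S: "M \<inter> G = S"
proof -
  have "pr 2 3 x \<notin> Ext" if "x \<in> M" "x $ 1 = 0" for x
    using that \<Gamma>_pt[of x] domains(1) by (auto simp: \<Gamma>_iff)
  then show ?thesis using S_iff M_nonneg by (auto simp: G_def) (metis less_eq_real_def)
qed

text \<open>Pushing upwards along the \<open>x\<close>-direction moves \<open>G\<close> into the convex set \<open>x > 0\<close>.\<close>

lemma contractible_G: "contractible G"
proof -
  define \<rho> where "\<rho> x = x + (\<bar>x $ 1\<bar> + 1) *\<^sub>R axis 1 1" for x :: "real^3"
  have up: "x + t *\<^sub>R axis 1 1 \<in> G" if "x \<in> G" "t \<ge> 0" for x t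
  proof -
    have "pr 2 3 (x + t *\<^sub>R axis 1 1) = pr 2 3 x" by (simp add: vec_eq_iff forall_2 axis_def)
    then show ?thesis using that by (auto simp: G_def axis_def)
  qed
  have c\<rho>: "continuous_on G \<rho>" unfolding \<rho>_def by (intro continuous_intros)
  have "closed_segment x (\<rho> x) \<subseteq> G" if x: "x \<in> G" for x
  proof
    fix y assume "y \<in> closed_segment x (\<rho> x)"
    then obtain t where t: "0 \<le> t" "y = (1 - t) *\<^sub>R x + t *\<^sub>R \<rho> x" by (auto simp: closed_segment_def)
    have "y = x + (t * (\<bar>x $ 1\<bar> + 1)) *\<^sub>R axis 1 1" unfolding t(2) \<rho>_def by (simp add: algebra_simps)
    then show "y \<in> G" using up[OF x, of "t * (\<bar>x $ 1\<bar> + 1)"] t by simp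
  qed
  then have 1: "homotopic_with_canon (\<lambda>x. True) G G id \<rho>"
    by (intro homotopic_with_linear c\<rho>) auto
  let ?a = "axis 1 1 :: real^3"
  have "closed_segment (\<rho> x) ?a \<subseteq> G" for x
  proof -
    have "convex {x::real^3. x $ 1 > 0}"
      using convex_halfspace_gt[of 0 "axis 1 1 :: real^3"] by (simp add: inner_axis')
    moreover have "\<rho> x \<in> {x. x $ 1 > 0}" "?a \<in> {x. x $ 1 > 0}" by (auto simp: \<rho>_def axis_def)
    ultimately have "closed_segment (\<rho> x) ?a \<subseteq> {x. x $ 1 > 0}" by (rule closed_segment_subset[rotated 2])
    then show ?thesis by (auto simp: G_def)
  qed
  then have 2: "homotopic_with_canon (\<lambda>x. True) G G \<rho> (\<lambda>x. ?a)"
    by (intro homotopic_with_linear c\<rho>) auto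
  show ?thesis unfolding contractible_def using homotopic_with_trans[OF 1 2] by blast
qed

end

lemma norm_pr_le:
  assumes "frame3 i j k" shows "norm (pr i j x) \<le> norm x"
  unfolding norm_le by (simp add: inner_vec_def sum_2 frame3_sum[OF assms])

lemma pr_diff: "pr i j (x - y) = pr i j x - pr i j y"
  by (simp add: vec_eq_iff forall_2)

lemma dist_pr_le:
  assumes "frame3 i j k" shows "dist (pr i j x) (pr i j y) \<le> dist x y"
  using norm_pr_le[OF assms, of "x - y"] by (simp add: dist_norm pr_diff)

context surface_over_domain
begin

lemma N_nonzero:
  assumes "x \<in> M" shows "\<exists>k. N x $ k \<noteq> 0"
proof (rule ccontr)
  assume "\<not> ?thesis"
  then have "sol_inner x (N x) (N x) = 0" by (simp add: sol_inner_eq)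
  then show False using cmc assms by (simp add: cmc_normal_def unit_normal_field_def)
qed

lemma interior_local_graph:
  assumes "p \<in> S" "frame3 i j k" "N p $ k \<noteq> 0" "\<epsilon> > 0"
  obtains r e f where "local_graph M i j k p r e f" "r < \<epsilon>" "e < \<epsilon>"
proof -
  have "p \<in> M" "p \<notin> \<Gamma>" using assms(1) unfolding S_def by blast+
  then have p: "p \<in> M" "p \<notin> surface_boundary M" using \<Gamma> by blast+
  obtain B X u where X: "open_param M B X" "u \<in> B" "X u = p"
    using interior_open_param[OF embedded p] by blast
  define \<nu> where "\<nu> = (\<chi> l. gdiag p l * N p $ l)"
  have "\<nu> \<bullet> partial a X u = 0" for a
    using cmc_normal_open_param(1)[OF cmc X(1,2), of a] X(3) by (simp add: \<nu>_def sol_inner_eq inner_vec_def mult_ac)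
  moreover have "\<nu> $ k \<noteq> 0" using assms(3) gdiag_pos[of p k] by (simp add: \<nu>_def)
  ultimately show thesis
    using local_graph_exists[OF assms(2) X _ _ assms(4)] that by blast
qed

lemma exists_frame:
  assumes "x \<in> M"
  obtains i j k where "frame3 i j k" "N x $ k \<noteq> 0"
proof -
  obtain k where k: "N x $ k \<noteq> 0" using N_nonzero[OF assms] by blast
  have "frame3 2 3 1" "frame3 1 3 2" "frame3 1 2 3" by (auto simp: frame3_def)
  moreover have "k = 1 \<or> k = 2 \<or> k = 3" by (rule exhaust_3)
  ultimately show thesis using that k by blast
qed

text \<open>A local defining function of the surface, increasing in the direction of the normal.\<close>

definition side_function :: "real^3 \<Rightarrow> real \<Rightarrow> (real^3 \<Rightarrow> real) \<Rightarrow> bool" where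
  "side_function p r F \<longleftrightarrow> r > 0 \<and> continuous_on (ball p r) F \<and>
     (\<forall>x\<in>ball p r. x $ 1 > 0 \<and> (x \<in> M \<longleftrightarrow> F x = 0)) \<and>
     (\<forall>m\<in>M \<inter> ball p r. \<exists>c>0. (F has_derivative (\<lambda>h. c * sol_inner m (N m) h)) (at m))"

lemma local_graph_conormal:
  assumes fr: "frame3 i j k" and lg: "local_graph M i j k p r e f" and v: "v \<in> ball (pr i j p) r"
  defines "x \<equiv> gpt i j k v (f v)"
  shows "sol_inner x (N x) h = gdiag x k * N x $ k * (h $ k - partial 1 f v * h $ i - partial 2 f v * h $ j)"
proof -
  have "sol_inner x (N x) h = (\<Sum>l\<in>UNIV. gdiag x k * N x $ k * (cvec i j k (partial 1 f v) (partial 2 f v) $ l * h $ l))"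
  proof -
    have "gdiag x l * N x $ l * h $ l = gdiag x k * N x $ k * (cvec i j k (partial 1 f v) (partial 2 f v) $ l * h $ l)" for l
      using arg_cong[OF local_graph_normal(1)[OF cmc fr lg v, folded x_def, of l], of "\<lambda>z. z * h $ l"]
      by (simp only: mult_ac)
    then show ?thesis by (simp only: sol_inner_eq)
  qed
  also have "\<dots> = gdiag x k * N x $ k * (h $ k - partial 1 f v * h $ i - partial 2 f v * h $ j)"
    by (simp add: frame3_sum[OF fr] cvec_nth[OF fr] sum_distrib_left[symmetric] algebra_simps)
  finally show ?thesis .
qed

lemma side_function_exists:
  assumes p: "p \<in> S" shows "\<exists>r F. side_function p r F"
proof -
  have pM: "p \<in> M" and p1: "p $ 1 > 0" using p by (auto simp: S_iff)
  obtain i j k where fr: "frame3 i j k" and Nk: "N p $ k \<noteq> 0" using exists_frame[OF pM] by blast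
  obtain r0 e f where lg: "local_graph M i j k p r0 e f"
    using interior_local_graph[OF p fr Nk zero_less_one] by blast
  note d = local_graphD[OF lg]
  define r where "r = min (min r0 e) (p $ 1)"
  have r: "r > 0" using d p1 by (simp add: r_def)
  define s where "s = sgn (N p $ k)"
  have s: "s\<^sup>2 = 1" "s * N p $ k > 0" using Nk by (auto simp: s_def sgn_if power2_eq_square)
  define F where "F x = s * (x $ k - f (pr i j x))" for x
  have inb: "pr i j x \<in> ball (pr i j p) r0" "\<bar>x $ k - p $ k\<bar> < e" "x $ 1 > 0" if "x \<in> ball p r" for x
  proof -
    have x: "dist p x < r0" "dist p x < e" "dist p x < p $ 1" using that by (auto simp: r_def)
    show "pr i j x \<in> ball (pr i j p) r0" using dist_pr_le[OF fr, of p x] x by simp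
    show "\<bar>x $ k - p $ k\<bar> < e" "x $ 1 > 0"
      using component_le_norm_cart[of "p - x" k] component_le_norm_cart[of "p - x" 1] x by (simp_all add: dist_norm)
  qed
  have "side_function p r F"
    unfolding side_function_def
  proof (intro conjI ballI)
    show "continuous_on (ball p r) F"
      unfolding F_def
      by (intro continuous_intros continuous_on_compose2[OF smooth_on_continuous[OF d(3)]]) (use inb in blast)
    show "x $ 1 > 0" "x \<in> M \<longleftrightarrow> F x = 0" if "x \<in> ball p r" for x
      using inb[OF that] d(5)[of x] s by (auto simp: F_def)
    fix m assume "m \<in> M \<inter> ball p r"
    then have m: "m \<in> M" "m \<in> ball p r" by auto
    define v where "v = pr i j m"
    have v: "v \<in> ball (pr i j p) r0" using inb[OF m(2)] by (simp add: v_def)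
    have mv: "gpt i j k v (f v) = m"
      using d(5)[of m] inb[OF m(2)] m gpt_pr[OF fr, of m] by (simp add: v_def)
    define c where "c = s / (gdiag m k * N m $ k)"
    have sN: "s * N m $ k > 0" using local_graph_sign[OF cmc fr lg pM s v] by (simp add: mv)
    then have Nm: "N m $ k \<noteq> 0" by auto
    have "s / N m $ k > 0" using sN by (simp add: zero_less_mult_iff zero_less_divide_iff)
    then have c: "c > 0" using gdiag_pos[of m k] divide_pos_pos[of "s / N m $ k" "gdiag m k"] by (simp add: c_def mult.commute)
    have df: "(f has_derivative (\<lambda>h. partial 1 f v * h $ 1 + partial 2 f v * h $ 2)) (at (pr i j m))"
      using smooth_partials(1)[OF open_ball d(3) v] by (simp add: v_def)
    have "((\<lambda>x. f (pr i j x)) has_derivative (\<lambda>h. partial 1 f v * h $ i + partial 2 f v * h $ j)) (at m)"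
      using has_derivative_compose[OF bounded_linear_imp_has_derivative[OF bounded_linear_pr] df] by simp
    then have "(F has_derivative (\<lambda>h. s * (h $ k - (partial 1 f v * h $ i + partial 2 f v * h $ j)))) (at m)"
      unfolding F_def
      by (intro has_derivative_mult_right has_derivative_diff bounded_linear_imp_has_derivative[OF bounded_linear_vec_nth])
    moreover have "(\<lambda>h. s * (h $ k - (partial 1 f v * h $ i + partial 2 f v * h $ j))) = (\<lambda>h. c * sol_inner m (N m) h)"
    proof
      fix h
      have "gdiag m k * N m $ k \<noteq> 0" using Nm gdiag_pos[of m k] by simp
      then have "c * (gdiag m k * N m $ k) = s" by (simp add: c_def)
      then have "c * (gdiag m k * N m $ k * y) = s * y" for y by (simp only: mult.assoc[symmetric])
      then show "s * (h $ k - (partial 1 f v * h $ i + partial 2 f v * h $ j)) = c * sol_inner m (N m) h"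
        unfolding local_graph_conormal[OF fr lg v, of h, unfolded mv] by (simp only: diff_diff_eq)
    qed
    ultimately show "\<exists>c>0. (F has_derivative (\<lambda>h. c * sol_inner m (N m) h)) (at m)" using c by auto
  qed fact
  then show ?thesis by blast
qed

text \<open>By the first variation of the distance, the segment to a nearest point is orthogonal to the tangent plane,
  so it is a multiple of the conormal, on which the lowered normal does not vanish.\<close>

lemma nearest_point_transversal:
  assumes m: "m \<in> S" and x: "x \<noteq> m" and near: "\<And>m'. m' \<in> M \<Longrightarrow> dist x m \<le> dist x m'"
  shows "sol_inner m (N m) (x - m) \<noteq> 0"
proof
  assume z: "sol_inner m (N m) (x - m) = 0"
  have mM: "m \<in> M" using m by (auto simp: S_iff)
  obtain i j k where fr: "frame3 i j k" and Nk: "N m $ k \<noteq> 0" using exists_frame[OF mM] by blast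
  obtain r e f where lg: "local_graph M i j k m r e f"
    using interior_local_graph[OF m fr Nk zero_less_one] by blast
  note d = local_graphD[OF lg]
  let ?v = "pr i j m"
  have v: "?v \<in> ball ?v r" using d(1) by simp
  have mv: "gpt i j k ?v (f ?v) = m" using local_graph_center[OF lg mM] gpt_pr[OF fr, of m] by simp
  define p1 p2 where "p1 = partial 1 f ?v" and "p2 = partial 2 f ?v"
  define \<psi> where "\<psi> w = (x - gpt i j k w (f w)) \<bullet> (x - gpt i j k w (f w))" for w
  have df: "(f has_derivative (\<lambda>h. p1 * h $ 1 + p2 * h $ 2)) (at ?v)"
    unfolding p1_def p2_def by (rule smooth_partials(1)[OF open_ball d(3) v])
  have dX: "((\<lambda>w. x - gpt i j k w (f w)) has_derivative (\<lambda>h. 0 - gpt i j k h (p1 * h $ 1 + p2 * h $ 2))) (at ?v)"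
    by (intro has_derivative_diff has_derivative_const has_derivative_gpt df)
  have d\<psi>: "(\<psi> has_derivative (\<lambda>h. (x - m) \<bullet> (0 - gpt i j k h (p1 * h $ 1 + p2 * h $ 2)) + (0 - gpt i j k h (p1 * h $ 1 + p2 * h $ 2)) \<bullet> (x - m))) (at ?v)"
    using has_derivative_inner[OF dX dX] unfolding \<psi>_def mv .
  have "\<psi> ?v \<le> \<psi> w" if "w \<in> ball ?v r" for w
  proof -
    have "dist x m \<le> dist x (gpt i j k w (f w))" by (rule near[OF local_graph_mem[OF fr lg that]])
    then show ?thesis unfolding \<psi>_def mv by (simp add: dist_norm norm_le)
  qed
  then have "(\<lambda>h. (x - m) \<bullet> (0 - gpt i j k h (p1 * h $ 1 + p2 * h $ 2)) + (0 - gpt i j k h (p1 * h $ 1 + p2 * h $ 2)) \<bullet> (x - m)) = (\<lambda>h. 0)"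
    using differential_zero_maxmin[OF v open_ball d\<psi>] by blast
  then have *: "(x - m) \<bullet> gpt i j k h (p1 * h $ 1 + p2 * h $ 2) = 0" for h
    by (simp add: fun_eq_iff inner_commute) 
  define y where "y = x - m"
  have iy: "y \<bullet> gpt i j k h t = y $ i * h $ 1 + y $ j * h $ 2 + y $ k * t" for h t
    using fr by (simp add: inner_vec_def frame3_sum[OF fr])
  have yi: "y $ i = - p1 * y $ k" "y $ j = - p2 * y $ k"
    using *[of "axis 1 1"] *[of "axis 2 1"] unfolding y_def[symmetric] iy by (auto simp: axis_def algebra_simps)
  have "gdiag m k * N m $ k * (y $ k - p1 * y $ i - p2 * y $ j) = 0"
    using z local_graph_conormal[OF fr lg v, of "x - m"] unfolding mv y_def[symmetric] p1_def[symmetric] p2_def[symmetric] by simp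
  then have "y $ k - p1 * y $ i - p2 * y $ j = 0" using Nk gdiag_pos[of m k] by simp
  then have "y $ k * (1 + p1\<^sup>2 + p2\<^sup>2) = 0" unfolding yi by (simp add: algebra_simps power2_eq_square)
  moreover have "1 + p1\<^sup>2 + p2\<^sup>2 > 0" by (smt (verit) zero_le_power2)
  ultimately have "y $ k = 0" by simp
  then have "y = 0" using yi by (intro frame3_eqI[OF fr]) auto
  then show False using x by (simp add: y_def)
qed

text \<open>The segment from \<open>x\<close> to a nearest point \<open>m\<close> meets the surface in \<open>m\<close> only, so \<open>F\<close> keeps its sign along it, and
  near \<open>m\<close> this sign is given by the derivative. Hence the side of \<open>x\<close> is described without reference to the
  choice of \<open>F\<close>, which makes the local sides fit together.\<close>

lemma side_function_nearest:
  assumes F: "side_function p r F" and p: "p \<in> M" and x: "dist p x < r / 2" "x \<notin> M"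
    and m: "m \<in> M" "\<And>m'. m' \<in> M \<Longrightarrow> dist x m \<le> dist x m'"
  shows "sgn (sol_inner m (N m) (x - m)) = sgn (F x)" and "F x \<noteq> 0"
proof -
  have cF: "continuous_on (ball p r) F" and FM: "\<And>y. y \<in> ball p r \<Longrightarrow> y $ 1 > 0 \<and> (y \<in> M \<longleftrightarrow> F y = 0)" and "r > 0"
    using F by (auto simp: side_function_def)
  have xm: "dist x m < r / 2" using m(2)[OF p] x(1) by (simp add: dist_commute)
  have xb: "x \<in> ball p r" using x(1) \<open>r > 0\<close> by simp
  have mb: "m \<in> ball p r" using dist_triangle[of p m x] xm x(1) by simp
  have mS: "m \<in> S" using FM[OF mb] m(1) by (simp add: S_iff)
  have xnm: "x \<noteq> m" using x(2) m(1) by blast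
  obtain c where c: "c > 0" "(F has_derivative (\<lambda>h. c * sol_inner m (N m) h)) (at m)"
    using F m(1) mb unfolding side_function_def by blast
  define y where "y t = m + t *\<^sub>R (x - m)" for t
  have yb: "y t \<in> ball p r" if "0 \<le> t" "t \<le> 1" for t
  proof -
    have "y t = (1 - t) *\<^sub>R m + t *\<^sub>R x" by (simp add: y_def algebra_simps)
    then show ?thesis using convexD_alt[OF convex_ball mb xb that] by simp
  qed
  have yM: "y t \<notin> M" if "0 < t" "t \<le> 1" for t
  proof
    assume "y t \<in> M"
    then have "dist x m \<le> dist x (y t)" by (rule m(2))
    also have "x - y t = (1 - t) *\<^sub>R (x - m)" by (simp add: y_def algebra_simps)
    then have "dist x (y t) = (1 - t) * dist x m" using that by (simp add: dist_norm)
    finally have "t * dist x m \<le> 0" by (simp add: algebra_simps)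
    moreover have "t * dist x m > 0" using that xnm by simp
    ultimately show False by simp
  qed
  show Fx: "F x \<noteq> 0" using FM[OF xb] x(2) by simp
  define \<phi> where "\<phi> t = F (y t)" for t
  have \<phi>0: "\<phi> 0 = 0" using FM[OF mb] m(1) by (simp add: \<phi>_def y_def)
  have same: "sgn (\<phi> t) = sgn (F x)" if t: "0 < t" "t \<le> 1" for t
  proof -
    have "continuous_on {0<..1} \<phi>"
      unfolding \<phi>_def by (rule continuous_on_compose2[OF cF]) (auto simp: y_def intro!: continuous_intros yb[unfolded y_def])
    moreover have nz: "\<phi> t \<noteq> 0" if "t \<in> {0<..1}" for t using FM[OF yb] yM that by (auto simp: \<phi>_def)
    moreover have "\<phi> 1 = F x" by (simp add: \<phi>_def y_def)
    moreover have con: "connected {0<..1::real}" by (intro convex_connected convex_real_interval)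
    ultimately have "\<phi> t > 0 \<longleftrightarrow> F x > 0" 
      using connected_positive[of "{0<..1}" \<phi> t 1] connected_positive[of "{0<..1}" \<phi> 1 t] t by auto
    then show ?thesis using nz[of t] t Fx by (auto simp: sgn_if)
  qed
  have "((\<lambda>t. y t) has_derivative (\<lambda>t. t *\<^sub>R (x - m))) (at 0)"
    unfolding y_def by (auto intro!: derivative_eq_intros)
  moreover have "(F has_derivative (\<lambda>h. c * sol_inner m (N m) h)) (at (y 0))" using c(2) by (simp add: y_def)
  ultimately have "(\<phi> has_derivative (\<lambda>t. c * sol_inner m (N m) (t *\<^sub>R (x - m)))) (at 0)"
    unfolding \<phi>_def by (rule has_derivative_compose)
  moreover have "(\<lambda>t. c * sol_inner m (N m) (t *\<^sub>R (x - m))) = (*) (c * sol_inner m (N m) (x - m))"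
    by (simp add: fun_eq_iff sol_inner_eq sum_distrib_left mult_ac)
  ultimately have der: "(\<phi> has_real_derivative (c * sol_inner m (N m) (x - m))) (at 0)"
    by (simp add: has_field_derivative_def)
  let ?w = "sol_inner m (N m) (x - m)"
  have "?w \<noteq> 0" by (rule nearest_point_transversal[OF mS xnm m(2)])
  then consider "?w > 0" | "?w < 0" by linarith
  then show "sgn ?w = sgn (F x)"
  proof cases
    case 1
    then have "c * ?w > 0" using c by simp
    then obtain d where d: "d > 0" "\<And>h. 0 < h \<Longrightarrow> h < d \<Longrightarrow> \<phi> 0 < \<phi> (0 + h)" using DERIV_pos_inc_right[OF der] by blast
    define t where "t = min d 1 / 2"
    have "0 < t" "t < d" "t \<le> 1" using d(1) by (auto simp: t_def)
    then show ?thesis using d(2)[of t] same[of t] \<phi>0 1 by simp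
  next
    case 2
    then have "c * ?w < 0" using c by (simp add: mult_pos_neg)
    then obtain d where d: "d > 0" "\<And>h. 0 < h \<Longrightarrow> h < d \<Longrightarrow> \<phi> 0 > \<phi> (0 + h)" using DERIV_neg_dec_right[OF der] by blast
    define t where "t = min d 1 / 2"
    have "0 < t" "t < d" "t \<le> 1" using d(1) by (auto simp: t_def)
    then show ?thesis using d(2)[of t] same[of t] \<phi>0 2 by simp
  qed
qed

lemma S_nonempty: "S \<noteq> {}"
proof -
  obtain q where "q \<in> C" using C_nonempty by blast
  then have "pt q 0 \<in> \<Gamma>" by (simp add: C_def P_point_eq)
  then show ?thesis using half_disc by force
qed

text \<open>Let \<open>\<sigma>\<close> be the side of a point near \<open>S\<close> and let \<open>h\<close> grow from \<open>0\<close> on \<open>S\<close> to \<open>\<pi>\<close> outside a neighbourhood \<open>O'\<close> of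
  \<open>S\<close>. Then \<open>cos h + i \<sigma> sin h\<close> is continuous on \<open>G\<close>, since \<open>sin h\<close> vanishes wherever \<open>\<sigma>\<close> jumps, and takes the value
  \<open>1\<close> exactly on \<open>S\<close>. As \<open>G\<close> is contractible, it has a continuous argument, which is constant on the connected
  set \<open>S\<close>. Normalized to \<open>0\<close> there, the argument vanishes on \<open>S\<close> only, and near \<open>S\<close> it has the sign \<open>\<sigma>\<close>.\<close>

lemma crossing_function:
  obtains \<Theta> where "continuous_on G \<Theta>" "\<And>x. x \<in> G \<Longrightarrow> \<Theta> x = 0 \<longleftrightarrow> x \<in> M"
    "\<And>p. p \<in> S \<Longrightarrow> N p $ 1 \<noteq> 0 \<Longrightarrow> \<exists>\<delta>>0. \<forall>s. 0 < s \<and> s < \<delta> \<longrightarrow>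
        sgn (\<Theta> (p + s *\<^sub>R axis 1 1)) = sgn (N p $ 1) \<and> sgn (\<Theta> (p - s *\<^sub>R axis 1 1)) = - sgn (N p $ 1)"
proof -
  define nr where "nr x = (SOME m. m \<in> M \<and> (\<forall>m'\<in>M. dist x m \<le> dist x m'))" for x
  have Mne: "M \<noteq> {}" using S_nonempty by (auto simp: S_def)
  have nr: "nr x \<in> M" "\<And>m'. m' \<in> M \<Longrightarrow> dist x (nr x) \<le> dist x m'" for x
  proof -
    have "\<exists>m\<in>M. \<forall>m'\<in>M. dist x m \<le> dist x m'"
      using distance_attains_inf[OF compact_imp_closed[OF compact] Mne, of x] by metis
    then have "\<exists>m. m \<in> M \<and> (\<forall>m'\<in>M. dist x m \<le> dist x m')" by blast
    from someI_ex[OF this] show "nr x \<in> M" "\<And>m'. m' \<in> M \<Longrightarrow> dist x (nr x) \<le> dist x m'"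
      unfolding nr_def by blast+
  qed
  define \<sigma> where "\<sigma> x = sgn (sol_inner (nr x) (N (nr x)) (x - nr x))" for x
  define O' where "O' = {x. \<exists>p\<in>S. \<exists>r F. side_function p r F \<and> dist p x < r / 2}"
  have \<sigma>F: "\<sigma> x = sgn (F x)" "F x \<noteq> 0" if "side_function p r F" "p \<in> S" "dist p x < r / 2" "x \<notin> M" for x p r F
    using side_function_nearest[OF that(1) _ that(3,4) nr] that(2) by (auto simp: \<sigma>_def S_iff)
  have \<sigma>sq: "\<sigma> x * \<sigma> x = 1" if "x \<in> O'" "x \<notin> M" for x
    using \<sigma>F that unfolding O'_def by (auto simp: sgn_if)
  have \<sigma>le: "\<bar>\<sigma> x\<bar> \<le> 1" for x by (simp add: \<sigma>_def abs_sgn_eq)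
  have oO: "open O'"
  proof -
    have "O' = (\<Union>p\<in>S. \<Union>r\<in>{r. \<exists>F. side_function p r F}. ball p (r/2))"
      unfolding O'_def by (intro set_eqI) (simp only: UN_iff mem_Collect_eq mem_ball, blast)
    then show ?thesis by (simp add: open_UN)
  qed
  have SO: "S \<subseteq> O'"
  proof
    fix p assume "p \<in> S"
    then obtain r F where "side_function p r F" using side_function_exists by blast
    moreover from this have "dist p p < r / 2" by (simp add: side_function_def)
    ultimately show "p \<in> O'" using \<open>p \<in> S\<close> unfolding O'_def by blast
  qed
  have O1: "x $ 1 > 0" if "x \<in> O'" for x
    using that unfolding O'_def side_function_def by fastforce
  then have OG: "O' \<subseteq> G" by (auto simp: G_def)
  have "0 \<notin> O'" using O1 by force
  then have Oc: "- O' \<noteq> {}" "closed (- O')" using oO by auto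
  define d1 where "d1 x = infdist x M" for x
  define d2 where "d2 x = infdist x (- O')" for x
  have d1: "d1 x \<ge> 0" "d1 x = 0 \<longleftrightarrow> x \<in> M" for x
    using in_closed_iff_infdist_zero[OF compact_imp_closed[OF compact] Mne] by (auto simp: d1_def infdist_nonneg)
  have d2: "d2 x \<ge> 0" "d2 x = 0 \<longleftrightarrow> x \<notin> O'" for x
    using in_closed_iff_infdist_zero[OF Oc(2,1)] by (auto simp: d2_def infdist_nonneg)
  have dpos: "d1 x + d2 x > 0" if "x \<in> G" for x
  proof -
    have "d1 x \<noteq> 0 \<or> d2 x \<noteq> 0" using that G_S SO d1(2) d2(2) by blast
    then show ?thesis using d1(1)[of x] d2(1)[of x] by linarith
  qed
  define h where "h x = pi * (d1 x / (d1 x + d2 x))" for x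
  have ch: "continuous_on G h"
    unfolding h_def d1_def d2_def
    using dpos[unfolded d1_def d2_def] by (intro continuous_intros) (metis less_irrefl)
  have hM: "h x = 0 \<longleftrightarrow> x \<in> M" if "x \<in> G" for x using d1(2)[of x] dpos[OF that] by (auto simp: h_def)
  have hO: "h x = pi" if "x \<in> G" "x \<notin> O'" for x using d2(2)[of x] dpos[OF that(1)] that(2) by (auto simp: h_def)
  have h_range: "0 \<le> h x" "h x \<le> pi" if "x \<in> G" for x
  proof -
    have "0 \<le> d1 x / (d1 x + d2 x)" "d1 x / (d1 x + d2 x) \<le> 1"
      using d1(1)[of x] d2(1)[of x] dpos[OF that] by auto
    then have *: "0 \<le> pi * (d1 x / (d1 x + d2 x))" "pi * (d1 x / (d1 x + d2 x)) \<le> pi"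
      using mult_left_le[of "d1 x / (d1 x + d2 x)" pi] pi_ge_zero mult_nonneg_nonneg[of pi] by blast+
    show "0 \<le> h x" "h x \<le> pi" unfolding h_def by (rule *)+
  qed
  have h_strict: "0 < h x" "h x < pi" if "x \<in> O'" "x \<notin> M" for x
  proof -
    have x: "x \<in> G" using that OG by blast
    show "0 < h x" using hM[OF x] h_range[OF x] that by linarith
    have "d1 x / (d1 x + d2 x) < 1" using d2(1)[of x] d2(2)[of x] that(1) dpos[OF x] by (simp add: divide_less_eq)
    then show "h x < pi" unfolding h_def using pi_gt_zero mult_strict_left_mono[of _ 1 pi] by fastforce
  qed
  define w where "w x = \<sigma> x * sin (h x)" for x
  have csin: "continuous_on G (\<lambda>x. sin (h x))" by (intro continuous_intros ch)
  have cw: "continuous_on G w"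
    unfolding continuous_on_def
  proof
    fix x assume x: "x \<in> G"
    have ts: "((\<lambda>y. sin (h y)) \<longlongrightarrow> sin (h x)) (at x within G)" using csin x by (simp add: continuous_on_def)
    show "(w \<longlongrightarrow> w x) (at x within G)"
    proof (cases "x \<in> O' \<and> x \<notin> M")
      case True
      then obtain p r F where p: "p \<in> S" and F: "side_function p r F" and px: "dist p x < r / 2"
        unfolding O'_def by blast
      have r: "r > 0" and cF: "continuous_on (ball p r) F" using F by (auto simp: side_function_def)
      have Fx: "F x \<noteq> 0" using \<sigma>F(2)[OF F p px] True by blast
      define W where "W = ball p (r/2) \<inter> (\<lambda>y. F y * F x) -` {0<..}"
      have "continuous_on (ball p (r/2)) (\<lambda>y. F y * F x)"
        by (intro continuous_intros continuous_on_subset[OF cF]) (use r in auto)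
      then have oW: "open W" unfolding W_def by (intro continuous_open_preimage) auto
      have xW: "x \<in> W" using px Fx by (auto simp: W_def zero_less_mult_iff) 
      have \<sigma>W: "\<sigma> y = \<sigma> x" if "y \<in> W" for y
      proof -
        have y: "dist p y < r / 2" "F y * F x > 0" using that by (auto simp: W_def)
        have "y \<in> ball p r" using y r by auto
        then have "y \<notin> M" using F y(2) unfolding side_function_def by auto
        then have "\<sigma> y = sgn (F y)" using \<sigma>F(1)[OF F p y(1)] by simp
        moreover have "\<sigma> x = sgn (F x)" using \<sigma>F(1)[OF F p px] True by simp
        ultimately show ?thesis using y(2) by (auto simp: zero_less_mult_iff)
      qed
      have "((\<lambda>y. \<sigma> x * sin (h y)) \<longlongrightarrow> w x) (at x within G)"
        unfolding w_def by (intro tendsto_mult tendsto_const ts)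
      moreover have "eventually (\<lambda>y. \<sigma> x * sin (h y) = w y) (at x within G)"
        unfolding eventually_at_topological
      proof (intro exI[of _ W] conjI ballI impI)
        show "\<sigma> x * sin (h y) = w y" if "y \<in> W" for y using \<sigma>W[OF that] by (simp add: w_def)
      qed (rule oW, rule xW)
      ultimately show ?thesis by (rule Lim_transform_eventually)
    next
      case False
      then have "sin (h x) = 0" using hM[OF x] hO[OF x] by auto
      then have "((\<lambda>y. sin (h y)) \<longlongrightarrow> 0) (at x within G)" "w x = 0" using ts by (simp_all add: w_def)
      moreover have "norm (w y) \<le> norm (sin (h y))" for y
        unfolding w_def real_norm_def abs_mult using \<sigma>le[of y] by (simp add: mult_left_le_one_le)
      ultimately show ?thesis by (metis (mono_tags, lifting) Lim_null_comparison always_eventually tendsto_norm_zero)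
    qed
  qed
  define g where "g x = complex_of_real (cos (h x)) + \<i> * complex_of_real (w x)" for x
  have cg: "continuous_on G g" unfolding g_def by (intro continuous_intros ch cw)
  have w2: "(w x)\<^sup>2 = (sin (h x))\<^sup>2" if "x \<in> G" for x
  proof (cases "x \<in> O' \<and> x \<notin> M")
    case True
    then show ?thesis using \<sigma>sq[of x] by (simp add: w_def power_mult_distrib power2_eq_square)
  next
    case False
    then have "sin (h x) = 0" using hM[OF that] hO[OF that] by auto
    then show ?thesis by (simp add: w_def)
  qed
  have ng: "norm (g x) = 1" if "x \<in> G" for x
    using w2[OF that] by (simp add: g_def cmod_def)
  then have "g x \<noteq> 0" if "x \<in> G" for x using that by force
  then obtain L where L: "continuous_on G L" "\<And>x. x \<in> G \<Longrightarrow> g x = exp (L x)"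
    using continuous_logarithm_on_contractible[OF cg contractible_G] by blast
  define \<theta> where "\<theta> x = Im (L x)" for x
  have c\<theta>: "continuous_on G \<theta>" unfolding \<theta>_def by (intro continuous_intros L(1))
  have \<theta>: "cos (\<theta> x) = cos (h x)" "sin (\<theta> x) = w x" if "x \<in> G" for x
  proof -
    have "exp (Re (L x)) = 1" using ng[OF that] L(2)[OF that] by simp
    then have "exp (L x) = cis (\<theta> x)" by (simp add: exp_eq_polar \<theta>_def)
    then have "g x = cis (\<theta> x)" using L(2)[OF that] by simp
    then have "Re (g x) = cos (\<theta> x)" "Im (g x) = sin (\<theta> x)" by simp_all
    then show "cos (\<theta> x) = cos (h x)" "sin (\<theta> x) = w x" by (simp_all add: g_def)
  qed
  have SG: "S \<subseteq> G" using G_S by blast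
  have \<theta>S: "cos (\<theta> x) = 1" "sin (\<theta> x) = 0" if "x \<in> S" for x
    using \<theta>[of x] hM[of x] that SG by (auto simp: S_iff w_def)
  have const: "\<not> \<theta> a < \<theta> b" if ab: "a \<in> S" "b \<in> S" for a b
  proof
    assume lt: "\<theta> a < \<theta> b"
    define s where "s = min pi (\<theta> b - \<theta> a)"
    have s: "0 < s" "s \<le> pi" "s \<le> \<theta> b - \<theta> a" using lt by (auto simp: s_def)
    have "\<theta> a + s \<in> \<theta> ` S"
      by (rule connectedD_interval[OF connected_continuous_image[OF continuous_on_subset[OF c\<theta> SG] connected_S], of "\<theta> a" "\<theta> b"])
         (use ab s in auto)
    then have "cos (\<theta> a + s) = 1" using \<theta>S by force
    then have "cos s = 1" using \<theta>S[OF ab(1)] by (simp add: cos_add)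
    moreover have "cos s < cos 0" using s by (intro cos_monotone_0_pi) auto
    ultimately show False by simp
  qed
  obtain p0 where p0: "p0 \<in> S" using S_nonempty by blast
  define \<Theta> where "\<Theta> x = \<theta> x - \<theta> p0" for x
  have c\<Theta>: "continuous_on G \<Theta>" unfolding \<Theta>_def by (intro continuous_intros c\<theta>)
  have \<Theta>: "cos (\<Theta> x) = cos (h x)" "sin (\<Theta> x) = w x" if "x \<in> G" for x
    using \<theta>[OF that] \<theta>S[OF p0] by (simp_all add: \<Theta>_def cos_diff sin_diff)
  have \<Theta>S: "\<Theta> x = 0" if "x \<in> S" for x using const[OF that p0] const[OF p0 that] by (simp add: \<Theta>_def)
  have zero: "\<Theta> x = 0 \<longleftrightarrow> x \<in> M" if x: "x \<in> G" for x
  proof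
    assume "\<Theta> x = 0"
    then have "cos (h x) = 1" using \<Theta>(1)[OF x] by simp
    then have "h x = 0" using h_range[OF x] cos_monotone_0_pi[of 0 "h x"] by force
    then show "x \<in> M" using hM[OF x] by simp
  next
    assume "x \<in> M"
    then show "\<Theta> x = 0" using \<Theta>S x G_S by blast
  qed
  show thesis
  proof (rule that[OF c\<Theta> zero])
    fix p assume p: "p \<in> S" and Np: "N p $ 1 \<noteq> 0"
    have pM: "p \<in> M" using p by (simp add: S_iff)
    obtain r F where F: "side_function p r F" using side_function_exists[OF p] by blast
    have r: "r > 0" and FM: "\<And>x. x \<in> ball p r \<Longrightarrow> x $ 1 > 0 \<and> (x \<in> M \<longleftrightarrow> F x = 0)"
      using F by (auto simp: side_function_def)
    obtain c where c: "c > 0" "(F has_derivative (\<lambda>h. c * sol_inner p (N p) h)) (at p)"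
      using F pM r unfolding side_function_def by (metis IntI centre_in_ball)
    let ?e = "axis 1 1 :: real^3"
    define s0 where "s0 = sgn (N p $ 1)"
    have s0: "s0 * N p $ 1 > 0" "s0 = 1 \<or> s0 = -1" using Np by (auto simp: s0_def sgn_if)
    define \<phi> where "\<phi> t = s0 * F (p + t *\<^sub>R ?e)" for t
    have "((\<lambda>t. p + t *\<^sub>R ?e) has_derivative (\<lambda>t. t *\<^sub>R ?e)) (at 0)" by (auto intro!: derivative_eq_intros)
    moreover have "(F has_derivative (\<lambda>h. c * sol_inner p (N p) h)) (at (p + 0 *\<^sub>R ?e))" using c(2) by simp
    ultimately have "((\<lambda>t. F (p + t *\<^sub>R ?e)) has_derivative (\<lambda>t. c * sol_inner p (N p) (t *\<^sub>R ?e))) (at 0)"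
      by (rule has_derivative_compose)
    then have "(\<phi> has_derivative (\<lambda>t. s0 * (c * sol_inner p (N p) (t *\<^sub>R ?e)))) (at 0)"
      unfolding \<phi>_def by (rule has_derivative_mult_right)
    moreover have "(\<lambda>t. s0 * (c * sol_inner p (N p) (t *\<^sub>R ?e))) = (*) (s0 * (c * (gdiag p 1 * N p $ 1)))"
      by (simp add: fun_eq_iff sol_inner_eq axis_def if_distrib[where f="\<lambda>z. _ * z"] mult_ac cong: if_cong)
    ultimately have der: "(\<phi> has_real_derivative (s0 * (c * (gdiag p 1 * N p $ 1)))) (at 0)"
      by (simp add: has_field_derivative_def)
    have "s0 * (c * (gdiag p 1 * N p $ 1)) = c * gdiag p 1 * (s0 * N p $ 1)" by (simp only: mult_ac)
    also have "\<dots> > 0" by (intro mult_pos_pos c(1) gdiag_pos s0(1))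
    finally have pos: "s0 * (c * (gdiag p 1 * N p $ 1)) > 0" .
    obtain da where da: "da > 0" "\<And>t. 0 < t \<Longrightarrow> t < da \<Longrightarrow> \<phi> 0 < \<phi> (0 + t)" using DERIV_pos_inc_right[OF der pos] by blast
    obtain db where db: "db > 0" "\<And>t. 0 < t \<Longrightarrow> t < db \<Longrightarrow> \<phi> (0 - t) < \<phi> 0" using DERIV_pos_inc_left[OF der pos] by blast
    have \<phi>0: "\<phi> 0 = 0" using FM[of p] r pM by (simp add: \<phi>_def)
    have pG: "p \<in> G" using p SG by blast
    have "\<exists>d>0. \<forall>x\<in>G. dist x p < d \<longrightarrow> dist (\<Theta> x) (\<Theta> p) < pi"
      using c\<Theta> pG pi_gt_zero unfolding continuous_on_iff by blast
    then obtain dc where dc: "dc > 0" "\<And>x. x \<in> G \<Longrightarrow> dist x p < dc \<Longrightarrow> \<bar>\<Theta> x\<bar> < pi" 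
      using \<Theta>S[OF p] by (auto simp: dist_real_def)
    have key: "sgn (\<Theta> x) = sgn (F x)" if x: "dist p x < min dc (r/2)" "F x \<noteq> 0" for x
    proof -
      have xb: "x \<in> ball p r" using x r by auto
      have xM: "x \<notin> M" using FM[OF xb] x(2) by simp
      have xO: "x \<in> O'" using p F x(1) unfolding O'_def by auto
      have xG: "x \<in> G" using xO OG by blast
      have "sin (h x) > 0" using h_strict[OF xO xM] by (rule sin_gt_zero)
      then have "sgn (sin (\<Theta> x)) = sgn (F x)"
        using \<Theta>(2)[OF xG] \<sigma>F(1)[OF F p _ xM] x(1) by (simp add: w_def sgn_mult)
      moreover have "\<bar>\<Theta> x\<bar> < pi" using dc(2)[OF xG] x(1) by (simp add: dist_commute)
      then have "sgn (sin (\<Theta> x)) = sgn (\<Theta> x)"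
        using sin_gt_zero[of "\<Theta> x"] sin_gt_zero[of "- \<Theta> x"] by (cases "\<Theta> x" "0::real" rule: linorder_cases) auto
      ultimately show ?thesis by simp
    qed
    define \<delta> where "\<delta> = min (min da db) (min dc (r/2))"
    show "\<exists>\<delta>>0. \<forall>s. 0 < s \<and> s < \<delta> \<longrightarrow>
        sgn (\<Theta> (p + s *\<^sub>R ?e)) = sgn (N p $ 1) \<and> sgn (\<Theta> (p - s *\<^sub>R ?e)) = - sgn (N p $ 1)"
    proof (intro exI[of _ \<delta>] conjI allI impI)
      show "\<delta> > 0" using da db dc r by (simp add: \<delta>_def)
      fix s assume s: "0 < s \<and> s < \<delta>"
      have "\<phi> s > 0" "\<phi> (- s) < 0" using da(2)[of s] db(2)[of s] s \<phi>0 by (auto simp: \<delta>_def)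
      then have a: "s0 * F (p + s *\<^sub>R ?e) > 0" "s0 * F (p - s *\<^sub>R ?e) < 0" by (simp_all add: \<phi>_def)
      have "dist p (p + s *\<^sub>R ?e) = s" "dist p (p - s *\<^sub>R ?e) = s" using s by (simp_all add: dist_norm)
      then have "sgn (\<Theta> (p + s *\<^sub>R ?e)) = sgn (F (p + s *\<^sub>R ?e))" "sgn (\<Theta> (p - s *\<^sub>R ?e)) = sgn (F (p - s *\<^sub>R ?e))"
        using s a by (auto intro!: key simp: \<delta>_def)
      then show "sgn (\<Theta> (p + s *\<^sub>R ?e)) = sgn (N p $ 1)" "sgn (\<Theta> (p - s *\<^sub>R ?e)) = - sgn (N p $ 1)"
        using a s0(2) unfolding s0_def[symmetric] by auto
    qed
  qed
qed

lemma open_G: "open G"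
proof -
  have "G = {x. x $ 1 > 0} \<union> pr 2 3 -` Ext" by (auto simp: G_def)
  moreover have "open (pr 2 3 -` Ext)" by (intro open_vimage domains(4) continuous_on_pr continuous_on_id)
  ultimately show ?thesis by (simp add: open_Un open_halfspace_component_gt_cart)
qed

text \<open>The crossing function has one sign \<open>\<omega>\<close> at infinity, hence above all points of a column and below the plane
  outside \<open>D\<close>. Descending from infinity its sign changes at the top point of a column and not again before the next
  point; this determines both normals. Over a point of the curve with a single further point above it, the
  sign in between would be \<open>- \<omega>\<close>; but slightly above the curve it is \<open>\<omega>\<close>, as one sees by moving outside \<open>D\<close> and
  descending through the plane.\<close>

lemma columns:
  shows opposite_normals: "\<And>y a b. b > 0 \<Longrightarrow> b < a \<Longrightarrow> pt y a \<in> M \<Longrightarrow> pt y b \<in> M \<Longrightarrow> N (pt y a) $ 1 \<noteq> 0 \<Longrightarrow> N (pt y b) $ 1 \<noteq> 0 \<Longrightarrow>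
      (\<And>s. s > b \<Longrightarrow> s \<noteq> a \<Longrightarrow> pt y s \<notin> M) \<Longrightarrow> N (pt y a) $ 1 * N (pt y b) $ 1 < 0"
    and boundary_column: "\<And>q a. q \<in> C \<Longrightarrow> a > 0 \<Longrightarrow> pt q a \<in> M \<Longrightarrow> N (pt q a) $ 1 \<noteq> 0 \<Longrightarrow>
      (\<And>s. s > 0 \<Longrightarrow> s \<noteq> a \<Longrightarrow> pt q s \<notin> M) \<Longrightarrow> False"
proof -
  obtain \<Theta> where c\<Theta>: "continuous_on G \<Theta>" and zero: "\<And>x. x \<in> G \<Longrightarrow> \<Theta> x = 0 \<longleftrightarrow> x \<in> M"
    and cross: "\<And>p. p \<in> S \<Longrightarrow> N p $ 1 \<noteq> 0 \<Longrightarrow> \<exists>\<delta>>0. \<forall>s. 0 < s \<and> s < \<delta> \<longrightarrow>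
        sgn (\<Theta> (p + s *\<^sub>R axis 1 1)) = sgn (N p $ 1) \<and> sgn (\<Theta> (p - s *\<^sub>R axis 1 1)) = - sgn (N p $ 1)"
    using crossing_function by blast
  have same: "sgn (\<Theta> a) = sgn (\<Theta> b)" if B: "connected B" "B \<subseteq> G" "B \<inter> M = {}" and ab: "a \<in> B" "b \<in> B" for B a b
  proof -
    have nz: "\<Theta> x \<noteq> 0" if "x \<in> B" for x using zero B that by blast
    have cB: "continuous_on B \<Theta>" by (rule continuous_on_subset[OF c\<Theta> B(2)])
    have "\<Theta> a > 0 \<longleftrightarrow> \<Theta> b > 0"
      using connected_positive[OF B(1) cB nz ab(1) _ ab(2)] connected_positive[OF B(1) cB nz ab(2) _ ab(1)] by blast
    then show ?thesis using nz[OF ab(1)] nz[OF ab(2)] by (auto simp: sgn_if)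
  qed
  have line: "connected ((\<lambda>s. pt y s) ` I)" if "connected I" for y I
    by (intro connected_continuous_image that continuous_intros)
  obtain R where R: "\<And>x. x \<in> M \<Longrightarrow> norm x \<le> R"
    using compact_imp_bounded[OF compact] unfolding bounded_iff by blast
  define h1 where "h1 = \<bar>R\<bar> + 1"
  have h1: "h1 > 0" "\<And>x. x \<in> M \<Longrightarrow> x $ 1 < h1"
  proof -
    show "h1 > 0" by (simp add: h1_def)
    show "x $ 1 < h1" if "x \<in> M" for x
      using R[OF that] component_le_norm_cart[of x 1] by (simp add: h1_def)
  qed
  define \<omega> where "\<omega> = sgn (\<Theta> (pt 0 h1))"
  have high: "sgn (\<Theta> (pt y s)) = \<omega>" if "s > 0" "\<And>x. x \<in> M \<Longrightarrow> x $ 1 < s" for y s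
    unfolding \<omega>_def
  proof (rule same)
    have "convex {x::real^3. x $ 1 \<ge> min s h1}"
      using convex_halfspace_ge[of "min s h1" "axis 1 1 :: real^3"] by (simp add: inner_axis')
    then show "connected {x::real^3. x $ 1 \<ge> min s h1}" by (rule convex_connected)
    show "{x. x $ 1 \<ge> min s h1} \<subseteq> G" using that(1) h1(1) by (auto simp: G_def)
    show "{x. x $ 1 \<ge> min s h1} \<inter> M = {}" using that(2) h1(2) by (force simp: min_def)
  qed auto
  have "pt 0 h1 \<in> G" "pt 0 h1 \<notin> M" using h1(1) h1(2)[of "pt 0 h1"] by (auto simp: G_def)
  then have \<omega>: "\<omega> = 1 \<or> \<omega> = -1" using zero[of "pt 0 h1"] by (auto simp: \<omega>_def sgn_if)
  \<comment> \<open>above all points of a column\<close>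
  have above: "sgn (\<Theta> (pt y s)) = \<omega>" if s: "s > 0" "\<And>t. t \<ge> s \<Longrightarrow> pt y t \<notin> M" for y s
  proof -
    have "sgn (\<Theta> (pt y s)) = sgn (\<Theta> (pt y (max s h1)))"
    proof (rule same[OF line[of "{s..}" y]])
      show "(\<lambda>s. pt y s) ` {s..} \<subseteq> G" using s(1) by (auto simp: G_def)
      show "(\<lambda>s. pt y s) ` {s..} \<inter> M = {}" using s(2) by auto
    qed auto
    also have "\<dots> = \<omega>" using h1 by (intro high) force+
    finally show ?thesis .
  qed
  \<comment> \<open>below the plane, outside the domain\<close>
  have below: "sgn (\<Theta> (pt q s)) = \<omega>" if q: "q \<in> Ext" "s < 0" for q s
  proof -
    have "bounded (- Ext \<union> cball 0 R)" using bounded_compl_Ext by simp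
    then have "- Ext \<union> cball 0 R \<noteq> UNIV" using not_bounded_UNIV by metis
    then obtain q1 where q1: "q1 \<in> Ext" "norm q1 > R" by force
    have q1M: "pt q1 t \<notin> M" for t
      using R[of "pt q1 t"] norm_pr_le[OF frame3_231, of "pt q1 t"] q1(2) by auto
    have "sgn (\<Theta> (pt q s)) = sgn (\<Theta> (pt q1 (-1)))"
    proof (rule same)
      show "connected ((\<lambda>z. pt (fst z) (snd z)) ` (Ext \<times> {..<0}))"
        by (intro connected_continuous_image continuous_intros connected_Times domains(6)) auto
      show "(\<lambda>z. pt (fst z) (snd z)) ` (Ext \<times> {..<0}) \<subseteq> G" by (auto simp: G_def)
      show "(\<lambda>z. pt (fst z) (snd z)) ` (Ext \<times> {..<0}) \<inter> M = {}" using M_nonneg by force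
      show "pt q s \<in> (\<lambda>z. pt (fst z) (snd z)) ` (Ext \<times> {..<0})" using q by force
      show "pt q1 (-1) \<in> (\<lambda>z. pt (fst z) (snd z)) ` (Ext \<times> {..<0})" using q1 by force
    qed
    also have "\<dots> = sgn (\<Theta> (pt q1 h1))"
      by (rule same[OF line[of UNIV q1]]) (use q1 q1M in \<open>auto simp: G_def\<close>)
    also have "\<dots> = \<omega>" using h1 by (intro high) auto
    finally show ?thesis .
  qed
  have pt_add: "pt y a + s *\<^sub>R axis 1 1 = pt y (a + s)" "pt y a - s *\<^sub>R axis 1 1 = pt y (a - s)" for y a s
    by (simp_all add: gpt_def algebra_simps)
  \<comment> \<open>the topmost point of a column\<close>
  have top: "sgn (N (pt y a) $ 1) = \<omega> \<and> (\<exists>\<delta>>0. \<forall>s. 0 < s \<and> s < \<delta> \<longrightarrow> sgn (\<Theta> (pt y (a - s))) = - \<omega>)"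
    if a: "a > 0" "pt y a \<in> M" "N (pt y a) $ 1 \<noteq> 0" "\<And>s. s > a \<Longrightarrow> pt y s \<notin> M" for y a
  proof -
    have "pt y a \<in> S" using a by (simp add: S_iff)
    from cross[OF this a(3)] obtain \<delta> where \<delta>: "\<delta> > 0" "\<And>s. 0 < s \<Longrightarrow> s < \<delta> \<Longrightarrow>
        sgn (\<Theta> (pt y (a + s))) = sgn (N (pt y a) $ 1) \<and> sgn (\<Theta> (pt y (a - s))) = - sgn (N (pt y a) $ 1)"
      unfolding pt_add by blast
    have "sgn (\<Theta> (pt y (a + \<delta>/2))) = \<omega>" using a \<delta>(1) by (intro above) auto
    then have "sgn (N (pt y a) $ 1) = \<omega>" using \<delta>(2)[of "\<delta>/2"] \<delta>(1) by simp
    then show ?thesis using \<delta> by auto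
  qed
  show "N (pt y a) $ 1 * N (pt y b) $ 1 < 0"
    if ab: "b > 0" "b < a" "pt y a \<in> M" "pt y b \<in> M" "N (pt y a) $ 1 \<noteq> 0" "N (pt y b) $ 1 \<noteq> 0"
      "\<And>s. s > b \<Longrightarrow> s \<noteq> a \<Longrightarrow> pt y s \<notin> M" for y a b
  proof -
    have "\<And>s. s > a \<Longrightarrow> pt y s \<notin> M" using ab(2,7) by auto
    from top[OF _ ab(3,5) this] ab obtain \<delta> where \<delta>: "sgn (N (pt y a) $ 1) = \<omega>" "\<delta> > 0"
      "\<And>s. 0 < s \<Longrightarrow> s < \<delta> \<Longrightarrow> sgn (\<Theta> (pt y (a - s))) = - \<omega>" by auto
    have "pt y b \<in> S" using ab by (simp add: S_iff)
    from cross[OF this ab(6)] obtain \<delta>' where \<delta>': "\<delta>' > 0"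
      "\<And>s. 0 < s \<Longrightarrow> s < \<delta>' \<Longrightarrow> sgn (\<Theta> (pt y (b + s))) = sgn (N (pt y b) $ 1)"
      unfolding pt_add by blast
    define s s' where "s = min \<delta> (a - b) / 2" and "s' = min \<delta>' (a - b) / 2"
    have s: "0 < s" "s < \<delta>" "s < a - b" "0 < s'" "s' < \<delta>'" "s' < a - b" using \<delta> \<delta>' ab(2) by (auto simp: s_def s'_def)
    have "sgn (\<Theta> (pt y (a - s))) = sgn (\<Theta> (pt y (b + s')))"
      by (rule same[OF line[of "{b<..<a}" y]]) (use ab s in \<open>auto simp: G_def\<close>)
    then have "sgn (N (pt y b) $ 1) = - \<omega>" using \<delta>(3)[of s] \<delta>'(2)[of s'] s by simp
    then have "sgn (N (pt y a) $ 1 * N (pt y b) $ 1) = -1" using \<delta>(1) \<omega> by (auto simp: sgn_mult)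
    then show ?thesis by (metis sgn_1_neg)
  qed
  show False if q: "q \<in> C" and a: "a > 0" "pt q a \<in> M" "N (pt q a) $ 1 \<noteq> 0" "\<And>s. s > 0 \<Longrightarrow> s \<noteq> a \<Longrightarrow> pt q s \<notin> M" for q a
  proof -
    have "\<And>s. s > a \<Longrightarrow> pt q s \<notin> M" using a by auto
    from top[OF a(1,2,3) this] obtain \<delta> where \<delta>: "\<delta> > 0"
      "\<And>s. 0 < s \<Longrightarrow> s < \<delta> \<Longrightarrow> sgn (\<Theta> (pt q (a - s))) = - \<omega>" by auto
    obtain \<epsilon> where \<epsilon>: "\<epsilon> > 0" "\<And>x. x \<in> M \<Longrightarrow> dist x (pt q 0) < \<epsilon> \<Longrightarrow> x \<in> V" using near_boundary[OF q] by blast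
    define s0 where "s0 = min a \<epsilon> / 2"
    have s0: "0 < s0" "s0 < a" "s0 < \<epsilon>" "s0 \<le> \<epsilon> / 2" using a \<epsilon> by (auto simp: s0_def)
    have "sgn (\<Theta> (pt q s0)) = sgn (\<Theta> (pt q (a - min \<delta> a / 2)))"
      by (rule same[OF line[of "{0<..<a}" q]]) (use a s0 \<delta>(1) in \<open>auto simp: G_def\<close>)
    also have "\<dots> = - \<omega>" using \<delta>(1) a(1) by (intro \<delta>(2)) auto
    finally have neg: "sgn (\<Theta> (pt q s0)) = - \<omega>" .
    have qG: "pt q s0 \<in> G - M" using s0 a(4) by (simp add: G_def)
    have "open (G - M)" using open_G compact_imp_closed[OF compact] by (rule open_Diff)
    then obtain d where d: "d > 0" "ball (pt q s0) d \<subseteq> G - M" using qG open_contains_ball by meson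
    have "min d (\<epsilon>/2) > 0" using d \<epsilon> by simp
    then obtain q' where q': "q' \<in> Ext" "dist q' q < min d (\<epsilon>/2)"
      using C_subset_closure_Ext q closure_approachable by blast
    have "dist (pt q s0) (pt q' s0) < d" using dist_pt[of q s0 q' s0] q'(2) by (simp add: dist_commute)
    then have "sgn (\<Theta> (pt q s0)) = sgn (\<Theta> (pt q' s0))"
      by (intro same[OF connected_ball[of "pt q s0" d]]) (use d in auto)
    also have "\<dots> = sgn (\<Theta> (pt q' (-1)))"
    proof (rule same[OF line[of "{-1..s0}" q']])
      show "(\<lambda>s. pt q' s) ` {-1..s0} \<subseteq> G" using q'(1) by (auto simp: G_def)
      have "pt q' t \<notin> M" if t: "t \<in> {-1..s0}" for t
      proof
        assume m: "pt q' t \<in> M"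
        then have "t \<ge> 0" using M_nonneg by force
        then have "dist (pt q' t) (pt q 0) < \<epsilon>" using dist_pt[of q' t q 0] q'(2) t s0(4) by auto
        then have "q' \<in> A" using \<epsilon>(2)[OF m] by (simp add: V_iff)
        then show False using A_subset(1) q'(1) Ext_iff by blast
      qed
      then show "(\<lambda>s. pt q' s) ` {-1..s0} \<inter> M = {}" by auto
    qed (use s0 in auto)
    also have "\<dots> = \<omega>" by (rule below[OF q'(1)]) simp
    finally show False using neg \<omega> by auto
  qed
qed

end

context surface_over_domain
begin

section \<open>Moving the reflection plane\<close>

text \<open>The diagonal part makes the set compact at positive heights: two sheets can merge only where the tangent
  plane contains the \<open>x\<close>-direction.\<close>

definition reflection_pairs :: "((real^3) \<times> (real^3)) set" where
  "reflection_pairs = {(p, p'). p \<in> M \<and> p' \<in> M \<and> pr 2 3 p = pr 2 3 p' \<and> p' $ 1 < p $ 1}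
     \<union> {(p, p') . p = p' \<and> p \<in> S \<and> N p $ 1 = 0}"

definition bounds_pairs :: "real \<Rightarrow> bool" where
  "bounds_pairs T \<longleftrightarrow> T > 0 \<and> (\<forall>(p, p')\<in>reflection_pairs. p $ 1 + p' $ 1 \<le> 2 * T)"

lemma maximal_pair:
  assumes "reflection_pairs \<noteq> {}"
  obtains T p p' where "bounds_pairs T" "(p, p') \<in> reflection_pairs" "p $ 1 + p' $ 1 = 2 * T"
proof -
  have pos: "p $ 1 + p' $ 1 > 0" if "(p, p') \<in> reflection_pairs" for p p'
    using that M_nonneg[of p'] by (auto simp: reflection_pairs_def S_iff)
  define K where "K = {z. pr 2 3 (fst z) = pr 2 3 (snd z)} \<inter> {z::(real^3)\<times>(real^3). snd z $ 1 \<le> fst z $ 1} \<inter> (M \<times> M)"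
  have "closed {z. pr 2 3 (fst z) = pr 2 3 (snd z)}"
    by (intro closed_Collect_eq continuous_on_pr continuous_intros)
  moreover have "closed {z::(real^3)\<times>(real^3). snd z $ 1 \<le> fst z $ 1}"
    by (intro closed_Collect_le continuous_intros)
  ultimately have cK: "compact K" unfolding K_def
    by (intro closed_Int_compact closed_Int compact_Times compact)
  have sub: "reflection_pairs \<subseteq> K" by (auto simp: reflection_pairs_def K_def S_iff)
  then have clK: "closure reflection_pairs \<subseteq> K" using cK by (simp add: closure_minimal compact_imp_closed)
  then have "compact (closure reflection_pairs)"
    by (intro compact_eq_bounded_closed[THEN iffD2] conjI closed_closure bounded_subset[OF compact_imp_bounded[OF cK]])
  moreover have "continuous_on (closure reflection_pairs) (\<lambda>z. fst z $ 1 + snd z $ 1)" by (intro continuous_intros)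
  ultimately obtain z where z: "z \<in> closure reflection_pairs"
    "\<forall>z'\<in>closure reflection_pairs. fst z' $ 1 + snd z' $ 1 \<le> fst z $ 1 + snd z $ 1"
    using continuous_attains_sup[of "closure reflection_pairs" "\<lambda>z. fst z $ 1 + snd z $ 1"] assms by auto
  obtain p p' where pp: "z = (p, p')" by (cases z)
  have max: "a $ 1 + b $ 1 \<le> p $ 1 + p' $ 1" if "(a, b) \<in> reflection_pairs" for a b
    using z(2) that closure_subset[of reflection_pairs] unfolding pp by force
  have K: "p \<in> M" "p' \<in> M" "pr 2 3 p = pr 2 3 p'" "p' $ 1 \<le> p $ 1" using z(1) clK unfolding pp K_def by auto
  obtain a b where ab: "(a, b) \<in> reflection_pairs" using assms by auto
  have s0: "p $ 1 + p' $ 1 > 0" using max[OF ab] pos[OF ab] by linarith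
  have mem: "(p, p') \<in> reflection_pairs"
  proof (cases "p' $ 1 < p $ 1")
    case True
    then show ?thesis using K by (simp add: reflection_pairs_def)
  next
    case False
    then have eq: "p = p'" using K by (intro pt_eqI) auto
    have pS: "p \<in> S" using s0 K(1) by (simp add: eq S_iff)
    have "N p $ 1 = 0"
    proof (rule ccontr)
      assume "N p $ 1 \<noteq> 0"
      then obtain r e f where lg: "local_graph M 2 3 1 p r e f"
        using interior_local_graph[OF pS frame3_231 _ zero_less_one] by blast
      note d = local_graphD[OF lg]
      define \<rho> where "\<rho> = min r e"
      have "\<rho> > 0" using d by (simp add: \<rho>_def)
      then obtain z' where z': "z' \<in> reflection_pairs" "dist z' z < \<rho>"
        using z(1) unfolding closure_approachable by blast
      obtain a b where ab: "z' = (a, b)" by (cases z')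
      have "dist a p \<le> dist z' z" "dist b p \<le> dist z' z"
        unfolding ab pp eq using dist_fst_le[of "(a,b)" "(p',p')"] dist_snd_le[of "(a,b)" "(p',p')"] by auto
      then have close: "dist a p < \<rho>" "dist b p < \<rho>" using z'(2) by auto
      have cyl: "pr 2 3 x \<in> ball (pr 2 3 p) r" "\<bar>x $ 1 - p $ 1\<bar> < e" if "dist x p < \<rho>" for x
        using that dist_pr_le[OF frame3_231, of x p] component_le_norm_cart[of "x - p" 1] norm_minus_commute[of x p]
        by (auto simp: \<rho>_def dist_commute dist_norm)
      have abM: "a \<in> M" "b \<in> M" "pr 2 3 a = pr 2 3 b" using z'(1) sub unfolding ab K_def by auto
      have a1: "a $ 1 = f (pr 2 3 a)" using d(5)[OF cyl[OF close(1)]] abM by simp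
      have b1: "b $ 1 = f (pr 2 3 b)" using d(5)[OF cyl[OF close(2)]] abM by simp
      then have "N a $ 1 = 0" using z'(1) a1 abM(3) unfolding ab reflection_pairs_def by auto
      moreover have "pt (pr 2 3 a) (f (pr 2 3 a)) = a" using a1 pt_pr[of a] by simp
      ultimately show False using local_graph_normal(2)[OF cmc frame3_231 lg cyl(1)[OF close(1)]] by simp
    qed
    then show ?thesis using eq pS by (simp add: reflection_pairs_def)
  qed
  define T where "T = (p $ 1 + p' $ 1) / 2"
  have "2 * T = p $ 1 + p' $ 1" by (simp add: T_def)
  then have "bounds_pairs T" unfolding bounds_pairs_def using max s0 by auto
  then show thesis using that[OF _ mem] by (simp add: T_def)
qed

context
  fixes T :: real
  assumes T: "bounds_pairs T"
begin

lemma T_pos: "T > 0" using T by (simp add: bounds_pairs_def)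

lemma pairs_le: "(p, p') \<in> reflection_pairs \<Longrightarrow> p $ 1 + p' $ 1 \<le> 2 * T"
  using T unfolding bounds_pairs_def by blast

lemma pair_bound: "pt y a \<in> M \<Longrightarrow> pt y b \<in> M \<Longrightarrow> b < a \<Longrightarrow> a + b \<le> 2 * T"
  using pairs_le[of "pt y a" "pt y b"] by (simp add: reflection_pairs_def)

lemma pair_bound': "x \<in> M \<Longrightarrow> x' \<in> M \<Longrightarrow> pr 2 3 x = pr 2 3 x' \<Longrightarrow> x' $ 1 < x $ 1 \<Longrightarrow> x $ 1 + x' $ 1 \<le> 2 * T"
  using pair_bound pt_pr by metis

lemma vertical_bound: "p \<in> S \<Longrightarrow> N p $ 1 = 0 \<Longrightarrow> p $ 1 \<le> T"
  using pairs_le[of p p] by (simp add: reflection_pairs_def)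

text \<open>By the bound on pairs such a point would be the only one of positive height in its column, and the tangent
  plane there would not contain the \<open>x\<close>-direction.\<close>

lemma no_high_boundary_column:
  assumes q: "q \<in> C" shows "pt q (2 * T) \<notin> M"
proof
  assume m: "pt q (2 * T) \<in> M"
  have "pt q (2 * T) \<in> S" using m T_pos by (simp add: S_iff)
  then have "N (pt q (2 * T)) $ 1 \<noteq> 0" using vertical_bound T_pos by force
  moreover have "pt q s \<notin> M" if "s > 0" "s \<noteq> 2 * T" for s
  proof
    assume s: "pt q s \<in> M"
    show False
    proof (cases "s < 2 * T")
      case True
      then show False using pair_bound[OF m s] that by simp
    next
      case False
      then show False using pair_bound[OF s m] that T_pos by simp
    qed
  qed
  ultimately show False using boundary_column[OF q _ m] T_pos by simp
qed

text \<open>By the bound on pairs, the surface near \<open>pt y b\<close> lies below the mirror image of the upper sheet. Its tangent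
  plane at \<open>pt y b\<close> cannot contain the \<open>x\<close>-direction: a curve in the surface leaving \<open>pt y b\<close> in this direction
  would violate the bound to first order. Then \<open>contact_interior\<close> applies.\<close>

lemma contact_pair:
  assumes b: "b > 0" "b < a" and m: "pt y a \<in> M" "pt y b \<in> M" and sum: "a + b = 2 * T"
  obtains \<delta> where "\<delta> > 0" "\<And>x. x \<in> M \<Longrightarrow> dist x (pt y a) < \<delta> \<or> dist x (pt y b) < \<delta> \<Longrightarrow> mirror T x \<in> M"
proof -
  define \<epsilon> where "\<epsilon> = (a - b) / 4"
  have \<epsilon>: "\<epsilon> > 0" using b by (simp add: \<epsilon>_def)
  have aT: "a > T" using b sum by simp
  have S: "pt y a \<in> S" "pt y b \<in> S" using b m by (auto simp: S_iff)
  have Na: "N (pt y a) $ 1 \<noteq> 0" using vertical_bound[OF S(1)] aT by force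
  obtain r e f where lga: "local_graph M 2 3 1 (pt y a) r e f" and re: "e < \<epsilon>"
    using interior_local_graph[OF S(1) frame3_231 Na \<epsilon>] by blast
  note da = local_graphD[OF lga, simplified]
  have fy: "f y = a" using local_graph_center[OF lga m(1)] by simp
  have fM: "pt v (f v) \<in> M" if "dist y v < r" for v using local_graph_mem[OF frame3_231 lga, of v] that by simp
  have below: "f (pr 2 3 x) + x $ 1 \<le> 2 * T" if x: "x \<in> M" "dist y (pr 2 3 x) < r" "\<bar>x $ 1 - b\<bar> < \<epsilon>" for x
  proof -
    have "\<bar>f (pr 2 3 x) - a\<bar> < \<epsilon>" using da(4)[OF x(2)] re by simp
    moreover have "4 * \<epsilon> = a - b" by (simp add: \<epsilon>_def)
    ultimately have "x $ 1 < f (pr 2 3 x)" using x(3) b(2) by (auto simp: abs_less_iff)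
    then show ?thesis using pair_bound'[OF fM[OF x(2)] x(1)] by simp
  qed
  have Nb: "N (pt y b) $ 1 \<noteq> 0"
  proof
    assume Nb0: "N (pt y b) $ 1 = 0"
    obtain k where k: "N (pt y b) $ k \<noteq> 0" using N_nonzero[OF m(2)] by blast
    then have "k \<noteq> 1" using Nb0 by auto
    then obtain j where fr: "frame3 1 j k" using exhaust_3[of k] by (auto simp: frame3_def intro: that[of 2] that[of 3])
    obtain r' e' g where lg: "local_graph M 1 j k (pt y b) r' e' g"
      using interior_local_graph[OF S(2) fr k zero_less_one] by blast
    note d = local_graphD[OF lg]
    define v0 where "v0 = pr 1 j (pt y b)"
    have v0: "v0 \<in> ball (pr 1 j (pt y b)) r'" using d(1) by (simp add: v0_def)
    have gp: "gpt 1 j k v0 (g v0) = pt y b"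
      using local_graph_center[OF lg m(2)] gpt_pr[OF fr, of "pt y b"] by (simp add: v0_def)
    have g1: "partial 1 g v0 = 0"
      using local_graph_normal(1)[OF cmc fr lg v0, of 1] Nb0 k gdiag_pos[of "pt y b" k]
      by (simp add: gp cvec_nth[OF fr])
    define X where "X t = gpt 1 j k (v0 + t *\<^sub>R axis 1 1) (g (v0 + t *\<^sub>R axis 1 1))" for t
    have X0: "X 0 = pt y b" by (simp add: X_def gp)
    have dl: "((\<lambda>t. v0 + t *\<^sub>R axis 1 1) has_derivative (\<lambda>t. t *\<^sub>R axis 1 (1::real))) (at 0)"
      by (auto intro!: derivative_eq_intros)
    have "(g has_derivative (\<lambda>h. partial 1 g v0 * h $ 1 + partial 2 g v0 * h $ 2)) (at (v0 + 0 *\<^sub>R axis 1 1))"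
      using smooth_partials(1)[OF open_ball d(3) v0] by simp
    from has_derivative_compose[OF dl has_derivative_gpt[OF this, of 1 j k]]
    have dX: "(X has_derivative (\<lambda>t. t *\<^sub>R axis 1 1)) (at 0)"
      unfolding X_def by (simp add: g1 gpt_def axis_def)
    have dpX: "((\<lambda>t. pr 2 3 (X t)) has_derivative (\<lambda>t. 0)) (at 0)"
    proof -
      have "pr 2 3 (t *\<^sub>R axis 1 1) = 0" for t by (simp add: vec_eq_iff forall_2 axis_def)
      then show ?thesis using bounded_linear.has_derivative[OF bounded_linear_pr[of 2 3] dX] by simp
    qed
    have "y \<in> ball y r" using da(1) by simp
    then have "(f has_derivative (\<lambda>h. partial 1 f y * h $ 1 + partial 2 f y * h $ 2)) (at (pr 2 3 (X 0)))"
      using smooth_partials(1)[OF open_ball da(3)] by (simp add: X0)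
    from has_derivative_compose[OF dpX this]
    have "((\<lambda>t. f (pr 2 3 (X t))) has_derivative (\<lambda>t. 0)) (at 0)" by simp
    moreover have "((\<lambda>t. X t $ 1) has_derivative (\<lambda>t. t)) (at 0)"
      using bounded_linear.has_derivative[OF bounded_linear_vec_nth[of 1] dX] by (simp add: axis_def)
    ultimately have "((\<lambda>t. f (pr 2 3 (X t)) + X t $ 1) has_derivative (\<lambda>t. 0 + t)) (at 0)"
      by (rule has_derivative_add)
    then have der: "((\<lambda>t. f (pr 2 3 (X t)) + X t $ 1) has_real_derivative 1) (at 0)"
      unfolding has_field_derivative_def by (simp add: mult_1[abs_def])
    obtain d1 where d1: "d1 > 0" "\<And>t. 0 < t \<Longrightarrow> t < d1 \<Longrightarrow> 2 * T < f (pr 2 3 (X t)) + X t $ 1"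
      using DERIV_pos_inc_right[OF der] fy sum by (auto simp: X0)
    have "isCont X 0" using dX has_derivative_continuous by blast
    then obtain d2 where d2: "d2 > 0" "\<And>t. dist t 0 < d2 \<Longrightarrow> dist (X t) (X 0) < min r \<epsilon>"
      using da(1) \<epsilon> unfolding continuous_at_eps_delta by (metis min_less_iff_conj)
    define t where "t = min (min d1 d2) r' / 2"
    have t: "0 < t" "t < d1" "t < d2" "t < r'" using d1 d2 d(1) by (auto simp: t_def)
    have "dist v0 (v0 + t *\<^sub>R axis 1 1) < r'" using t by (simp add: dist_norm)
    then have XM: "X t \<in> M" unfolding X_def by (intro local_graph_mem[OF fr lg]) (simp add: v0_def)
    have "dist (X t) (pt y b) < min r \<epsilon>" using d2(2)[of t] t by (simp add: X0)
    then have "dist y (pr 2 3 (X t)) < r" "\<bar>X t $ 1 - b\<bar> < \<epsilon>"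
      using dist_pr_le[OF frame3_231, of "X t" "pt y b"] component_le_norm_cart[of "X t - pt y b" 1]
      by (auto simp: dist_commute dist_norm)
    from below[OF XM this] d1(2)[OF t(1,2)] show False by simp
  qed
  have opp: "N (pt y a) $ 1 * N (pt y b) $ 1 < 0"
  proof (rule opposite_normals[OF b m Na Nb])
    fix s assume s: "s > b" "s \<noteq> a"
    show "pt y s \<notin> M"
    proof
      assume "pt y s \<in> M"
      then show False using pair_bound[OF _ m(2) s(1)] pair_bound[OF m(1), of s] s sum by (cases "s < a") auto
    qed
  qed
  obtain r' e' g where lgb: "local_graph M 2 3 1 (pt y b) r' e' g" and re': "e' < \<epsilon>"
    using interior_local_graph[OF S(2) frame3_231 Nb \<epsilon>] by blast
  note db = local_graphD[OF lgb, simplified]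
  have gM: "pt v (g v) \<in> M" if "dist y v < r'" for v using local_graph_mem[OF frame3_231 lgb, of v] that by simp
  have "\<exists>\<delta>>0. \<forall>v\<in>ball (pr 2 3 (pt y a)) \<delta>. f v + g v = 2 * T"
  proof (rule contact_interior[OF cmc m(1) lga m(2) lgb])
    show "min r r' > 0" using da db by simp
    fix v assume "v \<in> ball (pr 2 3 (pt y a)) (min r r')"
    then have v: "dist y v < r" "dist y v < r'" by auto
    show "f v + g v \<le> 2 * T" using below[OF gM[OF v(2)]] v db(4)[OF v(2)] re' by simp
  qed (use sum opp in auto)
  then obtain \<delta> where \<delta>: "\<delta> > 0" "\<And>v. dist y v < \<delta> \<Longrightarrow> f v + g v = 2 * T" by auto
  define d where "d = min (min \<delta> (min r r')) (min e e')"
  show thesis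
  proof (rule that[of d])
    show "d > 0" using \<delta> da db by (simp add: d_def)
    fix x assume x: "x \<in> M" and dx: "dist x (pt y a) < d \<or> dist x (pt y b) < d"
    have mp: "mirror T x = pt (pr 2 3 x) (2 * T - x $ 1)"
      by (rule pt_eqI) (simp_all add: vec_eq_iff forall_2 mirror_nth)
    from dx show "mirror T x \<in> M"
    proof
      assume "dist x (pt y a) < d"
      then have c: "dist y (pr 2 3 x) < d" "\<bar>x $ 1 - a\<bar> < d"
        using dist_pr_le[OF frame3_231, of x "pt y a"] component_le_norm_cart[of "x - pt y a" 1]
        by (auto simp: dist_commute dist_norm)
      then have "x $ 1 = f (pr 2 3 x)" using da(5)[of x] x by (simp add: d_def)
      then have "2 * T - x $ 1 = g (pr 2 3 x)" using \<delta>(2)[of "pr 2 3 x"] c(1) by (simp add: d_def)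
      then show ?thesis unfolding mp using gM[of "pr 2 3 x"] c(1) by (simp add: d_def)
    next
      assume "dist x (pt y b) < d"
      then have c: "dist y (pr 2 3 x) < d" "\<bar>x $ 1 - b\<bar> < d"
        using dist_pr_le[OF frame3_231, of x "pt y b"] component_le_norm_cart[of "x - pt y b" 1]
        by (auto simp: dist_commute dist_norm)
      then have "x $ 1 = g (pr 2 3 x)" using db(5)[of x] x by (simp add: d_def)
      then have "2 * T - x $ 1 = f (pr 2 3 x)" using \<delta>(2)[of "pr 2 3 x"] c(1) by (simp add: d_def)
      then show ?thesis unfolding mp using fM[of "pr 2 3 x"] c(1) by (simp add: d_def)
    qed
  qed
qed

text \<open>Above the mirror no tangent plane contains the \<open>x\<close>-direction, so the graph function is strictly monotone in \<open>x\<close>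
  there. If it failed to dominate its mirror image, the intermediate value theorem would produce two points in a
  column with midpoint above the mirror.\<close>

lemma contact_vertical_point:
  assumes p: "p \<in> S" "p $ 1 = T" "N p $ 1 = 0"
  obtains \<delta> where "\<delta> > 0" "\<And>x. x \<in> M \<Longrightarrow> dist x p < \<delta> \<Longrightarrow> mirror T x \<in> M"
    "\<And>x. x \<in> M \<Longrightarrow> dist x p < \<delta> \<Longrightarrow> x $ 1 = T \<Longrightarrow> N x $ 1 = 0"
proof -
  have pM: "p \<in> M" using p by (simp add: S_iff)
  obtain k where k: "N p $ k \<noteq> 0" using N_nonzero[OF pM] by blast
  then have "k \<noteq> 1" using p by auto
  then obtain j where fr: "frame3 1 j k" using exhaust_3[of k] by (auto simp: frame3_def intro: that[of 2] that[of 3])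
  have jk: "j \<noteq> 1" "k \<noteq> 1" "j \<noteq> k" using fr by (auto simp: frame3_def)
  obtain r e f where lg: "local_graph M 1 j k p r e f"
    using interior_local_graph[OF p(1) fr k zero_less_one] by blast
  note d = local_graphD[OF lg]
  define v0 where "v0 = pr 1 j p"
  let ?B = "ball v0 r"
  have v01: "v0 $ 1 = T" using p by (simp add: v0_def)
  have rv0: "mirror2 T v0 = v0" using v01 by (simp add: vec_eq_iff forall_2)
  have inb: "mirror2 T v \<in> ball v0 \<rho> \<longleftrightarrow> v \<in> ball v0 \<rho>" for v \<rho>
    using dist_mirror2[of T v0 v] by (simp add: rv0)
  have fM: "gpt 1 j k v (f v) \<in> M" if "v \<in> ?B" for v
    using local_graph_mem[OF fr lg] that by (simp add: v0_def)
  have fs: "smooth_on ?B f" using d(3) by (simp add: v0_def)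
  have normal_iff: "N (gpt 1 j k v (f v)) $ 1 = 0 \<longleftrightarrow> partial 1 f v = 0" if v: "v \<in> ?B" for v
  proof -
    have v': "v \<in> ball (pr 1 j p) r" using v by (simp add: v0_def)
    let ?x = "gpt 1 j k v (f v)"
    have "gdiag ?x 1 * N ?x $ 1 = gdiag ?x k * N ?x $ k * (- partial 1 f v)"
      using local_graph_normal(1)[OF cmc fr lg v', of 1] by (simp add: cvec_nth[OF fr])
    moreover have "N ?x $ k \<noteq> 0" by (rule local_graph_normal(2)[OF cmc fr lg v'])
    ultimately show ?thesis using gdiag_pos[of ?x k] gdiag_pos[of ?x 1]
      by (metis mult_eq_0_iff neg_equal_0_iff_equal less_irrefl)
  qed
  define Hf where "Hf = ?B \<inter> {v. v $ 1 > T}"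
  have f1: "partial 1 f v \<noteq> 0" if "v \<in> Hf" for v
  proof -
    have v: "v \<in> ?B" "v $ 1 > T" using that by (auto simp: Hf_def)
    have "gpt 1 j k v (f v) $ 1 = v $ 1" using fr by simp
    then have "gpt 1 j k v (f v) \<in> S" using fM[OF v(1)] v(2) T_pos by (simp add: S_iff)
    then have "N (gpt 1 j k v (f v)) $ 1 \<noteq> 0" using vertical_bound v(2) fr by force
    then show ?thesis using normal_iff[OF v(1)] by simp
  qed
  have "convex {v::real^2. v $ 1 > T}"
    using convex_halfspace_gt[of T "axis 1 1 :: real^2"] by (simp add: inner_axis')
  then have cH: "connected Hf" unfolding Hf_def by (intro convex_connected convex_Int convex_ball)
  define v1 where "v1 = v0 + (r/2) *\<^sub>R axis 1 1"
  have "dist v0 v1 < r" using d(1) by (simp add: v1_def dist_norm)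
  moreover have "v1 $ 1 > T" using d(1) v01 by (simp add: v1_def axis_def)
  ultimately have v1: "v1 \<in> Hf" by (simp add: Hf_def)
  define \<sigma> where "\<sigma> = - sgn (partial 1 f v1)"
  have \<sigma>: "\<sigma>\<^sup>2 = 1" "- \<sigma> * partial 1 f v1 > 0" using f1[OF v1] by (auto simp: \<sigma>_def sgn_if power2_eq_square)
  have \<sigma>f: "\<sigma> * partial 1 f v < 0" if "v \<in> Hf" for v
  proof -
    have "continuous_on Hf (partial 1 f)"
      by (rule continuous_on_subset[OF smooth_on_continuous[OF smooth_on_partial[OF fs]]]) (simp add: Hf_def)
    then have "continuous_on Hf (\<lambda>v. - \<sigma> * partial 1 f v)" by (intro continuous_intros)
    moreover have "- \<sigma> * partial 1 f v \<noteq> 0" if "v \<in> Hf" for v using f1[OF that] \<sigma>(1) by auto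
    ultimately have "- \<sigma> * partial 1 f v > 0"
      using connected_positive[where \<phi> = "\<lambda>v. - \<sigma> * partial 1 f v", OF cH _ _ v1 \<sigma>(2) that] by blast
    then show ?thesis by simp
  qed
  have le: "\<sigma> * f v \<le> \<sigma> * f (mirror2 T v)" if v: "v \<in> ?B" "v $ 1 > T" for v
  proof (rule ccontr)
    assume "\<not> \<sigma> * f v \<le> \<sigma> * f (mirror2 T v)"
    then have gt: "\<sigma> * f v > \<sigma> * f (mirror2 T v)" by simp
    define \<gamma> where "\<gamma> t = v + (t - v $ 1) *\<^sub>R axis 1 1" for t
    have \<gamma>nth: "\<gamma> t $ 1 = t" "\<gamma> t $ 2 = v $ 2" for t by (simp_all add: \<gamma>_def axis_def)
    have \<gamma>e: "\<gamma> (v $ 1) = v" "\<gamma> (2 * T - v $ 1) = mirror2 T v" by (simp_all add: vec_eq_iff forall_2 \<gamma>nth)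
    have \<gamma>B: "\<gamma> t \<in> ?B" if t: "2 * T - v $ 1 \<le> t" "t \<le> v $ 1" for t
    proof -
      define s where "s = (v $ 1 - t) / (2 * (v $ 1 - T))"
      have s: "0 \<le> s" "s \<le> 1" using t v(2) by (auto simp: s_def)
      have "s * (2 * (v $ 1 - T)) = v $ 1 - t" using v(2) by (simp add: s_def)
      then have "\<gamma> t = (1 - s) *\<^sub>R v + s *\<^sub>R mirror2 T v"
        by (simp add: vec_eq_iff forall_2 \<gamma>nth algebra_simps)
      moreover have "mirror2 T v \<in> ?B" using inb v(1) by blast
      ultimately show ?thesis using convexD_alt[OF convex_ball v(1) _ s] by simp
    qed
    define h where "h t = \<sigma> * f (\<gamma> t)" for t
    have dh: "(h has_real_derivative (\<sigma> * partial 1 f (\<gamma> t))) (at t)" if t: "2 * T - v $ 1 \<le> t" "t \<le> v $ 1" for t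
    proof -
      have "(\<gamma> has_derivative (\<lambda>s. s *\<^sub>R axis 1 1)) (at t)"
        unfolding \<gamma>_def by (auto intro!: derivative_eq_intros)
      from has_derivative_compose[OF this smooth_partials(1)[OF open_ball fs \<gamma>B[OF t]]]
      have "((\<lambda>t. f (\<gamma> t)) has_derivative (\<lambda>s. partial 1 f (\<gamma> t) * s)) (at t)" by (simp add: axis_def)
      then have "((\<lambda>t. f (\<gamma> t)) has_real_derivative partial 1 f (\<gamma> t)) (at t)" by (simp add: has_field_derivative_def)
      then show ?thesis unfolding h_def by (intro DERIV_cmult)
    qed
    obtain z where z: "T < z" "z < v $ 1" "h (v $ 1) - h T = (v $ 1 - T) * (\<sigma> * partial 1 f (\<gamma> z))"
      using MVT2[OF v(2), of h "\<lambda>t. \<sigma> * partial 1 f (\<gamma> t)"] dh v(2) by auto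
    have "\<gamma> z \<in> Hf" using \<gamma>B[of z] z(1,2) v(2) by (simp add: Hf_def \<gamma>nth)
    from \<sigma>f[OF this] have "h (v $ 1) < h T" using z(3) v(2) by (smt (verit) mult_pos_neg)
    moreover have "h (2 * T - v $ 1) < h (v $ 1)" using gt by (simp add: h_def \<gamma>e)
    moreover have "isCont h t" if "2 * T - v $ 1 \<le> t" "t \<le> T" for t
      using dh[of t] that v(2) by (intro DERIV_isCont) auto
    ultimately obtain x' where x': "2 * T - v $ 1 \<le> x'" "x' \<le> T" "h x' = h (v $ 1)"
      using IVT[of h "2 * T - v $ 1" "h (v $ 1)" T] v(2) by auto
    have "x' \<noteq> 2 * T - v $ 1" using x'(3) gt by (auto simp: h_def \<gamma>e)
    then have x'1: "2 * T - v $ 1 < x'" using x'(1) by simp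
    have ff: "f (\<gamma> x') = f v" using x'(3) \<sigma>(1) by (auto simp: h_def \<gamma>e)
    let ?x = "gpt 1 j k v (f v)" and ?y = "gpt 1 j k (\<gamma> x') (f (\<gamma> x'))"
    have M2: "?x \<in> M" "?y \<in> M" using fM v(1) \<gamma>B[of x'] x' v(2) by auto
    have "?x $ l = ?y $ l" if "l \<noteq> 1" for l
      using frame3_cases[OF fr, of l] that fr by (auto simp: \<gamma>nth ff)
    then have "pr 2 3 ?x = pr 2 3 ?y" by (simp add: vec_eq_iff forall_2)
    from pair_bound'[OF M2 this] fr x'1 x'(2) v(2) show False by (simp add: \<gamma>nth)
  qed
  have "\<exists>\<delta>>0. \<forall>v\<in>ball (pr 1 j p) \<delta>. f v = f (mirror2 T v)"
    by (rule contact_vertical[OF cmc fr pM lg p(2,3) \<sigma>(1) d(1)]) (use le in \<open>simp add: v0_def\<close>)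
  then obtain \<delta> where \<delta>: "\<delta> > 0" "\<And>v. v \<in> ball v0 \<delta> \<Longrightarrow> f v = f (mirror2 T v)" by (auto simp: v0_def)
  define \<rho> where "\<rho> = min (min \<delta> r) e"
  have cyl: "pr 1 j x \<in> ball v0 \<delta>" "pr 1 j x \<in> ?B" "\<bar>x $ k - p $ k\<bar> < e" if "dist x p < \<rho>" for x
    using that dist_pr_le[OF fr, of x p] component_le_norm_cart[of "x - p" k] norm_minus_commute[of x p]
    by (auto simp: \<rho>_def v0_def dist_commute dist_norm)
  have xk: "x $ k = f (pr 1 j x)" if "x \<in> M" "dist x p < \<rho>" for x
    using d(5)[of x] cyl[OF that(2)] that(1) by (simp add: v0_def)
  show thesis
  proof (rule that[of \<rho>])
    show "\<rho> > 0" using \<delta> d by (simp add: \<rho>_def)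
    fix x assume x: "x \<in> M" "dist x p < \<rho>"
    have pm: "pr 1 j (mirror T x) = mirror2 T (pr 1 j x)" using jk by (simp add: vec_eq_iff forall_2 mirror_nth)
    have "pr 1 j (mirror T x) \<in> ?B" unfolding pm using inb cyl(2)[OF x(2)] by blast
    moreover have "mirror T x $ k = f (pr 1 j (mirror T x))"
      unfolding pm using \<delta>(2)[OF cyl(1)[OF x(2)]] xk[OF x] jk by (simp add: mirror_nth)
    moreover have "\<bar>mirror T x $ k - p $ k\<bar> < e" using cyl(3)[OF x(2)] jk by (simp add: mirror_nth)
    ultimately show "mirror T x \<in> M" using d(5)[of "mirror T x"] by (simp add: v0_def)
    show "N x $ 1 = 0" if xT: "x $ 1 = T"
    proof -
      let ?v = "pr 1 j x"
      have vB: "?v \<in> ?B" by (rule cyl(2)[OF x(2)])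
      have rv: "mirror2 T ?v = ?v" using xT by (simp add: vec_eq_iff forall_2)
      have df: "(f has_derivative (\<lambda>h. partial 1 f ?v * h $ 1 + partial 2 f ?v * h $ 2)) (at ?v)"
        by (rule smooth_partials(1)[OF open_ball fs vB])
      then have df': "(f has_derivative (\<lambda>h. partial 1 f ?v * h $ 1 + partial 2 f ?v * h $ 2)) (at (mirror2 T ?v))" by (simp add: rv)
      have "((\<lambda>v. f (mirror2 T v)) has_derivative (\<lambda>h. partial 1 f ?v * h $ 1 + partial 2 f ?v * h $ 2)) (at ?v)"
        by (rule has_derivative_transform_within_open[OF df open_ball cyl(1)[OF x(2)] \<delta>(2)])
      from has_derivative_unique[OF this has_derivative_compose[OF has_derivative_mirror2 df']]
      have "partial 1 f ?v = 0" by (auto simp: fun_eq_iff axis_def dest!: spec[of _ "axis 1 1"])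
      moreover have "gpt 1 j k ?v (f ?v) = x" using xk[OF x] gpt_pr[OF fr, of x] by simp
      ultimately show ?thesis using normal_iff[OF vB] by simp
    qed
  qed
qed

text \<open>The points where \<open>M\<close> is in contact with its mirror image. On the mirror itself every point is fixed, and
  contact means that the tangent plane contains the \<open>x\<close>-direction.\<close>

definition contact_set :: "(real^3) set" where
  "contact_set = {p \<in> S. mirror T p \<in> S \<and> (p $ 1 = T \<longrightarrow> N p $ 1 = 0)}"

lemma contact_set_open:
  assumes p: "p \<in> contact_set"
  shows "\<exists>\<delta>>0. \<forall>x\<in>S. dist x p < \<delta> \<longrightarrow> x \<in> contact_set"
proof -
  have pS: "p \<in> S" "mirror T p \<in> S" and pT: "p $ 1 = T \<longrightarrow> N p $ 1 = 0" using p by (auto simp: contact_set_def)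
  have m1: "2 * T - p $ 1 > 0" using pS(2) by (simp add: S_iff mirror_nth)
  have x1: "\<bar>x $ 1 - p $ 1\<bar> \<le> dist x p" for x using component_le_norm_cart[of "x - p" 1] by (simp add: dist_norm)
  have mS: "mirror T x \<in> S" if "mirror T x \<in> M" "dist x p < 2 * T - p $ 1" for x
    using that x1[of x] by (simp add: S_iff mirror_nth)
  show ?thesis
  proof (cases "p $ 1 = T")
    case True
    obtain \<delta> where \<delta>: "\<delta> > 0" "\<And>x. x \<in> M \<Longrightarrow> dist x p < \<delta> \<Longrightarrow> mirror T x \<in> M"
      "\<And>x. x \<in> M \<Longrightarrow> dist x p < \<delta> \<Longrightarrow> x $ 1 = T \<Longrightarrow> N x $ 1 = 0"
      using contact_vertical_point[OF pS(1) True] pT True by blast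
    show ?thesis
      by (rule exI[of _ "min \<delta> (2 * T - p $ 1)"]) (use \<delta> m1 mS in \<open>auto simp: contact_set_def S_iff\<close>)
  next
    case False
    define y a b where "y = pr 2 3 p" and "a = max (p $ 1) (2 * T - p $ 1)" and "b = min (p $ 1) (2 * T - p $ 1)"
    have e1: "pt y (p $ 1) = p" by (simp add: y_def pt_pr)
    have e2: "pt y (2 * T - p $ 1) = mirror T p" by (rule pt_eqI) (simp_all add: y_def vec_eq_iff forall_2 mirror_nth)
    have "b > 0" "b < a" "a + b = 2 * T" using False m1 pS(1) by (auto simp: a_def b_def S_iff max_def min_def)
    moreover have "pt y a \<in> M" "pt y b \<in> M" using e1 e2 pS by (auto simp: a_def b_def max_def min_def S_iff)
    ultimately obtain \<delta> where \<delta>: "\<delta> > 0" "\<And>x. x \<in> M \<Longrightarrow> dist x (pt y a) < \<delta> \<or> dist x (pt y b) < \<delta> \<Longrightarrow> mirror T x \<in> M"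
      using contact_pair by metis
    have "p = pt y a \<or> p = pt y b" using e1 by (auto simp: a_def b_def max_def min_def)
    then have \<delta>': "mirror T x \<in> M" if "x \<in> M" "dist x p < \<delta>" for x using \<delta>(2)[OF that(1)] that(2) by auto
    define d where "d = min (min \<delta> (2 * T - p $ 1)) \<bar>p $ 1 - T\<bar>"
    have "x \<in> contact_set" if x: "x \<in> S" "dist x p < d" for x
    proof -
      have "x $ 1 \<noteq> T" using x1[of x] x(2) by (auto simp: d_def)
      then show ?thesis using x \<delta>'[of x] mS[of x] by (auto simp: contact_set_def d_def S_iff)
    qed
    moreover have "d > 0" using \<delta>(1) m1 False by (simp add: d_def)
    ultimately show ?thesis by blast
  qed
qed

lemma closed_mirror: "closed {x. mirror T x \<in> M}"
  using continuous_closed_vimage[of M "mirror T"] compact_imp_closed[OF compact]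
    continuous_on_mirror[OF continuous_on_id, of UNIV T]
  by (simp add: vimage_def continuous_on_eq_continuous_at)

text \<open>Two things could go wrong in the limit. The mirror image cannot reach \<open>\<Gamma>\<close>, by
  \<open>no_high_boundary_column\<close>. Near a point of the mirror whose tangent plane does not contain the \<open>x\<close>-direction,
  each column meets \<open>M\<close> at most once nearby; a contact point there would lie on the mirror, where contact
  means the opposite.\<close>

lemma contact_set_closed:
  assumes p: "p \<in> S" "p \<in> closure contact_set"
  shows "p \<in> contact_set"
proof -
  have "contact_set \<subseteq> {x. mirror T x \<in> M}" by (auto simp: contact_set_def S_iff)
  then have mM: "mirror T p \<in> M" using closure_minimal[OF _ closed_mirror] p(2) by blast
  have pM: "p \<in> M" using p by (simp add: S_iff)
  have "mirror T p $ 1 \<noteq> 0"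
  proof
    assume z: "mirror T p $ 1 = 0"
    define q where "q = pr 2 3 p"
    have "mirror T p = pt q 0" by (rule pt_eqI) (use z in \<open>simp_all add: q_def vec_eq_iff forall_2 mirror_nth\<close>)
    then have "q \<in> C" using mM by (simp add: C_iff)
    moreover have "p = pt q (2 * T)" by (rule pt_eqI) (use z in \<open>simp_all add: q_def mirror_nth\<close>)
    ultimately show False using no_high_boundary_column pM by blast
  qed
  then have mS: "mirror T p \<in> S" using mM M_nonneg[OF mM] by (simp add: S_iff)
  have "N p $ 1 = 0" if pT: "p $ 1 = T"
  proof (rule ccontr)
    assume N1: "N p $ 1 \<noteq> 0"
    obtain r e f where lg: "local_graph M 2 3 1 p r e f"
      using interior_local_graph[OF p(1) frame3_231 N1 zero_less_one] by blast
    note d = local_graphD[OF lg]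
    have "min r e > 0" using d by simp
    then obtain x where x: "x \<in> contact_set" "dist x p < min r e"
      using p(2) unfolding closure_approachable by blast
    have pmx: "pr 2 3 (mirror T x) = pr 2 3 x" by (simp add: vec_eq_iff forall_2 mirror_nth)
    have x1: "\<bar>x $ 1 - p $ 1\<bar> < e" using component_le_norm_cart[of "x - p" 1] x(2) by (simp add: dist_norm)
    have xb: "pr 2 3 x \<in> ball (pr 2 3 p) r" using dist_pr_le[OF frame3_231, of x p] x(2) by (simp add: dist_commute)
    have xM: "x \<in> M" "mirror T x \<in> M" using x(1) by (auto simp: contact_set_def S_iff)
    have a: "x $ 1 = f (pr 2 3 x)" using d(5)[OF xb x1] xM by simp
    have "\<bar>mirror T x $ 1 - p $ 1\<bar> < e" using x1 pT by (simp add: mirror_nth)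
    then have "mirror T x $ 1 = f (pr 2 3 x)" using d(5)[of "mirror T x"] xM xb by (simp add: pmx)
    then have "x $ 1 = T" using a by (simp add: mirror_nth)
    then have "N x $ 1 = 0" using x(1) by (simp add: contact_set_def)
    moreover have "pt (pr 2 3 x) (f (pr 2 3 x)) = x" using a pt_pr[of x] by simp
    ultimately show False using local_graph_normal(2)[OF cmc frame3_231 lg xb] by simp
  qed
  then show ?thesis using p(1) mS by (simp add: contact_set_def)
qed

lemma contact_set_empty: "contact_set = {}"
proof (rule ccontr)
  assume ne: "contact_set \<noteq> {}"
  have sub: "contact_set \<subseteq> S" by (auto simp: contact_set_def)
  have "openin (top_of_set S) contact_set"
    unfolding openin_euclidean_subtopology_iff using sub contact_set_open by blast
  moreover have "closedin (top_of_set S) contact_set"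
    unfolding closedin_closed
  proof (intro exI[of _ "closure contact_set"] conjI)
    show "contact_set = S \<inter> closure contact_set" using contact_set_closed sub closure_subset by blast
  qed simp
  ultimately have "contact_set = S" using connected_S ne unfolding connected_clopen by blast
  then have "S \<subseteq> {x. mirror T x \<in> M}" by (auto simp: contact_set_def S_iff)
  then have cl: "closure S \<subseteq> {x. mirror T x \<in> M}" using closure_minimal[OF _ closed_mirror] by blast
  obtain q where q: "q \<in> C" using C_nonempty by blast
  then have "pt q 0 \<in> \<Gamma>" by (simp add: C_def P_point_eq)
  then have "pt q 0 \<in> closure S" using half_disc by blast
  then have "mirror T (pt q 0) \<in> M" using cl by blast
  moreover have "mirror T (pt q 0) = pt q (2 * T)" by (rule pt_eqI) (simp_all add: vec_eq_iff forall_2 mirror_nth)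
  ultimately show False using no_high_boundary_column[OF q] by simp
qed

text \<open>A maximal pair is a contact point.\<close>

lemma no_maximal_pair:
  assumes pp: "(p, p') \<in> reflection_pairs" and sum: "p $ 1 + p' $ 1 = 2 * T"
  shows False
proof -
  have "p \<in> contact_set"
  proof (cases "p = p'")
    case True
    then have "p $ 1 = T" "p \<in> S" "N p $ 1 = 0" using pp sum by (auto simp: reflection_pairs_def)
    moreover have "mirror T p = p" using \<open>p $ 1 = T\<close> by (simp add: vec_eq_iff mirror_nth)
    ultimately show ?thesis by (simp add: contact_set_def)
  next
    case False
    then have *: "p \<in> M" "p' \<in> M" "pr 2 3 p = pr 2 3 p'" "p' $ 1 < p $ 1" using pp by (auto simp: reflection_pairs_def)
    have m: "mirror T p = p'"
      by (rule pt_eqI) (use * sum in \<open>simp_all add: vec_eq_iff forall_2 mirror_nth\<close>)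
    have "p' $ 1 \<noteq> 0"
    proof
      assume z: "p' $ 1 = 0"
      define q where "q = pr 2 3 p"
      have "p' = pt q 0" by (rule pt_eqI) (use z * in \<open>simp_all add: q_def\<close>)
      then have "q \<in> C" using *(2) by (simp add: C_iff)
      moreover have "p = pt q (2 * T)" by (rule pt_eqI) (use z sum in \<open>simp_all add: q_def\<close>)
      ultimately show False using no_high_boundary_column *(1) by blast
    qed
    then have "p' \<in> S" using * M_nonneg[of p'] by (simp add: S_iff)
    then show ?thesis using * sum m M_nonneg[of p'] by (auto simp: contact_set_def S_iff)
  qed
  then show False using contact_set_empty by blast
qed

end

lemma no_reflection_pairs: "reflection_pairs = {}"
  using maximal_pair no_maximal_pair by metis

end

section \<open>The surface is a graph\<close>

context surface_over_domain
begin

lemma pr_inj: "x \<in> M \<Longrightarrow> x' \<in> M \<Longrightarrow> pr 2 3 x = pr 2 3 x' \<Longrightarrow> x = x'"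
proof (rule ccontr)
  assume x: "x \<in> M" "x' \<in> M" "pr 2 3 x = pr 2 3 x'" "x \<noteq> x'"
  then have "x $ 1 \<noteq> x' $ 1" using pt_eqI by blast
  then have "(x, x') \<in> reflection_pairs \<or> (x', x) \<in> reflection_pairs"
    using x by (auto simp: reflection_pairs_def)
  then show False using no_reflection_pairs by simp
qed

lemma N1_nonzero: "x \<in> S \<Longrightarrow> N x $ 1 \<noteq> 0"
  using no_reflection_pairs by (auto simp: reflection_pairs_def)

lemma S_local_graph:
  assumes "p \<in> S"
  obtains r f where "r > 0" "smooth_on (ball (pr 2 3 p) r) f" "\<And>v. v \<in> ball (pr 2 3 p) r \<Longrightarrow> pt v (f v) \<in> S"
proof -
  have p1: "p $ 1 > 0" using assms by (simp add: S_iff)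
  obtain r e f where lg: "local_graph M 2 3 1 p r e f" and e: "e < p $ 1"
    using interior_local_graph[OF assms frame3_231 N1_nonzero[OF assms] p1] by blast
  note d = local_graphD[OF lg]
  show thesis
  proof (rule that[OF d(1) d(3)])
    fix v assume v: "v \<in> ball (pr 2 3 p) r"
    have "f v > 0" using d(4)[OF v] e by linarith
    then show "pt v (f v) \<in> S" using local_graph_mem[OF frame3_231 lg v] by (simp add: S_iff)
  qed
qed

lemma projection_disjoint: "pr 2 3 ` S \<inter> C = {}"
proof -
  have False if x: "x \<in> S" "pr 2 3 x \<in> C" for x
  proof -
    have "x = pt (pr 2 3 x) 0" using x by (intro pr_inj) (auto simp: S_iff C_iff)
    then show False using x(1) by (metis S_iff less_irrefl pt_nth(1))
  qed
  then show ?thesis by blast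
qed

lemma projection_union: "pr 2 3 ` M = pr 2 3 ` S \<union> C"
proof
  show "pr 2 3 ` M \<subseteq> pr 2 3 ` S \<union> C" using \<Gamma>_pt by (auto simp: S_def)
  have "q \<in> pr 2 3 ` M" if "q \<in> C" for q using that by (force simp: C_iff image_iff intro: bexI[of _ "pt q 0"])
  then show "pr 2 3 ` S \<union> C \<subseteq> pr 2 3 ` M" by (auto simp: S_def)
qed

lemma open_projection: "open (pr 2 3 ` S)"
  unfolding open_contains_ball
proof
  fix y assume "y \<in> pr 2 3 ` S"
  then obtain p where p: "p \<in> S" "y = pr 2 3 p" by blast
  obtain r f where r: "r > 0" "\<And>v. v \<in> ball (pr 2 3 p) r \<Longrightarrow> pt v (f v) \<in> S" using S_local_graph[OF p(1)] by metis
  have "ball y r \<subseteq> pr 2 3 ` S"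
  proof
    fix v assume "v \<in> ball y r"
    then have "pt v (f v) \<in> S" using r(2) p(2) by blast
    then show "v \<in> pr 2 3 ` S" by (metis image_eqI pr_pt)
  qed
  then show "\<exists>e>0. ball y e \<subseteq> pr 2 3 ` S" using r(1) by blast
qed

lemma compact_projection: "compact (pr 2 3 ` M)"
  by (intro compact_continuous_image compact continuous_on_pr continuous_on_id)

text \<open>The projection of the interior is open, and closed in the complement of \<open>C\<close>; so it is a union of
  components of that complement.\<close>

lemma component_dichotomy:
  assumes K: "connected K" "K \<inter> C = {}" shows "K \<subseteq> pr 2 3 ` S \<or> K \<inter> pr 2 3 ` S = {}"
proof -
  have "openin (top_of_set K) (K \<inter> pr 2 3 ` S)" using open_projection by (simp add: openin_open_Int)
  moreover have "K \<inter> pr 2 3 ` S = K \<inter> pr 2 3 ` M" using K(2) projection_union by blast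
  then have "closedin (top_of_set K) (K \<inter> pr 2 3 ` S)"
    using compact_imp_closed[OF compact_projection] by (simp add: closedin_closed_Int)
  ultimately have "K \<inter> pr 2 3 ` S = {} \<or> K \<inter> pr 2 3 ` S = K"
    using K(1) unfolding connected_clopen by blast
  then show ?thesis by blast
qed

lemma projection_interior: "pr 2 3 ` S = D"
proof
  have "\<not> Ext \<subseteq> pr 2 3 ` S"
  proof
    assume "Ext \<subseteq> pr 2 3 ` S"
    then have "Ext \<subseteq> pr 2 3 ` M" using projection_union by blast
    then have "bounded Ext" using compact_imp_bounded[OF compact_projection] bounded_subset by blast
    then have "bounded (Ext \<union> - Ext)" using bounded_compl_Ext by (simp only: bounded_Un)
    then show False using not_bounded_UNIV by (metis Compl_partition)
  qed
  moreover have "Ext \<inter> C = {}" using domains(1) by blast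
  ultimately have "Ext \<inter> pr 2 3 ` S = {}" using component_dichotomy[OF domains(6)] by blast
  then show "pr 2 3 ` S \<subseteq> D" using projection_disjoint domains(1) by blast
  show "D \<subseteq> pr 2 3 ` S"
  proof
    fix y assume "y \<in> D"
    then obtain K where K: "K \<in> components (- C)" "K \<subseteq> D" "y \<in> K" using component_inside by blast
    have KC: "connected K" "K \<inter> C = {}" using K(1) in_components_connected in_components_subset by blast+
    obtain q where q: "q \<in> C" using C_nonempty by blast
    then have "q \<in> closure K" using frontier_component[OF K(1)] by (auto simp: frontier_def)
    obtain W where W: "open W" "A = closure D \<inter> W" using A(1) by (auto simp: openin_open)
    have "q \<in> W" using q A_subset(2) W(2) by blast
    then obtain y' where y': "y' \<in> K" "y' \<in> W"
      using \<open>q \<in> closure K\<close> W(1) open_Int_closure_eq_empty[of W K] by blast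
    then have "y' \<in> A" using W(2) K(2) closure_subset by blast
    then have "pt y' (u y') \<in> M" by (rule u_mem)
    moreover have "y' \<notin> C" using y' KC by blast
    ultimately have "y' \<in> pr 2 3 ` S" using projection_union by (metis UnE image_eqI pr_pt)
    then have "K \<subseteq> pr 2 3 ` S" using component_dichotomy[OF KC] y'(1) by blast
    then show "y \<in> pr 2 3 ` S" using K(3) by blast
  qed
qed

lemma projection_M: "pr 2 3 ` M = closure D"
  using projection_union projection_interior closure_D by simp

lemma killing_graph_M: "killing_graph (closure D) M"
proof -
  define g where "g q = the_inv_into M (pr 2 3) q" for q
  have inj: "inj_on (pr 2 3) M" using pr_inj by (auto simp: inj_on_def)
  have gx: "g (pr 2 3 x) = x" if "x \<in> M" for x
    unfolding g_def by (rule the_inv_into_f_f[OF inj that])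
  have cg: "continuous_on (closure D) g"
    unfolding projection_M[symmetric]
    by (rule continuous_on_inv[OF _ compact]) (use gx in \<open>auto intro: continuous_on_pr continuous_on_id\<close>)
  define U where "U q = g q $ 1" for q
  have U: "U q = s" if "pt q s \<in> M" for q s using gx[OF that] by (simp add: U_def)
  have "continuous_on (closure D) U" unfolding U_def by (intro continuous_intros cg)
  moreover have "smooth_on (interior (closure D)) U"
    unfolding smooth_on_def interior_closure_D
  proof (intro allI Ck_on_open_Union)
    fix n y assume "y \<in> D"
    then obtain p where p: "p \<in> S" "y = pr 2 3 p" using projection_interior by blast
    obtain r f where r: "r > 0" "smooth_on (ball (pr 2 3 p) r) f" "\<And>v. v \<in> ball (pr 2 3 p) r \<Longrightarrow> pt v (f v) \<in> S"
      using S_local_graph[OF p(1)] by metis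
    have fU: "f v = U v" if "v \<in> ball y r" for v using U[of v "f v"] r(3)[of v] that p(2) by (simp add: S_iff)
    have "Ck_on n f (ball y r)" using r(2) p(2) unfolding smooth_on_def by blast
    from Ck_on_cong[OF open_ball this fU] have "Ck_on n U (ball y r)" .
    moreover have "y \<in> ball y r" using r(1) by simp
    ultimately show "\<exists>T. open T \<and> y \<in> T \<and> Ck_on n U T" using open_ball by blast
  qed
  moreover have "M = (\<lambda>q. killing_flow (U q) (P_point q)) ` closure D"
  proof -
    have "x = pt (pr 2 3 x) (U (pr 2 3 x))" if "x \<in> M" for x using gx[OF that] pt_pr[of x] by (simp add: U_def)
    then show ?thesis unfolding killing_flow_P_point projection_M[symmetric] by (force simp: image_image)
  qed
  ultimately show ?thesis unfolding killing_graph_def by blast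
qed

end

lemma cmc_imp_normal:
  assumes "constant_mean_curvature M" obtains N H where "cmc_normal M N H"
  using assms unfolding constant_mean_curvature_def cmc_normal_def by blast

lemma graph_over_positive_side:
  fixes M \<Gamma> :: "(real^3) set" and D :: "(real^2) set"
  assumes "compact M" and "connected M" and "embedded_surface M"
    and "cmc_normal M N H"
    and "\<Gamma> = surface_boundary M" and "closed_curve \<Gamma>" and "\<Gamma> \<subseteq> plane_P"
    and "D = bounded_domain \<Gamma>"
    and "M \<subseteq> {p. p $ 1 \<ge> 0}" "M - \<Gamma> \<subseteq> {p. p $ 1 > 0}"
    and "graph_around M D \<Gamma>"
  shows "killing_graph (closure D) M"
proof -
  obtain V A u where VA: "openin (top_of_set M) V" "\<Gamma> \<subseteq> V" "openin (top_of_set (closure D)) A" "P_point -` \<Gamma> \<subseteq> A"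
    "V = (\<lambda>q. killing_flow (u q) (P_point q)) ` A"
    using assms(11) unfolding graph_around_def killing_graph_def by blast
  interpret surface_over_domain M \<Gamma> D N H V A u
    by unfold_locales (use assms VA in \<open>simp_all add: killing_flow_P_point\<close>)
  show ?thesis by (rule killing_graph_M)
qed

lemma mirror_pt: "mirror 0 (pt q s) = pt q (- s)"
  by (rule pt_eqI) (simp_all add: vec_eq_iff forall_2 mirror_nth)

lemma killing_graph_mirror:
  assumes "killing_graph A V" shows "killing_graph A (mirror 0 ` V)"
proof -
  obtain u where u: "continuous_on A u" "smooth_on (interior A) u" "V = (\<lambda>q. pt q (u q)) ` A"
    using assms unfolding killing_graph_def killing_flow_P_point by blast
  have "Ck_on k (\<lambda>q. -1 * u q) (interior A)" for k
    using u(2) by (intro Ck_on_mult Ck_on_const open_interior) (simp add: smooth_on_def)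
  then have "smooth_on (interior A) (\<lambda>q. - u q)" by (simp add: smooth_on_def)
  moreover have "continuous_on A (\<lambda>q. - u q)" using u(1) by (intro continuous_intros)
  moreover have "mirror 0 ` V = (\<lambda>q. pt q (- u q)) ` A" unfolding u(3) image_image mirror_pt ..
  ultimately show ?thesis unfolding killing_graph_def killing_flow_P_point by blast
qed

theorem theorem3p4:
  fixes M \<Gamma> :: "(real^3) set" and D :: "(real^2) set"
  assumes "compact M" and "connected M" and "embedded_surface M"
    and "constant_mean_curvature M"
    and "\<Gamma> = surface_boundary M" and "closed_curve \<Gamma>" and "\<Gamma> \<subseteq> plane_P"
    and "D = bounded_domain \<Gamma>"
    and "one_side_of_P M"
    and "graph_around M D \<Gamma>"
  shows "killing_graph (closure D) M"
proof -
  obtain N H where N: "cmc_normal M N H" using cmc_imp_normal[OF assms(4)] by blast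
  consider "M \<subseteq> {p. p $ 1 \<ge> 0}" "M - \<Gamma> \<subseteq> {p. p $ 1 > 0}" | "M \<subseteq> {p. p $ 1 \<le> 0}" "M - \<Gamma> \<subseteq> {p. p $ 1 < 0}"
    using assms(9) unfolding one_side_of_P_def assms(5) by blast
  then show ?thesis
  proof cases
    case 1
    then show ?thesis
      using graph_over_positive_side[OF assms(1-3) N assms(5-8) _ _ assms(10)] by blast
  next
    case 2
    \<comment> \<open>the reflection in \<open>P\<close> fixes \<open>\<Gamma>\<close> and exchanges the two sides\<close>
    let ?M = "mirror 0 ` M"
    have fix\<Gamma>: "mirror 0 x = x" if "x \<in> \<Gamma>" for x
      using that assms(7) by (auto simp: vec_eq_iff mirror_nth plane_P_def)
    then have m\<Gamma>: "mirror 0 ` \<Gamma> = \<Gamma>" by force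
    have "graph_around ?M D \<Gamma>"
    proof -
      obtain V A where VA: "openin (top_of_set M) V" "\<Gamma> \<subseteq> V" "openin (top_of_set (closure D)) A" "P_point -` \<Gamma> \<subseteq> A" "killing_graph A V"
        using assms(10) unfolding graph_around_def by blast
      have "\<Gamma> \<subseteq> mirror 0 ` V" using m\<Gamma> VA(2) by blast
      then show ?thesis unfolding graph_around_def using VA openin_mirror[OF VA(1), of 0] killing_graph_mirror[OF VA(5)] by blast
    qed
    moreover have "?M - \<Gamma> \<subseteq> {p. p $ 1 > 0}"
    proof
      fix x assume x: "x \<in> ?M - \<Gamma>"
      then have "mirror 0 x \<in> M" by (simp add: mirror_image_iff)
      moreover have "mirror 0 x \<notin> \<Gamma>" using x fix\<Gamma> m\<Gamma> by (metis Diff_iff mirror_mirror)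
      ultimately have "mirror 0 x $ 1 < 0" using 2(2) by blast
      then show "x \<in> {p. p $ 1 > 0}" by (simp add: mirror_nth)
    qed
    moreover have "?M \<subseteq> {p. p $ 1 \<ge> 0}" using 2(1) by (auto simp: mirror_nth)
    moreover have "compact ?M" "connected ?M"
      using assms(1,2) by (auto intro!: compact_continuous_image connected_continuous_image continuous_on_mirror continuous_on_id)
    moreover have "\<Gamma> = surface_boundary ?M" using m\<Gamma> surface_boundary_mirror[of 0 M] assms(5) by simp
    ultimately have "killing_graph (closure D) ?M"
      using graph_over_positive_side[OF _ _ embedded_surface_mirror[OF assms(3)] cmc_normal_mirror[OF N] _ assms(6-8)] by blast
    from killing_graph_mirror[OF this] show ?thesis by simp
  qed
qed

end
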